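(* Let $a<b$, $\alpha,\beta>0$, $\mu\in\mathbb{C}$, let $H:\mathbb{R}^d\times\mathbb{C}^d\to\mathbb{C}$, $(x,p)\mapsto H(x,p)$, be a Hamiltonian function, and let $F$ be the functional $$F(x,\mathbf p)=\int_a^b\left(\mathbf p(t)\,\mathcal{D}^{\alpha,\beta}_{\mu}x(t)-H(x(t),\mathbf p(t))\right)dt.$$ A couple $(x(t),\mathbf p(t))$ with $x(a)=x_a$, $\mathbf p(a)=\mathbf p_a$, $x(b)=x_b$, $\mathbf p(b)=\mathbf p_b$ is an extremal of $F$ if and only if it satisfies the fractional Hamiltonian equations $$\mathcal{D}^{\alpha,\beta}_{\mu}x(t)=\frac{\partial H}{\partial p}(x(t),\mathbf p(t)),\qquad \mathcal{D}^{\beta,\alpha}_{-\mu}\mathbf p(t)=-\frac{\partial H}{\partial x}(x(t),\mathbf p(t)).$$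
   Context: For $\alpha>0$ and $n\in\mathbb{N}$ with $n-1\le\alpha<n$: ${}_aD_t^{\alpha}x(t)=\frac{1}{\Gamma(n-\alpha)}\left(\frac{d}{dt}\right)^n\int_a^t(t-s)^{n-\alpha-1}x(s)\,ds$ and ${}_tD_b^{\alpha}x(t)=\frac{1}{\Gamma(n-\alpha)}\left(-\frac{d}{dt}\right)^n\int_t^b(s-t)^{n-\alpha-1}x(s)\,ds$. $\mathcal{D}^{\alpha,\beta}_{\mu}=\frac12\left[{}_aD_t^{\alpha}-{}_tD_b^{\beta}\right]+\frac{i\mu}{2}\left[{}_aD_t^{\alpha}+{}_tD_b^{\beta}\right]$, and $\mathcal{D}^{\beta,\alpha}_{-\mu}$ is obtained by exchanging $\alpha,\beta$ and replacing $\mu$ by $-\mu$. ${}_a^{\alpha}\mathbf{E}_b^{\beta}$ is the set of continuous functions on $[a,b]$ for which ${}_aD_t^{\alpha}$ and ${}_tD_b^{\beta}$ exist. The functional $F$ is regarded as the fractional functional, in the unknown $(x,\mathbf p)$, of the Lagrangian $\mathbf{L}(x,\mathbf p,v,w)=\mathbf p\,v-H(x,\mathbf p)$ evaluated at $v=\mathcal{D}^{\alpha,\beta}_{\mu}x$, $w=\mathcal{D}^{\alpha,\beta}_{\mu}\mathbf p$. Variations are pairs $h$ of functions in ${}_a^{\alpha}\mathbf{E}_b^{\beta}$ vanishing at $a$ and $b$. A couple $z=(x,\mathbf p)$ is an extremal if $F(z+\epsilon h)-F(z)=\epsilon\,dF(z,h)+o(\epsilon)$ for all such $h$, with $dF(z,h)$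 linear in $h$, and $dF(z,h)=0$ for all such $h$.
   Formalization: For α or β in {2,3,…} "equations ⇒ extremal" is false (α=β=2, μ=1, H=0, x=0, p=const≠0), so there p's derivatives of order ≤ α−2, β−2 must vanish at a, b. Derivatives in E exist on (a,b) and are integrable; p is also in E^{β,α}; H is C¹, holomorphic in p. *)

theory Defs
  imports "HOL-Analysis.Analysis" "HOL-Library.Landau_Symbols"
begin

definition vderiv :: "(real \<Rightarrow> 'v::real_normed_vector) \<Rightarrow> real \<Rightarrow> 'v" where
  "vderiv f = (\<lambda>t. vector_derivative f (at t))"

definition times_differentiable_on ::
    "nat \<Rightarrow> (real \<Rightarrow> 'v::real_normed_vector) \<Rightarrow> real set \<Rightarrow> bool" where
  "times_differentiable_on n f S \<longleftrightarrow>
     (\<forall>k<n. \<forall>t\<in>S. (vderiv ^^ k) f differentiable (at t))"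

text \<open>The integer \<open>n\<close> with \<open>n - 1 \<le> \<alpha> < n\<close>; note that it is \<open>m + 1\<close> for
  \<open>\<alpha> = m\<close> a natural number.\<close>

definition frac_n :: "real \<Rightarrow> nat" where
  "frac_n \<alpha> = nat \<lfloor>\<alpha>\<rfloor> + 1"

definition left_kernel_int :: "real \<Rightarrow> real \<Rightarrow> (real \<Rightarrow> 'v::euclidean_space) \<Rightarrow> real \<Rightarrow> 'v" where
  "left_kernel_int \<alpha> a x =
     (\<lambda>t. integral {a..t} (\<lambda>s. ((t - s) powr (real (frac_n \<alpha>) - \<alpha> - 1)) *\<^sub>R x s))"

definition right_kernel_int :: "real \<Rightarrow> real \<Rightarrow> (real \<Rightarrow> 'v::euclidean_space) \<Rightarrow> real \<Rightarrow> 'v" where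
  "right_kernel_int \<alpha> b x =
     (\<lambda>t. integral {t..b} (\<lambda>s. ((s - t) powr (real (frac_n \<alpha>) - \<alpha> - 1)) *\<^sub>R x s))"

definition left_RL :: "real \<Rightarrow> real \<Rightarrow> (real \<Rightarrow> 'v::euclidean_space) \<Rightarrow> real \<Rightarrow> 'v" where
  "left_RL \<alpha> a x t =
     (1 / Gamma (real (frac_n \<alpha>) - \<alpha>)) *\<^sub>R (vderiv ^^ frac_n \<alpha>) (left_kernel_int \<alpha> a x) t"

definition right_RL :: "real \<Rightarrow> real \<Rightarrow> (real \<Rightarrow> 'v::euclidean_space) \<Rightarrow> real \<Rightarrow> 'v" where
  "right_RL \<alpha> b x t =
     (1 / Gamma (real (frac_n \<alpha>) - \<alpha>)) *\<^sub>R
       ((-1) ^ frac_n \<alpha> *\<^sub>R (vderiv ^^ frac_n \<alpha>) (right_kernel_int \<alpha> b x) t)"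

text \<open>The derivatives are required to exist at every interior point of \<open>[a, b]\<close>, and to be
  integrable. At an endpoint they are not required to exist: for \<open>0 < \<alpha> < 1\<close> and
  \<open>x(a) \<noteq> 0\<close> the left derivative behaves like \<open>(t - a) powr (-\<alpha>)\<close> at \<open>a\<close>. Integrability is
  what makes the action functional below finite on the whole of this space.\<close>

definition frac_E :: "real \<Rightarrow> real \<Rightarrow> real \<Rightarrow> real \<Rightarrow> (real \<Rightarrow> 'v::euclidean_space) set" where
  "frac_E \<alpha> \<beta> a b =
     {x. continuous_on {a..b} x
       \<and> times_differentiable_on (frac_n \<alpha>) (left_kernel_int \<alpha> a x) {a<..<b}
       \<and> times_differentiable_on (frac_n \<beta>) (right_kernel_int \<beta> b x) {a<..<b}
       \<and> left_RL \<alpha> a x absolutely_integrable_on {a..b}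
       \<and> right_RL \<beta> b x absolutely_integrable_on {a..b}}"

definition frac_D :: "real \<Rightarrow> real \<Rightarrow> complex \<Rightarrow> real \<Rightarrow> real \<Rightarrow>
    (real \<Rightarrow> complex ^ 'd) \<Rightarrow> real \<Rightarrow> complex ^ 'd" where
  "frac_D \<alpha> \<beta> \<mu> a b x t =
     (1 / 2) *s (left_RL \<alpha> a x t - right_RL \<beta> b x t)
     + (\<i> * \<mu> / 2) *s (left_RL \<alpha> a x t + right_RL \<beta> b x t)"

definition cvec :: "real ^ 'd \<Rightarrow> complex ^ 'd" where
  "cvec v = (\<chi> i. complex_of_real (v $ i))"

text \<open>The product \<open>p v\<close> is the bilinear one, without complex conjugation.\<close>

definition cdot :: "complex ^ 'd \<Rightarrow> complex ^ 'd \<Rightarrow> complex" where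
  "cdot u v = (\<Sum>i\<in>UNIV. u $ i * v $ i)"

definition grad_x :: "(real ^ 'd \<Rightarrow> complex ^ 'd \<Rightarrow> complex) \<Rightarrow>
    real ^ 'd \<Rightarrow> complex ^ 'd \<Rightarrow> complex ^ 'd" where
  "grad_x H x p = (\<chi> i. vector_derivative (\<lambda>s. H (x + s *\<^sub>R axis i 1) p) (at 0))"

definition grad_p :: "(real ^ 'd \<Rightarrow> complex ^ 'd \<Rightarrow> complex) \<Rightarrow>
    real ^ 'd \<Rightarrow> complex ^ 'd \<Rightarrow> complex ^ 'd" where
  "grad_p H x p = (\<chi> i. deriv (\<lambda>z. H x (p + z *s axis i 1)) 0)"

text \<open>Continuously differentiable, and holomorphic in \<open>p\<close>, so that the derivative with
  respect to the complex variable \<open>p\<close> makes sense.\<close>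

definition hamiltonian_function :: "(real ^ 'd \<Rightarrow> complex ^ 'd \<Rightarrow> complex) \<Rightarrow> bool" where
  "hamiltonian_function H \<longleftrightarrow>
     (\<forall>x p. (\<lambda>y. H (fst y) (snd y)) differentiable (at (x, p)))
     \<and> (\<forall>x p i. (\<lambda>z. H x (p + z *s axis i 1)) field_differentiable (at 0))
     \<and> continuous_on UNIV (\<lambda>y. grad_x H (fst y) (snd y))
     \<and> continuous_on UNIV (\<lambda>y. grad_p H (fst y) (snd y))"

type_synonym 'd couple = "(real \<Rightarrow> real ^ 'd) \<times> (real \<Rightarrow> complex ^ 'd)"

definition action :: "(real ^ 'd \<Rightarrow> complex ^ 'd \<Rightarrow> complex) \<Rightarrow> real \<Rightarrow> real \<Rightarrow> complex \<Rightarrow>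
    real \<Rightarrow> real \<Rightarrow> 'd::finite couple \<Rightarrow> complex" where
  "action H \<alpha> \<beta> \<mu> a b z =
     integral {a..b} (\<lambda>t. cdot (snd z t) (frac_D \<alpha> \<beta> \<mu> a b (\<lambda>s. cvec (fst z s)) t)
                          - H (fst z t) (snd z t))"

definition variations :: "real \<Rightarrow> real \<Rightarrow> real \<Rightarrow> real \<Rightarrow> 'd::finite couple set" where
  "variations \<alpha> \<beta> a b =
     {h. fst h \<in> frac_E \<alpha> \<beta> a b \<and> snd h \<in> frac_E \<alpha> \<beta> a b
       \<and> fst h a = 0 \<and> fst h b = 0 \<and> snd h a = 0 \<and> snd h b = 0}"

definition lincomb :: "real \<Rightarrow> 'd::finite couple \<Rightarrow> real \<Rightarrow> 'd couple \<Rightarrow> 'd couple" where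
  "lincomb c h d k =
     (\<lambda>t. c *\<^sub>R fst h t + d *\<^sub>R fst k t, \<lambda>t. c *\<^sub>R snd h t + d *\<^sub>R snd k t)"

text \<open>\<open>dF\<close> stands for the map \<open>h \<mapsto> dF(z, h)\<close>. Linearity is over the reals, since the first
  components of variations are real.\<close>

definition has_differential ::
    "('d::finite couple \<Rightarrow> complex) \<Rightarrow> 'd couple set \<Rightarrow> 'd couple \<Rightarrow> ('d couple \<Rightarrow> complex) \<Rightarrow> bool"
  where
  "has_differential F V z dF \<longleftrightarrow>
     (\<forall>h\<in>V. \<forall>k\<in>V. \<forall>c d. dF (lincomb c h d k) = of_real c * dF h + of_real d * dF k)
     \<and> (\<forall>h\<in>V. (\<lambda>\<epsilon>::real. F (lincomb 1 z \<epsilon> h) - F z - of_real \<epsilon> * dF h)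
                \<in> o[at 0](\<lambda>\<epsilon>. of_real \<epsilon>))"

definition extremal ::
    "('d::finite couple \<Rightarrow> complex) \<Rightarrow> 'd couple set \<Rightarrow> 'd couple \<Rightarrow> bool" where
  "extremal F V z \<longleftrightarrow> (\<exists>dF. has_differential F V z dF \<and> (\<forall>h\<in>V. dF h = 0))"

definition fractional_hamilton_equations ::
    "(real ^ 'd \<Rightarrow> complex ^ 'd \<Rightarrow> complex) \<Rightarrow> real \<Rightarrow> real \<Rightarrow> complex \<Rightarrow> real \<Rightarrow> real \<Rightarrow>
      (real \<Rightarrow> real ^ 'd::finite) \<Rightarrow> (real \<Rightarrow> complex ^ 'd) \<Rightarrow> bool" where
  "fractional_hamilton_equations H \<alpha> \<beta> \<mu> a b x p \<longleftrightarrow>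
     (\<forall>t\<in>{a<..<b}. frac_D \<alpha> \<beta> \<mu> a b (\<lambda>s. cvec (x s)) t = grad_p H (x t) (p t)
                 \<and> frac_D \<beta> \<alpha> (- \<mu>) a b p t = - grad_x H (x t) (p t))"

text \<open>Vacuous unless \<open>\<gamma>\<close> is one of the integers \<open>2, 3, \<dots>\<close>. For these the Riemann-Liouville
  operators are ordinary derivatives of order \<open>\<gamma>\<close>, and integrating \<open>p D h\<close> by parts leaves the
  products of the derivatives of \<open>p\<close> of order \<open>k \<le> \<gamma> - 2\<close> with those of \<open>h\<close> of order
  \<open>\<gamma> - 1 - k \<ge> 1\<close> at \<open>a\<close> and \<open>b\<close>, which \<open>h(a) = h(b) = 0\<close> does not remove. Example:
  \<open>\<alpha> = \<beta> = 2\<close>, \<open>\<mu> = 1\<close>, \<open>H = 0\<close>, \<open>x = 0\<close>, \<open>p\<close> a nonzero constant solves the Hamiltonian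
  equations but is not an extremal.\<close>

definition natural_boundary :: "real \<Rightarrow> real \<Rightarrow> real \<Rightarrow> (real \<Rightarrow> 'v::euclidean_space) \<Rightarrow> bool" where
  "natural_boundary \<gamma> a b p \<longleftrightarrow>
     (\<gamma> \<in> \<nat> \<longrightarrow>
       (\<forall>k. real k + 1 < \<gamma> \<longrightarrow>
          ((vderiv ^^ k) p \<longlongrightarrow> 0) (at_right a) \<and> ((vderiv ^^ k) p \<longlongrightarrow> 0) (at_left b)))"

lemma natural_boundary_le_1: "\<gamma> \<le> 1 \<Longrightarrow> natural_boundary \<gamma> a b p"
  by (auto simp: natural_boundary_def)

lemma natural_boundary_non_integer: "\<gamma> \<notin> \<nat> \<Longrightarrow> natural_boundary \<gamma> a b p"
  by (auto simp: natural_boundary_def)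

end

theory Submission
  imports Defs
begin

text \<open>
  The action is differentiated along a variation \<open>(u, v)\<close>, which gives (\<open>action_has_derivative\<close>)
  \<open>\<integral> v (D x - \<partial>H/\<partial>p) + p D u - u \<partial>H/\<partial>x\<close>, with \<open>D\<close> the operator for \<open>(\<alpha>, \<beta>, \<mu>)\<close>. Being an
  extremal means that this vanishes for all variations. The two Hamilton equations appear
  once \<open>\<integral> p D u\<close> has been turned into \<open>- \<integral> u D' p\<close>, with \<open>D'\<close> the operator for \<open>(\<beta>, \<alpha>, -\<mu>)\<close>, so the
  theorem is a statement about fractional integration by parts.

  From extremals to equations, test functions suffice. For them integration by parts follows from Fubini's
  theorem and ordinary integration by parts (\<open>test_function_integration_by_parts\<close>), all boundary terms
  vanishing with the test function. The equations are obtained at every interior point, although a fractional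
  derivative need not be continuous: it is the pointwise derivative of some function, and a derivative
  that is orthogonal to all test functions vanishes everywhere (\<open>fundamental_lemma\<close>).

  From equations to extremals, the variation \<open>u\<close> is only continuous with integrable fractional
  derivatives and vanishes at the endpoints (\<open>fractional_integration_by_parts\<close>). For order below \<open>1\<close> the
  formula holds without boundary terms, by translating primitives
  (\<open>integration_by_parts_low_order\<close>). For order at least \<open>1\<close> both factors are represented as fractional
  integrals of their fractional derivatives plus powers of the distance to the endpoint
  (\<open>left_representation\<close>, from Taylor's formula and Abel inversion), and the formula becomes the
  statement that the contributions of these powers match
  (\<open>integration_by_parts_high_order\<close>). They match if the derivatives of \<open>p\<close> of low order vanish
  at the endpoints. For noninteger order this is automatic, because \<open>p\<close> has fractional derivatives of order
  \<open>\<alpha>\<close> from both sides: the left one forces powers of \<open>t - a\<close> with noninteger exponents at \<open>a\<close>, while the right one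
  forces smoothness there, and both together force vanishing (\<open>two_sided_noninteger_order\<close>).
  For integer orders it is what \<^const>\<open>natural_boundary\<close> asks for.
\<close>

section \<open>Towers of derivatives and the fractional regularity classes\<close>

lemma frac_n_bounds:
  assumes "0 < \<alpha>" shows "0 < real (frac_n \<alpha>) - \<alpha>" "real (frac_n \<alpha>) - \<alpha> \<le> 1"
  using assms unfolding frac_n_def by linarith+

text \<open>This makes the kernels integrable, since \<open>e = n - \<alpha> - 1 > -1\<close>.\<close>

lemma kernel_power_has_integral:
  fixes a t e :: real assumes "-1 < e" "a \<le> t"
  shows "((\<lambda>s. (t - s) powr e) has_integral (t - a) powr (e + 1) / (e + 1)) {a..t}"
proof -
  have "((\<lambda>u. u powr e) has_integral (t - a) powr (e + 1) / (e + 1)) {0..t - a}"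
    using has_integral_powr_from_0[of e "t - a"] assms by simp
  have "((\<lambda>u. (- u) powr e) has_integral (t - a) powr (e + 1) / (e + 1)) {- (t - a)..- 0}"
    using \<open>((\<lambda>u. u powr e) has_integral (t - a) powr (e + 1) / (e + 1)) {0..t - a}\<close>
    by (subst has_integral_reflect_real)
  from has_integral_shift_real_ivl[OF this, of "- t"] show ?thesis by simp
qed

text \<open>A tower carries the derivatives of its bottom function along explicitly. Every claim below about
  iterated derivatives is proved by exhibiting a tower; \<open>deriv_tower_vderiv\<close> then identifies its
  levels with the iterates of \<^const>\<open>vderiv\<close>. Linear maps and reflections commute with those
  iterates only where the derivatives exist.\<close>

definition deriv_tower :: "nat \<Rightarrow> (nat \<Rightarrow> real \<Rightarrow> 'v::real_normed_vector) \<Rightarrow> real set \<Rightarrow> bool" where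
  "deriv_tower n F S \<longleftrightarrow> (\<forall>k<n. \<forall>t\<in>S. (F k has_vector_derivative F (Suc k) t) (at t))"

lemma deriv_towerD:
  "deriv_tower n F S \<Longrightarrow> k < n \<Longrightarrow> t \<in> S \<Longrightarrow> (F k has_vector_derivative F (Suc k) t) (at t)"
  by (simp add: deriv_tower_def)

lemma has_vector_derivative_cong_open:
  assumes "open S" "t \<in> S" "\<And>s. s \<in> S \<Longrightarrow> f s = g s"
  shows "(f has_vector_derivative D) (at t) \<longleftrightarrow> (g has_vector_derivative D) (at t)"
proof -
  have "eventually (\<lambda>s. f s = g s) (nhds t)"
    using assms by (auto simp: eventually_nhds)
  then show ?thesis
    by (intro has_vector_derivative_cong_ev) (auto simp: assms elim: eventually_mono)
qed

lemma deriv_tower_vderiv: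
  assumes "open S" "deriv_tower n F S" "\<And>t. t \<in> S \<Longrightarrow> f t = F 0 t" "k \<le> n" "t \<in> S"
  shows "(vderiv ^^ k) f t = F k t"
  using assms(4,5)
proof (induction k arbitrary: t)
  case 0 then show ?case using assms by simp
next
  case (Suc k)
  have "((vderiv ^^ k) f has_vector_derivative F (Suc k) t) (at t)"
    using Suc assms(2)
    by (subst has_vector_derivative_cong_open[OF assms(1), of t _ "F k"]) (auto simp: deriv_tower_def)
  then show ?case by (simp add: vderiv_def[of "(vderiv ^^ k) f"] vector_derivative_at)
qed

lemma deriv_tower_times_differentiable:
  assumes "open S" "deriv_tower n F S" "\<And>t. t \<in> S \<Longrightarrow> f t = F 0 t"
  shows "times_differentiable_on n f S"
  unfolding times_differentiable_on_def
proof (intro allI impI ballI)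
  fix k t assume "k < n" "t \<in> S"
  then have "((vderiv ^^ k) f has_vector_derivative F (Suc k) t) (at t)"
    using assms(2) deriv_tower_vderiv[OF assms]
    by (subst has_vector_derivative_cong_open[OF assms(1), of t _ "F k"]) (auto simp: deriv_tower_def)
  then show "(vderiv ^^ k) f differentiable at t"
    by (rule differentiableI_vector)
qed

lemma times_differentiable_deriv_tower:
  "times_differentiable_on n f S \<Longrightarrow> deriv_tower n (\<lambda>k. (vderiv ^^ k) f) S"
  by (auto simp: times_differentiable_on_def deriv_tower_def vderiv_def
      vector_derivative_works[symmetric])

text \<open>The two one-sided halves of \<^const>\<open>frac_E\<close>. They are separated because integration by parts at
  order \<open>\<alpha>\<close> asks for different halves of its two factors.\<close>

definition left_reg :: "real \<Rightarrow> real \<Rightarrow> real \<Rightarrow> (real \<Rightarrow> 'v::euclidean_space) \<Rightarrow> bool" where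
  "left_reg \<alpha> a b x \<longleftrightarrow> continuous_on {a..b} x
     \<and> times_differentiable_on (frac_n \<alpha>) (left_kernel_int \<alpha> a x) {a<..<b}
     \<and> left_RL \<alpha> a x absolutely_integrable_on {a..b}"

definition right_reg :: "real \<Rightarrow> real \<Rightarrow> real \<Rightarrow> (real \<Rightarrow> 'v::euclidean_space) \<Rightarrow> bool" where
  "right_reg \<alpha> a b x \<longleftrightarrow> continuous_on {a..b} x
     \<and> times_differentiable_on (frac_n \<alpha>) (right_kernel_int \<alpha> b x) {a<..<b}
     \<and> right_RL \<alpha> b x absolutely_integrable_on {a..b}"

lemma frac_E_iff: "x \<in> frac_E \<alpha> \<beta> a b \<longleftrightarrow> left_reg \<alpha> a b x \<and> right_reg \<beta> a b x"
  by (auto simp: frac_E_def left_reg_def right_reg_def)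

lemma left_kernel_integrable:
  fixes x :: "real \<Rightarrow> 'v::euclidean_space"
  assumes "-1 < e" "a \<le> t" "t \<le> b" "continuous_on {a..b} x"
  shows "(\<lambda>s. ((t - s) powr e) *\<^sub>R x s) absolutely_integrable_on {a..t}"
proof -
  have c: "continuous_on {a..t} x" using assms by (auto intro: continuous_on_subset)
  have m: "x \<in> borel_measurable (lebesgue_on {a..t})"
    using c by (intro continuous_imp_measurable_on_sets_lebesgue) auto
  have bd: "bounded (x ` {a..t})" using c by (intro compact_imp_bounded compact_continuous_image) auto
  have "(\<lambda>s. (t - s) powr e) absolutely_integrable_on {a..t}"
    using kernel_power_has_integral[OF assms(1,2)]
    by (intro nonnegative_absolutely_integrable_1) (auto simp: has_integral_iff)
  from absolutely_integrable_bounded_measurable_product[OF _ m _ bd this, of "\<lambda>y c. c *\<^sub>R y"]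
  show ?thesis
    using bounded_bilinear.flip[OF bounded_bilinear_scaleR]
    by (simp add: bilinear_conv_bounded_bilinear)
qed

text \<open>Reflecting the time axis exchanges the left and the right operators. All one-sided statements are
  therefore proved on the left only and transported by this identity.\<close>

lemma right_kernel_int_reflect:
  "right_kernel_int \<alpha> b x t = left_kernel_int \<alpha> (- b) (\<lambda>s. x (- s)) (- t)"
  unfolding right_kernel_int_def left_kernel_int_def
  using Henstock_Kurzweil_Integration.integral_reflect_real[of b t "\<lambda>s. ((s - t) powr (real (frac_n \<alpha>) - \<alpha> - 1)) *\<^sub>R x s"]
  by (simp add: minus_diff_commute)

lemma deriv_tower_reflect:
  assumes "deriv_tower n F S"
  shows "deriv_tower n (\<lambda>k t. (- 1) ^ k *\<^sub>R F k (- t)) (uminus ` S)"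
  unfolding deriv_tower_def
proof (intro allI impI ballI)
  fix k t assume k: "k < n" and "t \<in> uminus ` S"
  then have "- t \<in> S" by auto
  then have "(F k has_vector_derivative F (Suc k) (- t)) (at (- t))"
    using assms k by (auto simp: deriv_tower_def)
  then have "(F k has_vector_derivative F (Suc k) (- t)) (at (uminus t))" by simp
  moreover have "(uminus has_vector_derivative -1) (at t)"
    by (auto intro!: derivative_eq_intros)
  ultimately have "((F k \<circ> uminus) has_vector_derivative - F (Suc k) (- t)) (at t)"
    using vector_diff_chain_at[of uminus "-1" t "F k"] by simp
  then show "((\<lambda>t. (- 1) ^ k *\<^sub>R F k (- t)) has_vector_derivative (- 1) ^ Suc k *\<^sub>R F (Suc k) (- t)) (at t)"
    by (auto intro!: derivative_eq_intros simp: o_def)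
qed

text \<open>The operators are controlled on the open interval only; their values at the two endpoints carry no
  meaning.\<close>

lemma absolutely_integrable_on_cong_Ioo:
  fixes f g :: "real \<Rightarrow> 'v::euclidean_space"
  assumes "f absolutely_integrable_on {a..b}" "\<And>t. t \<in> {a<..<b} \<Longrightarrow> g t = f t"
  shows "g absolutely_integrable_on {a..b}"
  by (rule absolutely_integrable_spike[OF assms(1), of "{a,b}"]) (use assms(2) in auto)

lemma left_reg_of_tower:
  fixes x :: "real \<Rightarrow> 'v::euclidean_space"
  assumes "continuous_on {a..b} x" "deriv_tower (frac_n \<alpha>) F {a<..<b}"
    "\<And>t. t \<in> {a<..<b} \<Longrightarrow> left_kernel_int \<alpha> a x t = F 0 t"
    "F (frac_n \<alpha>) absolutely_integrable_on {a..b}"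
  shows "left_reg \<alpha> a b x"
    "t \<in> {a<..<b} \<Longrightarrow> left_RL \<alpha> a x t = (1 / Gamma (real (frac_n \<alpha>) - \<alpha>)) *\<^sub>R F (frac_n \<alpha>) t"
proof -
  show *: "left_RL \<alpha> a x t = (1 / Gamma (real (frac_n \<alpha>) - \<alpha>)) *\<^sub>R F (frac_n \<alpha>) t"
    if "t \<in> {a<..<b}" for t
    unfolding left_RL_def using deriv_tower_vderiv[OF _ assms(2,3), of "frac_n \<alpha>" t] that by simp
  show "left_reg \<alpha> a b x"
    unfolding left_reg_def
  proof (intro conjI)
    show "times_differentiable_on (frac_n \<alpha>) (left_kernel_int \<alpha> a x) {a<..<b}"
      by (rule deriv_tower_times_differentiable[OF _ assms(2,3)]) auto
    show "left_RL \<alpha> a x absolutely_integrable_on {a..b}"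
      by (rule absolutely_integrable_on_cong_Ioo[OF _ *])
         (use assms(4) in \<open>auto intro: absolutely_integrable_scaleR_left\<close>)
  qed fact
qed

lemma left_reg_tower:
  assumes "left_reg \<alpha> a b x"
  shows "deriv_tower (frac_n \<alpha>) (\<lambda>k. (vderiv ^^ k) (left_kernel_int \<alpha> a x)) {a<..<b}"
  using assms by (auto simp: left_reg_def intro: times_differentiable_deriv_tower)

lemma left_RL_integrable_vderiv:
  fixes x :: "real \<Rightarrow> 'v::euclidean_space"
  assumes "0 < \<alpha>" "left_reg \<alpha> a b x"
  shows "(vderiv ^^ frac_n \<alpha>) (left_kernel_int \<alpha> a x) absolutely_integrable_on {a..b}"
proof -
  have "Gamma (real (frac_n \<alpha>) - \<alpha>) \<noteq> 0"
    using frac_n_bounds[OF assms(1)] by (simp add: Gamma_real_pos less_imp_neq[symmetric])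
  then have "(vderiv ^^ frac_n \<alpha>) (left_kernel_int \<alpha> a x)
     = (\<lambda>t. Gamma (real (frac_n \<alpha>) - \<alpha>) *\<^sub>R left_RL \<alpha> a x t)"
    by (simp add: left_RL_def fun_eq_iff)
  then show ?thesis using assms(2)
    by (auto simp: left_reg_def intro: absolutely_integrable_scaleR_left)
qed

lemma right_reg_reflect:
  fixes x :: "real \<Rightarrow> 'v::euclidean_space"
  assumes "0 < \<alpha>" "right_reg \<alpha> a b x"
  shows "left_reg \<alpha> (- b) (- a) (\<lambda>s. x (- s))"
    "t \<in> {a<..<b} \<Longrightarrow> right_RL \<alpha> b x t = left_RL \<alpha> (- b) (\<lambda>s. x (- s)) (- t)"
proof -
  let ?n = "frac_n \<alpha>" and ?K = "right_kernel_int \<alpha> b x" and ?g = "Gamma (real (frac_n \<alpha>) - \<alpha>)"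
  define F where "F = (\<lambda>k t. (- 1) ^ k *\<^sub>R (vderiv ^^ k) ?K (- t))"
  have g: "?g \<noteq> 0"
    using frac_n_bounds[OF assms(1)] by (simp add: Gamma_real_pos less_imp_neq[symmetric])
  have "uminus ` {a<..<b} = {- b<..<- a}" by simp
  with deriv_tower_reflect[OF times_differentiable_deriv_tower, of ?n ?K "{a<..<b}"]
  have tower: "deriv_tower ?n F {- b<..<- a}"
    using assms(2) by (simp add: right_reg_def F_def)
  have top: "F ?n t = ?g *\<^sub>R right_RL \<alpha> b x (- t)" for t
    using g by (simp add: F_def right_RL_def)
  have cont: "continuous_on {- b..- a} (\<lambda>s. x (- s))"
    using assms(2) unfolding right_reg_def
    by (auto intro!: continuous_on_compose2[of "{a..b}" x] continuous_intros)
  have int: "F ?n absolutely_integrable_on {- b..- a}"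
    unfolding top using assms(2)
    by (auto simp: right_reg_def intro!: absolutely_integrable_scaleR_left)
  have K0: "left_kernel_int \<alpha> (- b) (\<lambda>s. x (- s)) t = F 0 t" for t
    by (simp add: F_def right_kernel_int_reflect)
  note * = left_reg_of_tower[OF cont tower K0 int]
  show "left_reg \<alpha> (- b) (- a) (\<lambda>s. x (- s))" by (rule *(1))
  show "right_RL \<alpha> b x t = left_RL \<alpha> (- b) (\<lambda>s. x (- s)) (- t)" if "t \<in> {a<..<b}"
    using *(2)[of "- t"] that g by (simp add: top)
qed

lemma left_reg_reflect:
  fixes x :: "real \<Rightarrow> 'v::euclidean_space"
  assumes "0 < \<alpha>" "left_reg \<alpha> a b x"
  shows "right_reg \<alpha> (- b) (- a) (\<lambda>s. x (- s))"
    "t \<in> {a<..<b} \<Longrightarrow> left_RL \<alpha> a x t = right_RL \<alpha> (- a) (\<lambda>s. x (- s)) (- t)"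
proof -
  let ?n = "frac_n \<alpha>" and ?K = "left_kernel_int \<alpha> a x" and ?g = "Gamma (real (frac_n \<alpha>) - \<alpha>)"
  define F where "F = (\<lambda>k t. (- 1) ^ k *\<^sub>R (vderiv ^^ k) ?K (- t))"
  have "uminus ` {a<..<b} = {- b<..<- a}" by simp
  with deriv_tower_reflect[OF left_reg_tower[OF assms(2)]]
  have tower: "deriv_tower ?n F {- b<..<- a}" by (simp add: F_def)
  have K0: "right_kernel_int \<alpha> (- a) (\<lambda>s. x (- s)) t = F 0 t" for t
    by (simp add: F_def right_kernel_int_reflect)
  have vd: "(vderiv ^^ ?n) (right_kernel_int \<alpha> (- a) (\<lambda>s. x (- s))) t = F ?n t"
    if "t \<in> {- b<..<- a}" for t
    by (rule deriv_tower_vderiv[OF _ tower K0]) (use that in auto)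
  have RL: "right_RL \<alpha> (- a) (\<lambda>s. x (- s)) t = left_RL \<alpha> a x (- t)" if "t \<in> {- b<..<- a}" for t
    using vd[OF that] by (simp add: right_RL_def left_RL_def F_def flip: power_mult_distrib)
  show "left_RL \<alpha> a x t = right_RL \<alpha> (- a) (\<lambda>s. x (- s)) (- t)" if "t \<in> {a<..<b}"
    using RL[of "- t"] that by simp
  have "continuous_on {- b..- a} (\<lambda>s. x (- s))"
    using assms(2) unfolding left_reg_def
    by (auto intro!: continuous_on_compose2[of "{a..b}" x] continuous_intros)
  moreover have "times_differentiable_on ?n (right_kernel_int \<alpha> (- a) (\<lambda>s. x (- s))) {- b<..<- a}"
    by (rule deriv_tower_times_differentiable[OF _ tower K0]) auto
  moreover have "right_RL \<alpha> (- a) (\<lambda>s. x (- s)) absolutely_integrable_on {- b..- a}"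
    by (rule absolutely_integrable_on_cong_Ioo[OF _ RL])
       (use assms(2) in \<open>auto simp: left_reg_def\<close>)
  ultimately show "right_reg \<alpha> (- b) (- a) (\<lambda>s. x (- s))"
    by (simp add: right_reg_def)
qed

text \<open>Used for the coordinate functionals and for the embedding of real vectors into complex ones; it is
  what reduces the vector-valued problem to complex-valued functions.\<close>

lemma left_reg_linear:
  fixes x :: "real \<Rightarrow> 'v::euclidean_space" and T :: "'v \<Rightarrow> 'w::euclidean_space"
  assumes "0 < \<alpha>" "left_reg \<alpha> a b x" "bounded_linear T"
  shows "left_reg \<alpha> a b (\<lambda>s. T (x s))"
    "t \<in> {a<..<b} \<Longrightarrow> left_RL \<alpha> a (\<lambda>s. T (x s)) t = T (left_RL \<alpha> a x t)"
proof -
  interpret T: bounded_linear T by fact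
  let ?n = "frac_n \<alpha>" and ?K = "left_kernel_int \<alpha> a x" and ?g = "Gamma (real (frac_n \<alpha>) - \<alpha>)"
  define F where "F = (\<lambda>k t. T ((vderiv ^^ k) ?K t))"
  have cont: "continuous_on {a..b} x" using assms(2) by (simp add: left_reg_def)
  have tower: "deriv_tower ?n F {a<..<b}"
    using left_reg_tower[OF assms(2)] by (auto simp: deriv_tower_def F_def intro: T.has_vector_derivative)
  have K0: "left_kernel_int \<alpha> a (\<lambda>s. T (x s)) t = F 0 t" if "t \<in> {a<..<b}" for t
    using integral_linear[OF set_lebesgue_integral_eq_integral(1)[OF left_kernel_integrable] assms(3), of "real ?n - \<alpha> - 1" a t b x]
      frac_n_bounds[OF assms(1)] that cont
    by (simp add: left_kernel_int_def F_def o_def T.scaleR)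
  have int: "F ?n absolutely_integrable_on {a..b}"
    using absolutely_integrable_linear[OF left_RL_integrable_vderiv[OF assms(1,2)] assms(3)]
    by (simp add: F_def o_def)
  have cT: "continuous_on {a..b} (\<lambda>s. T (x s))"
    using cont by (rule T.continuous_on)
  note * = left_reg_of_tower[OF cT tower K0 int]
  show "left_reg \<alpha> a b (\<lambda>s. T (x s))" by (rule *(1))
  show "left_RL \<alpha> a (\<lambda>s. T (x s)) t = T (left_RL \<alpha> a x t)" if "t \<in> {a<..<b}"
    using *(2)[OF _ that] by (simp add: F_def left_RL_def T.scaleR)
qed

lemma right_reg_linear:
  fixes x :: "real \<Rightarrow> 'v::euclidean_space" and T :: "'v \<Rightarrow> 'w::euclidean_space"
  assumes "0 < \<alpha>" "right_reg \<alpha> a b x" "bounded_linear T"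
  shows "right_reg \<alpha> a b (\<lambda>s. T (x s))"
    "t \<in> {a<..<b} \<Longrightarrow> right_RL \<alpha> b (\<lambda>s. T (x s)) t = T (right_RL \<alpha> b x t)"
proof -
  note r = right_reg_reflect[OF assms(1,2)]
  note l = left_reg_linear[OF assms(1) r(1) assms(3)]
  note q = left_reg_reflect[OF assms(1) l(1)]
  show "right_reg \<alpha> a b (\<lambda>s. T (x s))" using q(1) by simp
  show "right_RL \<alpha> b (\<lambda>s. T (x s)) t = T (right_RL \<alpha> b x t)" if "t \<in> {a<..<b}"
    using q(2)[of "- t"] l(2)[of "- t"] r(2)[of t] that by simp
qed

lemma left_reg_combine:
  fixes x y :: "real \<Rightarrow> 'v::euclidean_space"
  assumes "0 < \<alpha>" "left_reg \<alpha> a b x" "left_reg \<alpha> a b y"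
  shows "left_reg \<alpha> a b (\<lambda>s. c *\<^sub>R x s + d *\<^sub>R y s)"
    "t \<in> {a<..<b} \<Longrightarrow> left_RL \<alpha> a (\<lambda>s. c *\<^sub>R x s + d *\<^sub>R y s) t
       = c *\<^sub>R left_RL \<alpha> a x t + d *\<^sub>R left_RL \<alpha> a y t"
proof -
  let ?n = "frac_n \<alpha>" and ?g = "Gamma (real (frac_n \<alpha>) - \<alpha>)"
  define F where "F = (\<lambda>k t. c *\<^sub>R (vderiv ^^ k) (left_kernel_int \<alpha> a x) t
    + d *\<^sub>R (vderiv ^^ k) (left_kernel_int \<alpha> a y) t)"
  have cx: "continuous_on {a..b} x" and cy: "continuous_on {a..b} y"
    using assms by (simp_all add: left_reg_def)
  have tower: "deriv_tower ?n F {a<..<b}"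
    using left_reg_tower[OF assms(2)] left_reg_tower[OF assms(3)]
    by (auto simp: deriv_tower_def F_def
        intro!: has_vector_derivative_add bounded_linear.has_vector_derivative[OF bounded_linear_scaleR_right])
  have K0: "left_kernel_int \<alpha> a (\<lambda>s. c *\<^sub>R x s + d *\<^sub>R y s) t = F 0 t" if "t \<in> {a<..<b}" for t
  proof -
    have i: "(\<lambda>s. ((t - s) powr (real ?n - \<alpha> - 1)) *\<^sub>R z s) integrable_on {a..t}"
      if "continuous_on {a..b} z" for z :: "real \<Rightarrow> 'v"
      using set_lebesgue_integral_eq_integral(1)[OF left_kernel_integrable[of _ a t b z]] that \<open>t \<in> {a<..<b}\<close>
        frac_n_bounds[OF assms(1)] by auto
    have "F 0 t = integral {a..t} (\<lambda>s. c *\<^sub>R (((t - s) powr (real ?n - \<alpha> - 1)) *\<^sub>R x s)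
        + d *\<^sub>R (((t - s) powr (real ?n - \<alpha> - 1)) *\<^sub>R y s))"
      using i[OF cx] i[OF cy]
      by (subst Henstock_Kurzweil_Integration.integral_add)
         (simp_all add: F_def left_kernel_int_def integrable_cmul del: scaleR_scaleR)
    then show ?thesis by (simp add: left_kernel_int_def algebra_simps)
  qed
  have int: "F ?n absolutely_integrable_on {a..b}"
    unfolding F_def using assms left_RL_integrable_vderiv
    by (intro set_integral_add absolutely_integrable_scaleR_left) auto
  have c: "continuous_on {a..b} (\<lambda>s. c *\<^sub>R x s + d *\<^sub>R y s)"
    using cx cy by (intro continuous_intros)
  note * = left_reg_of_tower[OF c tower K0 int]
  show "left_reg \<alpha> a b (\<lambda>s. c *\<^sub>R x s + d *\<^sub>R y s)" by (rule *(1))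
  show "left_RL \<alpha> a (\<lambda>s. c *\<^sub>R x s + d *\<^sub>R y s) t = c *\<^sub>R left_RL \<alpha> a x t + d *\<^sub>R left_RL \<alpha> a y t"
    if "t \<in> {a<..<b}"
    using *(2)[OF _ that] by (simp add: F_def left_RL_def algebra_simps)
qed

lemma right_reg_combine:
  fixes x y :: "real \<Rightarrow> 'v::euclidean_space"
  assumes "0 < \<alpha>" "right_reg \<alpha> a b x" "right_reg \<alpha> a b y"
  shows "right_reg \<alpha> a b (\<lambda>s. c *\<^sub>R x s + d *\<^sub>R y s)"
    "t \<in> {a<..<b} \<Longrightarrow> right_RL \<alpha> b (\<lambda>s. c *\<^sub>R x s + d *\<^sub>R y s) t
       = c *\<^sub>R right_RL \<alpha> b x t + d *\<^sub>R right_RL \<alpha> b y t"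
proof -
  note rx = right_reg_reflect[OF assms(1,2)] and ry = right_reg_reflect[OF assms(1,3)]
  note l = left_reg_combine[OF assms(1) rx(1) ry(1), where c = c and d = d]
  note q = left_reg_reflect[OF assms(1) l(1)]
  show "right_reg \<alpha> a b (\<lambda>s. c *\<^sub>R x s + d *\<^sub>R y s)" using q(1) by simp
  show "right_RL \<alpha> b (\<lambda>s. c *\<^sub>R x s + d *\<^sub>R y s) t = c *\<^sub>R right_RL \<alpha> b x t + d *\<^sub>R right_RL \<alpha> b y t"
    if "t \<in> {a<..<b}"
    using q(2)[of "- t"] l(2)[of "- t"] rx(2)[of t] ry(2)[of t] that by simp
qed

section \<open>The Riemann-Liouville integral on the real line\<close>

text \<open>The Riemann-Liouville kernel \<open>u^(c-1) / \<Gamma>(c)\<close> on the positive axis. The entire function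
  \<^const>\<open>rGamma\<close> is used in place of \<open>1 / \<Gamma>\<close> so that \<open>kern c\<close> has derivative \<open>kern (c - 1)\<close> for every
  real \<open>c\<close>, including \<open>c = 1\<close>, where the derivative is \<open>kern 0 = 0\<close>. Polynomials are the case of
  positive integers \<open>c\<close>.\<close>

definition kern :: "real \<Rightarrow> real \<Rightarrow> real" where
  "kern c u = (if u > 0 then rGamma c * u powr (c - 1) else 0)"

text \<open>The left fractional integral of order \<open>c\<close>. The lower limit is not a parameter: the argument is
  extended by zero to the left of it.\<close>

definition rl :: "real \<Rightarrow> (real \<Rightarrow> complex) \<Rightarrow> real \<Rightarrow> complex" where
  "rl c f t = (LINT s|lborel. kern c (t - s) *\<^sub>R f s)"

text \<open>The right fractional integral, the formal adjoint of \<^const>\<open>rl\<close>.\<close>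

definition rr :: "real \<Rightarrow> (real \<Rightarrow> complex) \<Rightarrow> real \<Rightarrow> complex" where
  "rr c f t = (LINT s|lborel. kern c (s - t) *\<^sub>R f s)"

lemma kern_measurable [measurable]: "kern c \<in> borel_measurable borel"
  unfolding kern_def by measurable

lemma kern_nonpos [simp]: "u \<le> 0 \<Longrightarrow> kern c u = 0"
  by (simp add: kern_def)

lemma kern_nonneg: "0 < c \<Longrightarrow> 0 \<le> kern c u"
  by (simp add: kern_def rGamma_inverse_Gamma Gamma_real_pos less_imp_le)

lemma kern_1: "kern 1 u = (if u > 0 then 1 else 0)"
  by (simp add: kern_def)

lemma kern_mono: "1 \<le> c \<Longrightarrow> u \<le> v \<Longrightarrow> kern c u \<le> kern c v"
proof (cases "u > 0")
  case True
  moreover assume "1 \<le> c" "u \<le> v"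
  moreover have "0 \<le> rGamma c"
    using \<open>1 \<le> c\<close> by (simp add: rGamma_inverse_Gamma Gamma_real_pos less_imp_le)
  ultimately show ?thesis by (auto simp: kern_def intro!: mult_left_mono powr_mono2)
qed (use kern_nonneg[of c v] in simp)

lemma kern_has_derivative:
  assumes "u > 0" shows "(kern c has_real_derivative kern (c - 1) u) (at u)"
proof -
  have "((\<lambda>u. rGamma c * u powr (c - 1)) has_real_derivative rGamma c * ((c - 1) * u powr (c - 1 - 1))) (at u)"
    using assms by (auto intro!: derivative_eq_intros)
  also have "rGamma c * ((c - 1) * u powr (c - 1 - 1)) = kern (c - 1) u"
    using assms rGamma_plus1[of "c - 1"] by (simp add: kern_def mult.commute)
  finally show ?thesis
    by (rule has_field_derivative_transform_within_open[of _ _ _ "{0<..}"])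
       (use assms in \<open>auto simp: kern_def\<close>)
qed

lemma kern_continuous_at: "u \<noteq> 0 \<Longrightarrow> isCont (kern c) u"
proof (cases "u > 0")
  case True then show ?thesis using kern_has_derivative DERIV_isCont by blast
next
  case False
  assume "u \<noteq> 0"
  with False have "u < 0" by simp
  then have "eventually (\<lambda>v. kern c v = 0) (nhds u)"
    by (auto simp: eventually_nhds intro!: exI[of _ "{..<0}"])
  then have "isCont (kern c) u = isCont (\<lambda>_. 0::real) u"
    by (rule isCont_cong)
  then show ?thesis by simp
qed

lemma kern_tendsto_0: "1 < c \<Longrightarrow> ((\<lambda>t. kern c (t - a)) \<longlongrightarrow> 0) (at_right a)"
proof -
  assume c: "1 < c"
  have "((\<lambda>t. rGamma c * (t - a) powr (c - 1)) \<longlongrightarrow> rGamma c * 0) (at_right a)"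
    using c by (intro tendsto_mult tendsto_const tendsto_zero_powrI) 
      (auto intro!: tendsto_eq_intros simp: eventually_at_filter)
  moreover have "eventually (\<lambda>t. rGamma c * (t - a) powr (c - 1) = kern c (t - a)) (at_right a)"
    by (auto simp: kern_def eventually_at_filter)
  ultimately have "((\<lambda>t. kern c (t - a)) \<longlongrightarrow> rGamma c * 0) (at_right a)"
    by (rule Lim_transform_eventually)
  then show ?thesis by (simp only: mult_zero_right)
qed

text \<open>The Beta integral: with \<open>w = t - s\<close> and \<open>r = s + w v\<close> the convolution becomes
  \<open>w^(c+d-1)\<close> times \<open>B(c, d) / (\<Gamma>(c) \<Gamma>(d)) = 1 / \<Gamma>(c + d)\<close>.\<close>

lemma kern_convolution:
  assumes "0 < c" "0 < d"
  shows "has_bochner_integral lborel (\<lambda>r. kern c (t - r) * kern d (r - s)) (kern (c + d) (t - s))"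
proof (cases "s < t")
  case False
  then have "(\<lambda>r. kern c (t - r) * kern d (r - s)) = (\<lambda>r. 0)"
    by (intro ext) (auto simp: kern_def)
  then show ?thesis using False by (simp add: has_bochner_integral_iff)
next
  case True
  define w where "w = t - s"
  have w: "w > 0" using True by (simp add: w_def)
  have "0 < Gamma c" "0 < Gamma d" using assms by (auto intro: Gamma_real_pos)
  then have Bt: "rGamma c * rGamma d * Beta c d = rGamma (c + d)"
    by (simp add: Beta_altdef rGamma_inverse_Gamma field_simps)
  have "((\<lambda>v. kern d v * kern c (1 - v)) has_integral rGamma c * rGamma d * Beta d c) {0..1}"
  proof (rule has_integral_spike[OF negligible_insert[THEN iffD2, of "{1}" 0]])
    show "((\<lambda>v. rGamma c * rGamma d * (v powr (d - 1) * (1 - v) powr (c - 1))) has_integral rGamma c * rGamma d * Beta d c) {0..1}"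
      by (intro has_integral_mult_right has_integral_Beta_real assms)
  qed (auto simp: kern_def)
  then have 1: "has_bochner_integral lborel (\<lambda>v. kern d v * kern c (1 - v)) (rGamma (c + d))"
  proof -
    assume "((\<lambda>v. kern d v * kern c (1 - v)) has_integral rGamma c * rGamma d * Beta d c) {0..1}"
    then have "((\<lambda>v. kern d v * kern c (1 - v)) has_integral rGamma (c + d)) UNIV"
      unfolding Beta_commute[of d c] Bt
      by (rule has_integral_on_superset) (auto simp: not_le)
    moreover have "0 \<le> rGamma (c + d)" 
      using assms by (simp add: rGamma_inverse_Gamma Gamma_real_pos less_imp_le)
    ultimately show ?thesis
      by (intro has_bochner_integral_nn_integral nn_integral_has_integral_lborel)
         (auto simp: kern_nonneg assms)
  qed
  have 2: "has_bochner_integral lborel (\<lambda>r. kern d ((r - s) / w) * kern c (1 - (r - s) / w)) (w * rGamma (c + d))"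
    using lborel_has_bochner_integral_real_affine_iff[of "1 / w" "\<lambda>v. kern d v * kern c (1 - v)" _ "- s / w"] 1 w
    by (simp add: field_simps)
  \<comment> \<open>homogeneity of the two kernels\<close>
  have eq: "kern c (t - r) * kern d (r - s) = w powr (c - 1) * w powr (d - 1) * (kern d ((r - s) / w) * kern c (1 - (r - s) / w))" for r
  proof -
    have "t - r = w * (1 - (r - s) / w)" using w by (simp add: w_def field_simps)
    moreover have "kern e (w * v) = w powr (e - 1) * kern e v" for e v
      using w by (simp add: kern_def powr_mult zero_less_mult_iff)
    moreover have "r - s = w * ((r - s) / w)" using w by simp
    ultimately show ?thesis by (metis mult.assoc mult.commute)
  qed
  have "w powr (c - 1) * w powr (d - 1) * (w * rGamma (c + d)) = kern (c + d) (t - s)"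
  proof -
    have "w powr (c - 1) * w powr (d - 1) * w = w powr (c + d - 1)"
      using w powr_mult_base[of w "c + d - 2"] by (simp add: powr_add[symmetric] mult.commute)
    then show ?thesis using w by (simp add: kern_def w_def[symmetric] mult.commute mult.left_commute)
  qed
  with has_bochner_integral_mult_right[OF 2, of "w powr (c - 1) * w powr (d - 1)"]
  show ?thesis by (simp add: eq)
qed

lemma rr_eq_rl_reflect: "rr c f t = rl c (\<lambda>s. f (- s)) (- t)"
  unfolding rr_def rl_def
  by (subst lborel_integral_real_affine[of "-1" _ 0]) (auto simp: algebra_simps)

lemma rl_cong: "(\<And>s. s < t \<Longrightarrow> f s = g s) \<Longrightarrow> rl c f t = rl c g t"
  unfolding rl_def
proof (intro Bochner_Integration.integral_cong refl)
  fix s assume "\<And>s. s < t \<Longrightarrow> f s = g s"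
  then show "kern c (t - s) *\<^sub>R f s = kern c (t - s) *\<^sub>R g s" by (cases "s < t") auto
qed

lemma rl_measurable [measurable]: "f \<in> borel_measurable borel \<Longrightarrow> rl c f \<in> borel_measurable borel"
proof -
  assume [measurable]: "f \<in> borel_measurable borel"
  show ?thesis unfolding rl_def by measurable
qed

lemma rl_before: "(\<And>s. s < a \<Longrightarrow> f s = 0) \<Longrightarrow> t \<le> a \<Longrightarrow> rl c f t = 0"
proof -
  assume "\<And>s. s < a \<Longrightarrow> f s = 0" "t \<le> a"
  then have "kern c (t - s) *\<^sub>R f s = 0" for s by (cases "s < t") auto
  then show ?thesis by (simp add: rl_def del: scaleR_eq_0_iff)
qed

text \<open>Fubini and \<open>kern_convolution\<close>. The case \<open>c + d = 1\<close> is Abel's inversion formula, and the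
  integer cases give iterated integrals; everything about fractional integrals below rests on this.\<close>

lemma rl_semigroup:
  assumes "0 < c" "0 < d" and [measurable]: "f \<in> borel_measurable borel"
    and int: "integrable lborel (\<lambda>s. kern (c + d) (t - s) *\<^sub>R f s)"
  shows "rl c (rl d f) t = rl (c + d) f t"
proof -
  define G where "G = (\<lambda>s r. (kern c (t - r) * kern d (r - s)) *\<^sub>R f s)"
  note conv = kern_convolution[OF assms(1,2)]
  have "integrable (lborel \<Otimes>\<^sub>M lborel) (case_prod G)"
  proof (rule lborel_pair.Fubini_integrable)
    show "case_prod G \<in> borel_measurable (lborel \<Otimes>\<^sub>M lborel)"
      unfolding G_def by measurable
    have "(LINT r|lborel. norm (case_prod G (s, r))) = norm (kern (c + d) (t - s) *\<^sub>R f s)" for s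
    proof -
      have "norm (case_prod G (s, r)) = (kern c (t - r) * kern d (r - s)) * norm (f s)" for r
        by (simp add: G_def kern_nonneg assms abs_mult)
      then have "(LINT r|lborel. norm (case_prod G (s, r))) = kern (c + d) (t - s) * norm (f s)"
        using has_bochner_integral_mult_left[OF conv[of t s], of "norm (f s)"]
        by (simp add: has_bochner_integral_iff)
      then show ?thesis using assms by (simp add: kern_nonneg)
    qed
    then show "integrable lborel (\<lambda>s. LINT r|lborel. norm (case_prod G (s, r)))"
      using integrable_norm[OF int] by (simp only:)
    show "AE s in lborel. integrable lborel (\<lambda>r. case_prod G (s, r))"
      using conv by (auto simp: G_def has_bochner_integral_iff)
  qed
  from lborel_pair.Fubini_integral[OF this]
  have "(LINT r|lborel. LINT s|lborel. G s r) = (LINT s|lborel. LINT r|lborel. G s r)" .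
  moreover have "(LINT s|lborel. G s r) = kern c (t - r) *\<^sub>R rl d f r" for r
  proof (cases "kern c (t - r) = 0")
    case False
    then show ?thesis by (simp add: G_def rl_def flip: scaleR_scaleR)
  qed (simp add: G_def)
  moreover have "(LINT r|lborel. G s r) = kern (c + d) (t - s) *\<^sub>R f s" for s
    using has_bochner_integral_scaleR_left[OF conv[of t s], of "f s"]
    by (simp add: G_def has_bochner_integral_iff)
  ultimately show ?thesis by (simp add: rl_def)
qed

text \<open>For \<open>c \<ge> 1\<close> the kernel is bounded on bounded sets, so an integrable factor suffices. For
  \<open>0 < c < 1\<close> it is singular and the other factor has to be bounded.\<close>

lemma kern_times_integrable:
  assumes "1 \<le> c" "integrable lborel f" "\<And>s. s < a \<Longrightarrow> f s = 0"
  shows "integrable lborel (\<lambda>s. kern c (t - s) *\<^sub>R (f s :: complex))"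
proof (rule Bochner_Integration.integrable_bound)
  show "integrable lborel (\<lambda>s. kern c (t - a) *\<^sub>R f s)" using assms by simp
  show "(\<lambda>s. kern c (t - s) *\<^sub>R f s) \<in> borel_measurable lborel"
    using borel_measurable_integrable[OF assms(2)] by measurable
  show "AE s in lborel. norm (kern c (t - s) *\<^sub>R f s) \<le> norm (kern c (t - a) *\<^sub>R f s)"
  proof (intro AE_I2)
    fix s show "norm (kern c (t - s) *\<^sub>R f s) \<le> norm (kern c (t - a) *\<^sub>R f s)"
      using assms kern_mono[of c "t - s" "t - a"]
      by (cases "s < a") (auto simp: kern_nonneg intro!: mult_right_mono)
  qed
qed

lemma kern_times_bounded_integrable:
  assumes "0 < c" and [measurable]: "f \<in> borel_measurable borel"
    and "\<And>s. s < a \<Longrightarrow> f s = 0" "\<And>s. s < t \<Longrightarrow> norm (f s) \<le> M"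
  shows "integrable lborel (\<lambda>s. kern c (t - s) *\<^sub>R (f s :: complex))"
    "norm (rl c f t) \<le> M * kern (c + 1) (t - a)"
proof -
  have conv: "has_bochner_integral lborel (\<lambda>s. kern c (t - s) * kern 1 (s - a)) (kern (c + 1) (t - a))"
    using assms by (intro kern_convolution) auto
  then have i: "integrable lborel (\<lambda>s. M * (kern c (t - s) * kern 1 (s - a)))"
    by (simp add: has_bochner_integral_iff)
  have le: "norm (kern c (t - s) *\<^sub>R f s) \<le> M * (kern c (t - s) * kern 1 (s - a))" if "s \<noteq> a" for s
    using assms that by (cases "s < a"; cases "s < t")
       (auto simp: kern_nonneg kern_1 mult.commute intro!: mult_right_mono)
  have "AE s in lborel. s \<noteq> a" by (rule AE_lborel_singleton)
  then have le': "AE s in lborel. norm (kern c (t - s) *\<^sub>R f s) \<le> M * (kern c (t - s) * kern 1 (s - a))"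
    by eventually_elim (rule le)
  show int: "integrable lborel (\<lambda>s. kern c (t - s) *\<^sub>R f s)"
  proof (rule Bochner_Integration.integrable_bound[OF i])
    show "AE s in lborel. norm (kern c (t - s) *\<^sub>R f s) \<le> norm (M * (kern c (t - s) * kern 1 (s - a)))"
      using le' by eventually_elim (simp only: real_norm_def abs_ge_self[THEN order_trans[rotated]])
  qed measurable
  have "norm (rl c f t) \<le> (LINT s|lborel. norm (kern c (t - s) *\<^sub>R f s))"
    unfolding rl_def by (rule integral_norm_bound)
  also have "\<dots> \<le> (LINT s|lborel. M * (kern c (t - s) * kern 1 (s - a)))"
    using int i le' by (intro integral_mono_AE integrable_norm)
  also have "\<dots> = M * kern (c + 1) (t - a)"
    using conv by (simp add: has_bochner_integral_iff)
  finally show "norm (rl c f t) \<le> M * kern (c + 1) (t - a)" .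
qed

text \<open>Dominated convergence; for \<open>c = 1\<close> the kernel jumps, but only at the single point \<open>s = t\<close>.\<close>

lemma rl_isCont:
  assumes "1 \<le> c" "integrable lborel f" "\<And>s. s < a \<Longrightarrow> f s = 0"
  shows "isCont (rl c f) t"
  unfolding continuous_at_sequentially
proof (intro allI impI, unfold o_def)
  fix X assume X: "X \<longlonglongrightarrow> t"
  then have "Bseq X" using convergent_imp_Bseq convergentI by blast
  then obtain T where T: "\<And>n. X n \<le> T"
    unfolding Bseq_def by (metis abs_le_D1 real_norm_def)
  have [measurable]: "f \<in> borel_measurable borel"
    using borel_measurable_integrable[OF assms(2)] by simp
  show "(\<lambda>n. rl c f (X n)) \<longlonglongrightarrow> rl c f t"
    unfolding rl_def
  proof (rule integral_dominated_convergence[where w = "\<lambda>s. kern c (T - a) * norm (f s)"])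
    show "integrable lborel (\<lambda>s. kern c (T - a) * norm (f s))"
      using assms by simp
    have "AE s in lborel. s \<noteq> t" by (rule AE_lborel_singleton)
    then show "AE s in lborel. (\<lambda>n. kern c (X n - s) *\<^sub>R f s) \<longlonglongrightarrow> kern c (t - s) *\<^sub>R f s"
    proof eventually_elim
      case (elim s)
      have "(\<lambda>n. X n - s) \<longlonglongrightarrow> t - s" using X by (intro tendsto_intros)
      then have "(\<lambda>n. kern c (X n - s)) \<longlonglongrightarrow> kern c (t - s)"
        using elim kern_continuous_at[of "t - s" c] isCont_tendsto_compose by fastforce
      then show ?case by (intro tendsto_intros)
    qed
    show "AE s in lborel. norm (kern c (X n - s) *\<^sub>R f s) \<le> kern c (T - a) * norm (f s)" for n
    proof (intro AE_I2)
      fix s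
      show "norm (kern c (X n - s) *\<^sub>R f s) \<le> kern c (T - a) * norm (f s)"
        using assms kern_mono[of c "X n - s" "T - a"] T[of n]
        by (cases "s < a") (auto simp: kern_nonneg intro!: mult_right_mono)
    qed
  qed measurable
qed

lemma rl_1_eq_integral:
  assumes "f absolutely_integrable_on {a..t}" "f \<in> borel_measurable borel" "\<And>s. s < a \<Longrightarrow> f s = 0"
  shows "rl 1 f t = integral {a..t} f"
proof -
  have si: "set_integrable lborel {a..t} f"
    using assms(1,2) by (simp add: set_integrable_def integrable_completion)
  have "AE s in lborel. s \<noteq> t" by (rule AE_lborel_singleton)
  then have ae: "AE s in lborel. kern 1 (t - s) *\<^sub>R f s = indicator {a..t} s *\<^sub>R f s"
    by eventually_elim (use assms(3) in \<open>auto simp: kern_1 indicator_def not_less[symmetric]\<close>)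
  have "rl 1 f t = (LINT s|lborel. indicator {a..t} s *\<^sub>R f s)"
    unfolding rl_def
    by (rule integral_cong_AE) (use assms(2) ae in measurable)
  also have "\<dots> = integral {a..t} f"
    using set_borel_integral_eq_integral(2)[OF si] by (simp add: set_lebesgue_integral_def)
  finally show ?thesis .
qed

lemma rl_1_has_derivative:
  assumes [measurable]: "f \<in> borel_measurable borel" and "\<And>s. s < a \<Longrightarrow> f s = 0"
    and "a \<le> t0" "t0 < t" "t < t1" "f absolutely_integrable_on {a..t1}" "continuous_on {t0<..<t1} f"
  shows "(rl 1 f has_vector_derivative f t) (at t)"
proof -
  have eq: "rl 1 f s = integral {a..s} f" if "s \<in> {a<..<t1}" for s
    using that assms by (intro rl_1_eq_integral absolutely_integrable_on_subinterval[OF assms(6)]) auto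
  define u v where "u = (t0 + t) / 2" and "v = (t + t1) / 2"
  have uv: "t0 < u" "u < t" "t < v" "v < t1" using assms by (auto simp: u_def v_def)
  have i: "f integrable_on {a..s}" if "s \<le> t1" for s
    using set_lebesgue_integral_eq_integral(1)[OF assms(6)] that by (auto intro: integrable_subinterval_real)
  have "continuous_on {u..v} f" by (rule continuous_on_subset[OF assms(7)]) (use uv in auto)
  then have "((\<lambda>s. integral {u..s} f) has_vector_derivative f t) (at t within {u..v})"
    using uv by (intro integral_has_vector_derivative) auto
  then have "((\<lambda>s. integral {u..s} f) has_vector_derivative f t) (at t)"
    using uv by (simp add: at_within_Icc_at)
  then have "((\<lambda>s. integral {a..u} f + integral {u..s} f) has_vector_derivative 0 + f t) (at t)"
    by (intro has_vector_derivative_add has_vector_derivative_const)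
  moreover have "integral {a..u} f + integral {u..s} f = rl 1 f s" if "s \<in> {u<..<v}" for s
    using that uv assms(3) i[of s]
    by (subst eq) (auto intro!: Henstock_Kurzweil_Integration.integral_combine)
  ultimately show ?thesis
    using has_vector_derivative_cong_open[of "{u<..<v}" t "\<lambda>s. integral {a..u} f + integral {u..s} f" "rl 1 f"] uv
    by simp
qed

text \<open>By the semigroup law \<open>rl c f\<close> is the primitive of \<open>rl (c - 1) f\<close>, which is continuous once
  \<open>c - 1 \<ge> 1\<close>.\<close>

lemma rl_has_derivative:
  assumes "2 \<le> c" "integrable lborel f" "\<And>s. s < a \<Longrightarrow> f s = 0"
  shows "(rl c f has_vector_derivative rl (c - 1) f t) (at t)"
proof -
  have [measurable]: "f \<in> borel_measurable borel"
    using borel_measurable_integrable[OF assms(2)] by simp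
  define a' where "a' = min a t - 1"
  have z: "\<And>s. s < a' \<Longrightarrow> f s = 0" using assms(3) by (simp add: a'_def)
  have c: "continuous_on S (rl (c - 1) f)" for S
    using rl_isCont[of "c - 1" f a] assms by (intro continuous_at_imp_continuous_on) auto
  have "(rl 1 (rl (c - 1) f) has_vector_derivative rl (c - 1) f t) (at t)"
    by (rule rl_1_has_derivative[of _ a' a' _ "t + 1"])
       (use rl_before[of a'] z c in \<open>auto simp: a'_def intro: absolutely_integrable_continuous_real\<close>)
  moreover have "rl 1 (rl (c - 1) f) = rl c f"
    using rl_semigroup[of 1 "c - 1" f] kern_times_integrable[OF _ assms(2,3), of c] assms(1)
    by (auto simp: fun_eq_iff)
  ultimately show ?thesis by simp
qed

section \<open>Taylor expansion and Abel inversion\<close>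

text \<open>A fractional derivative is only known to be Lebesgue measurable, whereas Fubini's theorem is applied
  on the product of two copies of \<^const>\<open>lborel\<close>. A Borel representative, extended by zero, bridges the two.\<close>

definition borel_rep :: "real \<Rightarrow> real \<Rightarrow> (real \<Rightarrow> complex) \<Rightarrow> (real \<Rightarrow> complex) \<Rightarrow> bool" where
  "borel_rep a b f g \<longleftrightarrow> integrable lborel g \<and> (\<forall>t. t \<notin> {a..b} \<longrightarrow> g t = 0)
     \<and> (AE t in lborel. t \<in> {a..b} \<longrightarrow> f t = g t)"

lemma borel_rep_exists:
  assumes "f absolutely_integrable_on {a..b}"
  shows "\<exists>g. borel_rep a b f g"
proof -
  define F where "F = (\<lambda>t. indicator {a..b} t *\<^sub>R f t)"
  have F: "integrable lebesgue F" using assms by (simp add: set_integrable_def F_def)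
  then have "(\<lambda>t. Re (F t)) \<in> borel_measurable lebesgue" "(\<lambda>t. Im (F t)) \<in> borel_measurable lebesgue"
    by (simp_all add: borel_measurable_integrable)
  then obtain r i where ri: "r \<in> borel_measurable lborel" "AE t in lborel. Re (F t) = r t"
    "i \<in> borel_measurable lborel" "AE t in lborel. Im (F t) = i t"
    by (metis completion_ex_borel_measurable_real)
  define g where "g = (\<lambda>t. indicator {a..b} t *\<^sub>R (of_real (r t) + \<i> * of_real (i t)) :: complex)"
  have [measurable]: "r \<in> borel_measurable borel" "i \<in> borel_measurable borel" using ri by simp_all
  have gm: "g \<in> borel_measurable borel" unfolding g_def by measurable
  have ae: "AE t in lborel. F t = g t"
    using ri(2,4)
  proof eventually_elim
    case (elim t)
    then show ?case by (cases "t \<in> {a..b}") (simp_all add: g_def F_def complex_eq_iff)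
  qed
  have "g \<in> borel_measurable lebesgue" using gm by (simp add: measurable_completion)
  then have "integrable lebesgue g"
    using integrable_cong_AE[OF borel_measurable_integrable[OF F] _ AE_completion[OF ae]] F by blast
  then have "integrable lborel g" using gm by (simp add: integrable_completion)
  moreover have "AE t in lborel. t \<in> {a..b} \<longrightarrow> f t = g t"
    using ae by eventually_elim (auto simp: F_def)
  ultimately show ?thesis
    by (auto simp: borel_rep_def g_def intro!: exI[of _ g])
qed

lemma borel_rep_measurable: "borel_rep a b f g \<Longrightarrow> g \<in> borel_measurable borel"
  unfolding borel_rep_def using borel_measurable_integrable[of lborel g] by simp

lemma integral_AE_cong:
  fixes f g :: "real \<Rightarrow> complex"
  assumes "AE t in lborel. t \<in> S \<longrightarrow> f t = g t"
  shows "integral S f = integral S g" "f integrable_on S \<longleftrightarrow> g integrable_on S"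
  using has_integral_AE[OF assms] by (simp_all add: integral_def integrable_on_def)

lemma borel_rep_integral:
  assumes "borel_rep a b f g" "integrable lborel (\<lambda>t. \<phi> t * g t)"
  shows "integral {a..b} (\<lambda>t. \<phi> t * f t) = (LINT t|lborel. \<phi> t * g t)"
    "(\<lambda>t. \<phi> t * f t) integrable_on {a..b}"
proof -
  have ae: "AE t in lborel. t \<in> {a..b} \<longrightarrow> \<phi> t * f t = \<phi> t * g t"
    using assms(1) unfolding borel_rep_def by (auto elim: eventually_mono)
  have i: "((\<lambda>t. \<phi> t * g t) has_integral (LINT t|lborel. \<phi> t * g t)) UNIV"
    by (rule has_integral_integral_lborel[OF assms(2)])
  have "((\<lambda>t. \<phi> t * g t) has_integral (LINT t|lborel. \<phi> t * g t)) {a..b}"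
  proof -
    have "(\<lambda>t. \<phi> t * g t) = (\<lambda>t. if t \<in> {a..b} then \<phi> t * g t else 0)"
      using assms(1) by (auto simp: borel_rep_def fun_eq_iff)
    with i show ?thesis using has_integral_restrict_UNIV[of "{a..b}" "\<lambda>t. \<phi> t * g t"] by metis
  qed
  then show "integral {a..b} (\<lambda>t. \<phi> t * f t) = (LINT t|lborel. \<phi> t * g t)"
    "(\<lambda>t. \<phi> t * f t) integrable_on {a..b}"
    using integral_AE_cong[OF ae] by auto
qed

lemma borel_rep_absolutely_integrable:
  assumes "borel_rep a b f g" "S \<in> sets borel" shows "g absolutely_integrable_on S"
proof -
  have [measurable]: "g \<in> borel_measurable borel" "S \<in> sets borel"
    using borel_rep_measurable[OF assms(1)] assms(2) by auto
  have "integrable lborel g" using assms(1) by (simp add: borel_rep_def)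
  then have "integrable lborel (\<lambda>t. indicator S t *\<^sub>R g t)"
    using assms(2) integrable_mult_indicator[of S lborel g] by simp
  moreover have "(\<lambda>t. indicator S t *\<^sub>R g t) \<in> borel_measurable borel"
    by measurable
  ultimately show ?thesis by (simp add: set_integrable_def integrable_completion)
qed

lemma borel_rep_rl_1:
  assumes "borel_rep a b f g" "a \<le> u" "u \<le> v" "v \<le> b"
  shows "integral {u..v} f = rl 1 g v - rl 1 g u"
proof -
  have "AE t in lborel. t \<in> {a..b} \<longrightarrow> f t = g t"
    using assms(1) by (simp add: borel_rep_def)
  then have ae: "AE t in lborel. t \<in> {u..v} \<longrightarrow> f t = g t"
    by eventually_elim (use assms(2-4) in auto)
  have ai: "g absolutely_integrable_on {s..t}" for s t
    by (rule borel_rep_absolutely_integrable[OF assms(1)]) simp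
  have i: "g integrable_on {s..t}" for s t
    by (rule set_lebesgue_integral_eq_integral(1)[OF ai])
  have e: "rl 1 g t = integral {a..t} g" for t
    by (rule rl_1_eq_integral[OF ai borel_rep_measurable[OF assms(1)]])
       (use assms(1) in \<open>simp add: borel_rep_def\<close>)
  have "integral {a..u} g + integral {u..v} g = integral {a..v} g"
    using assms i by (intro Henstock_Kurzweil_Integration.integral_combine) auto
  then show ?thesis using integral_AE_cong(1)[OF ae] by (simp add: e algebra_simps)
qed

lemma equal_derivatives_differ_by_const:
  fixes f g :: "real \<Rightarrow> complex"
  assumes "\<And>t. t \<in> {a<..<b} \<Longrightarrow> (f has_vector_derivative D t) (at t)"
    "\<And>t. t \<in> {a<..<b} \<Longrightarrow> (g has_vector_derivative D t) (at t)"
  obtains c where "\<And>t. t \<in> {a<..<b} \<Longrightarrow> f t = c + g t"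
proof -
  have "((\<lambda>t. f t - g t) has_vector_derivative 0) (at t within {a<..<b})" if "t \<in> {a<..<b}" for t
    using has_vector_derivative_diff[OF assms(1)[OF that] assms(2)[OF that]]
    by (simp add: has_vector_derivative_at_within)
  then obtain c where "\<And>t. t \<in> {a<..<b} \<Longrightarrow> f t - g t = c"
    using has_vector_derivative_zero_constant[of "{a<..<b}" "\<lambda>t. f t - g t"] by auto
  then show ?thesis by (intro that[of c]) (auto simp: algebra_simps)
qed

lemma kern_scaleR_has_vector_derivative:
  "a < t \<Longrightarrow> ((\<lambda>t. kern c (t - a) *\<^sub>R z) has_vector_derivative kern (c - 1) (t - a) *\<^sub>R z) (at t)"
proof -
  assume "a < t"
  then have "((\<lambda>t. kern c (t - a)) has_real_derivative kern (c - 1) (t - a)) (at t)"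
    using DERIV_shift[of "kern c" "kern (c - 1) (t - a)" t "- a"] kern_has_derivative[of "t - a" c] by simp
  then show ?thesis
    using has_vector_derivative_scaleR[of "\<lambda>t. kern c (t - a)" "kern (c - 1) (t - a)" t UNIV "\<lambda>_. z" 0]
    by simp
qed

text \<open>Taylor's formula with integral remainder when the top derivative is merely integrable. The induction
  runs downwards from the top level of the tower: level \<open>n - 1\<close> is a primitive of \<open>g\<close> by the fundamental
  theorem for the gauge integral, which needs the derivative at every point but no continuity of it, and
  each further level is recovered up to a constant.\<close>

lemma taylor_integrable:
  assumes "a < b" "deriv_tower n F {a<..<b}" "0 < n" and g: "borel_rep a b (F n) g"
  shows "\<exists>\<phi>. \<forall>t\<in>{a<..<b}. F 0 t = (\<Sum>k<n. kern (real k + 1) (t - a) *\<^sub>R \<phi> k) + rl (real n) g t"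
proof -
  have gi: "integrable lborel g" and gz: "\<And>s. s < a \<Longrightarrow> g s = 0"
    using g by (auto simp: borel_rep_def)
  have "\<exists>\<phi>. \<forall>t\<in>{a<..<b}. F (n - Suc j) t = (\<Sum>k<Suc j. kern (real k + 1) (t - a) *\<^sub>R \<phi> k) + rl (real (Suc j)) g t"
    if "j < n" for j
    using that
  proof (induction j)
    case 0
    define m where "m = n - 1"
    have n: "n = Suc m" using assms(3) by (simp add: m_def)
    define t0 where "t0 = (a + b) / 2"
    have t0: "a < t0" "t0 < b" using assms(1) by (auto simp: t0_def)
    have inc: "F m v - F m u = rl 1 g v - rl 1 g u" if "a < u" "u \<le> v" "v < b" for u v
    proof -
      have "(F n has_integral F m v - F m u) {u..v}"
      proof (rule fundamental_theorem_of_calculus)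
        fix s assume "s \<in> {u..v}"
        then have "(F m has_vector_derivative F n s) (at s)"
          using deriv_towerD[OF assms(2), of m s] that by (simp add: n)
        then show "(F m has_vector_derivative F n s) (at s within {u..v})"
          by (rule has_vector_derivative_at_within)
      qed (use that in auto)
      then show ?thesis
        using borel_rep_rl_1[OF g, of u v] that by (simp add: has_integral_iff)
    qed
    have "F m t = (F m t0 - rl 1 g t0) + rl 1 g t" if "t \<in> {a<..<b}" for t
      using inc[of t t0] inc[of t0 t] t0 that by (cases "t \<le> t0") (auto simp: algebra_simps)
    then show ?case
      by (intro exI[of _ "\<lambda>_. F m t0 - rl 1 g t0"]) (auto simp: kern_1 m_def)
  next
    case (Suc j)
    then obtain \<phi> where \<phi>: "\<And>t. t \<in> {a<..<b} \<Longrightarrow>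
      F (n - Suc j) t = (\<Sum>k<Suc j. kern (real k + 1) (t - a) *\<^sub>R \<phi> k) + rl (real (Suc j)) g t"
      by auto
    define m where "m = n - Suc (Suc j)"
    have m: "n - Suc j = Suc m" using Suc.prems by (simp add: m_def)
    define G where "G = (\<lambda>t. (\<Sum>k<Suc j. kern (real (Suc k) + 1) (t - a) *\<^sub>R \<phi> k) + rl (real (Suc (Suc j))) g t)"
    have 1: "(F m has_vector_derivative F (Suc m) t) (at t)" if "t \<in> {a<..<b}" for t
      using deriv_towerD[OF assms(2), of m t] Suc.prems that by (simp add: m_def)
    have 2: "(G has_vector_derivative F (Suc m) t) (at t)" if "t \<in> {a<..<b}" for t
    proof -
      have "((\<lambda>t. \<Sum>k<Suc j. kern (real (Suc k) + 1) (t - a) *\<^sub>R \<phi> k) has_vector_derivative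
          (\<Sum>k<Suc j. kern (real k + 1) (t - a) *\<^sub>R \<phi> k)) (at t)"
      proof (rule has_vector_derivative_sum)
        fix k
        show "((\<lambda>t. kern (real (Suc k) + 1) (t - a) *\<^sub>R \<phi> k) has_vector_derivative kern (real k + 1) (t - a) *\<^sub>R \<phi> k) (at t)"
          using kern_scaleR_has_vector_derivative[of a t "real (Suc k) + 1" "\<phi> k"] that
          by (simp add: add.commute)
      qed
      moreover have "(rl (real (Suc (Suc j))) g has_vector_derivative rl (real (Suc j)) g t) (at t)"
      proof -
        have "(rl (real (Suc (Suc j))) g has_vector_derivative rl (real (Suc (Suc j)) - 1) g t) (at t)"
          by (rule rl_has_derivative[where a = a, OF _ gi gz]) auto
        then show ?thesis by simp
      qed
      ultimately show ?thesis
        unfolding G_def \<phi>[OF that, unfolded m] by (rule has_vector_derivative_add)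
    qed
    obtain c where c: "\<And>t. t \<in> {a<..<b} \<Longrightarrow> F m t = c + G t"
      using equal_derivatives_differ_by_const[OF 1 2] by blast
    have "F m t = (\<Sum>k<Suc (Suc j). kern (real k + 1) (t - a) *\<^sub>R (case k of 0 \<Rightarrow> c | Suc k \<Rightarrow> \<phi> k)) + rl (real (Suc (Suc j))) g t"
      if "t \<in> {a<..<b}" for t
      using c[OF that] that
      by (subst sum.lessThan_Suc_shift) (simp add: G_def kern_1 add.assoc)
    then show ?case unfolding m_def by blast
  qed
  from this[of "n - 1"] assms(3) show ?thesis by simp
qed

definition zext :: "real \<Rightarrow> real \<Rightarrow> (real \<Rightarrow> complex) \<Rightarrow> real \<Rightarrow> complex" where
  "zext a b h s = indicator {a..b} s *\<^sub>R h s"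

lemma zext_outside: "s \<notin> {a..b} \<Longrightarrow> zext a b h s = 0"
  by (simp add: zext_def)

lemma zext_measurable: "continuous_on {a..b} h \<Longrightarrow> zext a b h \<in> borel_measurable borel"
  unfolding zext_def by (rule borel_measurable_continuous_on_indicator) auto

lemma zext_bounded:
  assumes "continuous_on {a..b} h" obtains M where "M \<ge> 0" "\<And>s. norm (zext a b h s) \<le> M"
proof -
  have "bounded (h ` {a..b})"
    using assms by (intro compact_imp_bounded compact_continuous_image) auto
  then obtain M where "0 < M" "\<And>s. s \<in> {a..b} \<Longrightarrow> norm (h s) \<le> M"
    unfolding bounded_pos by auto
  then show ?thesis by (intro that[of M]) (auto simp: zext_def indicator_def)
qed

lemma zext_integrable: "continuous_on {a..b} h \<Longrightarrow> integrable lborel (zext a b h)"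
  unfolding zext_def using borel_integrable_atLeastAtMost'[of a b h] by (simp add: set_integrable_def)

text \<open>At \<open>s = t\<close> both kernels vanish, since \<open>0 powr e = 0\<close>, even for integer \<open>\<alpha>\<close>.\<close>

lemma left_kernel_int_eq_rl:
  assumes "0 < \<alpha>" "continuous_on {a..b} h" "t \<in> {a..b}"
  shows "rl (real (frac_n \<alpha>) - \<alpha>) (zext a b h) t = rGamma (real (frac_n \<alpha>) - \<alpha>) *\<^sub>R left_kernel_int \<alpha> a h t"
proof -
  let ?\<gamma> = "real (frac_n \<alpha>) - \<alpha>"
  obtain M where M: "\<And>s. norm (zext a b h s) \<le> M" using zext_bounded[OF assms(2)] by metis
  have "integrable lborel (\<lambda>s. kern ?\<gamma> (t - s) *\<^sub>R zext a b h s)"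
    by (rule kern_times_bounded_integrable(1)[of _ _ a])
       (use frac_n_bounds[OF assms(1)] M zext_measurable[OF assms(2)] in \<open>auto intro: zext_outside\<close>)
  then have "rl ?\<gamma> (zext a b h) t = integral UNIV (\<lambda>s. kern ?\<gamma> (t - s) *\<^sub>R zext a b h s)"
    unfolding rl_def using has_integral_integral_lborel by (metis integral_unique)
  also have "(\<lambda>s. kern ?\<gamma> (t - s) *\<^sub>R zext a b h s) =
      (\<lambda>s. if s \<in> {a..t} then rGamma ?\<gamma> *\<^sub>R (((t - s) powr (?\<gamma> - 1)) *\<^sub>R h s) else 0)"
    using assms(3) by (auto simp: fun_eq_iff kern_def zext_def)
  also have "integral UNIV \<dots> = integral {a..t} (\<lambda>s. rGamma ?\<gamma> *\<^sub>R (((t - s) powr (?\<gamma> - 1)) *\<^sub>R h s))"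
    by (rule integral_restrict_UNIV)
  also have "\<dots> = rGamma ?\<gamma> *\<^sub>R left_kernel_int \<alpha> a h t"
    unfolding left_kernel_int_def by (rule integral_cmul)
  finally show ?thesis .
qed

lemma rl_tendsto_0_bounded:
  assumes "0 < c" "f \<in> borel_measurable borel" "\<And>s. s < a \<Longrightarrow> f s = 0" "\<And>s. norm (f s) \<le> M"
  shows "(rl c f \<longlongrightarrow> 0) (at_right a)"
proof (rule Lim_null_comparison)
  show "((\<lambda>t. M * kern (c + 1) (t - a)) \<longlongrightarrow> 0) (at_right a)"
    using tendsto_mult[OF tendsto_const[of M] kern_tendsto_0[of "c + 1" a]] assms by simp
  show "\<forall>\<^sub>F t in at_right a. norm (rl c f t) \<le> M * kern (c + 1) (t - a)"
    using kern_times_bounded_integrable(2)[OF assms(1-3), where M = M] assms(4) by simp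
qed

lemma rl_tendsto_0:
  assumes "1 \<le> c" "integrable lborel f" "\<And>s. s < a \<Longrightarrow> f s = 0"
  shows "(rl c f \<longlongrightarrow> 0) (at_right a)"
proof -
  have "isCont (rl c f) a" using rl_isCont[of c f a a] assms by blast
  moreover have "rl c f a = 0" using rl_before[of a f a c] assms by blast
  ultimately show ?thesis unfolding isCont_def by (simp add: filterlim_at_split)
qed

text \<open>Taylor's formula for the fractional integral of order \<open>n - \<alpha>\<close>, whose \<open>n\<close>-th derivative is the
  fractional derivative. The constant term vanishes because a fractional integral of a bounded function
  tends to \<open>0\<close> at \<open>a\<close>.\<close>

lemma fractional_integral_taylor:
  assumes "a < b" "0 < \<alpha>" "left_reg \<alpha> a b h" "borel_rep a b (left_RL \<alpha> a h) g"
  obtains \<phi> where "\<phi> 0 = 0" "\<And>t. t \<in> {a<..<b} \<Longrightarrow> rl (real (frac_n \<alpha>) - \<alpha>) (zext a b h) t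
     = (\<Sum>k<frac_n \<alpha>. kern (real k + 1) (t - a) *\<^sub>R \<phi> k) + rl (real (frac_n \<alpha>)) g t"
proof -
  let ?n = "frac_n \<alpha>" and ?\<gamma> = "real (frac_n \<alpha>) - \<alpha>"
  have n: "0 < ?n" by (simp add: frac_n_def)
  have hc: "continuous_on {a..b} h" using assms(3) by (simp add: left_reg_def)
  define F where "F = (\<lambda>k t. rGamma ?\<gamma> *\<^sub>R (vderiv ^^ k) (left_kernel_int \<alpha> a h) t)"
  have tower: "deriv_tower ?n F {a<..<b}"
    using left_reg_tower[OF assms(3)]
    by (auto simp: deriv_tower_def F_def
        intro!: bounded_linear.has_vector_derivative[OF bounded_linear_scaleR_right])
  have "F ?n = left_RL \<alpha> a h"
    by (simp add: F_def left_RL_def fun_eq_iff rGamma_inverse_Gamma inverse_eq_divide)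
  then have "borel_rep a b (F ?n) g" using assms(4) by simp
  from taylor_integrable[OF assms(1) tower n this]
  obtain \<phi> where \<phi>: "\<And>t. t \<in> {a<..<b} \<Longrightarrow> F 0 t = (\<Sum>k<?n. kern (real k + 1) (t - a) *\<^sub>R \<phi> k) + rl (real ?n) g t"
    by blast
  have eq: "rl ?\<gamma> (zext a b h) t = (\<Sum>k<?n. kern (real k + 1) (t - a) *\<^sub>R \<phi> k) + rl (real ?n) g t"
    if "t \<in> {a<..<b}" for t
    using left_kernel_int_eq_rl[OF assms(2) hc, of t] \<phi>[OF that] that by (simp add: F_def)
  obtain M where M: "\<And>s. norm (zext a b h s) \<le> M" using zext_bounded[OF hc] by metis
  have ev: "eventually (\<lambda>t. t \<in> {a<..<b}) (at_right a)"
    using assms(1) eventually_at_right_less[of a] by (auto simp: eventually_at_right)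
  have "((\<lambda>t. (\<Sum>k<?n. kern (real k + 1) (t - a) *\<^sub>R \<phi> k)) \<longlongrightarrow> (\<Sum>k<?n. (if k = 0 then \<phi> 0 else 0))) (at_right a)"
  proof (rule tendsto_sum)
    fix k
    show "((\<lambda>t. kern (real k + 1) (t - a) *\<^sub>R \<phi> k) \<longlongrightarrow> (if k = 0 then \<phi> 0 else 0)) (at_right a)"
    proof (cases "k = 0")
      case True
      have "eventually (\<lambda>t. \<phi> 0 = kern 1 (t - a) *\<^sub>R \<phi> 0) (at_right a)"
        using ev by eventually_elim (auto simp: kern_1)
      then show ?thesis using True by (auto intro: Lim_transform_eventually[OF tendsto_const])
    next
      case False
      then show ?thesis
        using tendsto_scaleR[OF kern_tendsto_0[of "real k + 1" a] tendsto_const[of "\<phi> k"]] by simp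
    qed
  qed
  then have "((\<lambda>t. (\<Sum>k<?n. kern (real k + 1) (t - a) *\<^sub>R \<phi> k) + rl (real ?n) g t) \<longlongrightarrow> \<phi> 0 + 0) (at_right a)"
    using n rl_tendsto_0[of "real ?n" g a] assms(4)
    by (intro tendsto_add) (auto simp: borel_rep_def)
  then have "(rl ?\<gamma> (zext a b h) \<longlongrightarrow> \<phi> 0) (at_right a)"
    unfolding add_0_right
    by (rule Lim_transform_eventually) (use eq in \<open>auto intro: eventually_mono[OF ev]\<close>)
  moreover have "(rl ?\<gamma> (zext a b h) \<longlongrightarrow> 0) (at_right a)"
    by (rule rl_tendsto_0_bounded[OF _ zext_measurable[OF hc] _ M])
       (use frac_n_bounds[OF assms(2)] in \<open>auto simp: zext_def\<close>)
  ultimately have "\<phi> 0 = 0"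
    by (intro tendsto_unique[of "at_right a"]) auto
  then show ?thesis using eq by (rule that)
qed

text \<open>A function with an integrable fractional derivative of order \<open>\<alpha> \<ge> 1\<close> is the fractional integral of
  that derivative up to the singular solutions \<open>(t - a)^(\<alpha>-1-j)\<close> of the homogeneous equation. Applying the
  integral of order \<open>\<alpha> + 1 - n\<close> to the previous lemma turns its left-hand side into the primitive of \<open>h\<close>
  (Abel), and differentiating once gives the claim. For \<open>\<alpha> < 1\<close> the last step would fail, since \<open>rl \<alpha> g\<close>
  need not be continuous.\<close>

lemma left_representation:
  assumes "a < b" "1 \<le> \<alpha>" "left_reg \<alpha> a b h" "borel_rep a b (left_RL \<alpha> a h) g"
  obtains c where "\<And>t. t \<in> {a<..<b} \<Longrightarrow>
    h t = (\<Sum>j<nat \<lfloor>\<alpha>\<rfloor>. kern (\<alpha> - real j) (t - a) *\<^sub>R c j) + rl \<alpha> g t"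
proof -
  let ?n = "frac_n \<alpha>" and ?\<gamma> = "real (frac_n \<alpha>) - \<alpha>"
  have \<alpha>: "0 < \<alpha>" using assms(2) by simp
  have \<gamma>: "0 < ?\<gamma>" "?\<gamma> \<le> 1" using frac_n_bounds[OF \<alpha>] by auto
  have hc: "continuous_on {a..b} h" using assms(3) by (simp add: left_reg_def)
  have gi: "integrable lborel g" and gz: "\<And>s. s < a \<Longrightarrow> g s = 0"
    using assms(4) by (auto simp: borel_rep_def)
  have gm [measurable]: "g \<in> borel_measurable borel" using borel_rep_measurable[OF assms(4)] .
  have zm [measurable]: "zext a b h \<in> borel_measurable borel" by (rule zext_measurable[OF hc])
  obtain M where M: "\<And>s. norm (zext a b h s) \<le> M" using zext_bounded[OF hc] by metis
  define N where "N = nat \<lfloor>\<alpha>\<rfloor>"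
  have n: "?n = Suc N" by (simp add: frac_n_def N_def)
  have N\<alpha>: "real N \<le> \<alpha>" using assms(2) by (simp add: N_def)
  obtain \<phi> where \<phi>0: "\<phi> 0 = 0" and \<phi>: "\<And>t. t \<in> {a<..<b} \<Longrightarrow> rl ?\<gamma> (zext a b h) t
     = (\<Sum>k<?n. kern (real k + 1) (t - a) *\<^sub>R \<phi> k) + rl (real ?n) g t"
    using fractional_integral_taylor[OF assms(1) \<alpha> assms(3,4)] by metis
  have eq: "rl ?\<gamma> (zext a b h) t = (\<Sum>k<N. kern (real k + 2) (t - a) *\<^sub>R \<phi> (Suc k)) + rl (real ?n) g t"
    if "t < b" for t
  proof (cases "a < t")
    case True
    then show ?thesis
      using \<phi>[of t] that \<phi>0 sum.lessThan_Suc_shift[of "\<lambda>k. kern (real k + 1) (t - a) *\<^sub>R \<phi> k" N]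
      by (simp add: n algebra_simps del: sum.lessThan_Suc)
  next
    case False
    then show ?thesis
      using rl_before[of a "zext a b h" t] rl_before[of a g t] gz by (simp add: zext_def)
  qed
  have main: "rl 1 (zext a b h) t = (\<Sum>k<N. kern (real k + 3 - ?\<gamma>) (t - a) *\<^sub>R \<phi> (Suc k)) + rl (\<alpha> + 1) g t"
    if t: "t \<in> {a<..<b}" for t
  proof (cases "?\<gamma> = 1")
    case True
    then have "real ?n = \<alpha> + 1" by linarith
    then have "rl (real ?n) g t = rl (\<alpha> + 1) g t" by (simp only:)
    then show ?thesis using eq[of t] that True by (simp add: add.commute[of 2])
  next
    case False
    define d where "d = 1 - ?\<gamma>"
    have d: "0 < d" using False \<gamma> by (simp add: d_def)
    \<comment> \<open>Abel inversion\<close>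
    have s1: "rl d (rl ?\<gamma> (zext a b h)) t = rl 1 (zext a b h) t"
      using rl_semigroup[OF d \<gamma>(1) zm, of t] kern_times_integrable[OF _ zext_integrable[OF hc], of 1 a t]
      by (simp add: d_def zext_def)
    have s2: "rl d (rl (real ?n) g) t = rl (\<alpha> + 1) g t"
      using rl_semigroup[OF d, of "real ?n" g t] kern_times_integrable[of "\<alpha> + 1" g a t] gi gz \<alpha>
      by (simp add: d_def n algebra_simps)
    have kb: "has_bochner_integral lborel (\<lambda>s. kern d (t - s) *\<^sub>R (kern (real k + 2) (s - a) *\<^sub>R \<phi> (Suc k)))
        (kern (real k + 3 - ?\<gamma>) (t - a) *\<^sub>R \<phi> (Suc k))" for k
      using has_bochner_integral_scaleR_left[OF kern_convolution[of d "real k + 2" t a], of "\<phi> (Suc k)"] d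
      by (simp add: d_def algebra_simps)
    have gb: "has_bochner_integral lborel (\<lambda>s. kern d (t - s) *\<^sub>R rl (real ?n) g s) (rl d (rl (real ?n) g) t)"
    proof -
      have "continuous_on {a..t} (rl (real ?n) g)"
        using rl_isCont[of "real ?n" g a] gi gz n by (intro continuous_at_imp_continuous_on) auto
      then have "bounded (rl (real ?n) g ` {a..t})"
        by (intro compact_imp_bounded compact_continuous_image) auto
      then obtain K where K: "0 < K" "\<And>s. s \<in> {a..t} \<Longrightarrow> norm (rl (real ?n) g s) \<le> K"
        unfolding bounded_pos by auto
      have "norm (rl (real ?n) g s) \<le> K" if "s < t" for s
        using K rl_before[of a g s] gz that by (cases "s < a") auto
      then have "integrable lborel (\<lambda>s. kern d (t - s) *\<^sub>R rl (real ?n) g s)"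
        using rl_before[of a g] gz by (intro kern_times_bounded_integrable(1)[of d _ a t K] d) auto
      then show ?thesis by (simp add: has_bochner_integral_iff rl_def[of d])
    qed
    have "rl d (rl ?\<gamma> (zext a b h)) t =
        rl d (\<lambda>s. (\<Sum>k<N. kern (real k + 2) (s - a) *\<^sub>R \<phi> (Suc k)) + rl (real ?n) g s) t"
      by (rule rl_cong) (use eq t in auto)
    also have "\<dots> = (\<Sum>k<N. kern (real k + 3 - ?\<gamma>) (t - a) *\<^sub>R \<phi> (Suc k)) + rl d (rl (real ?n) g) t"
      unfolding rl_def[of d "\<lambda>s. _ s + _ s"] scaleR_add_right scaleR_sum_right
      by (intro has_bochner_integral_integral_eq has_bochner_integral_add has_bochner_integral_sum kb gb)
    finally show ?thesis using s1 s2 by simp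
  qed
  \<comment> \<open>the index is reversed so that \<open>c j\<close> belongs to the kernel of index \<open>\<alpha> - j\<close>\<close>
  define c where "c = (\<lambda>j. \<phi> (N - j))"
  have "h t = (\<Sum>j<N. kern (\<alpha> - real j) (t - a) *\<^sub>R c j) + rl \<alpha> g t" if t: "t \<in> {a<..<b}" for t
  proof -
    have "(rl 1 (zext a b h) has_vector_derivative zext a b h t) (at t)"
    proof (rule rl_1_has_derivative[where a = a and ?t0.0 = a and ?t1.0 = b])
      show "continuous_on {a<..<b} (zext a b h)"
        by (rule continuous_on_eq[of _ h]) (use hc in \<open>auto simp: zext_def intro: continuous_on_subset\<close>)
      show "zext a b h absolutely_integrable_on {a..b}"
        by (rule absolutely_integrable_continuous_real, rule continuous_on_eq[OF hc]) (auto simp: zext_def)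
    qed (use t in \<open>auto simp: zext_def\<close>)
    then have 1: "(rl 1 (zext a b h) has_vector_derivative h t) (at t)"
      using t by (simp add: zext_def)
    have "((\<lambda>t. (\<Sum>k<N. kern (real k + 3 - ?\<gamma>) (t - a) *\<^sub>R \<phi> (Suc k)) + rl (\<alpha> + 1) g t) has_vector_derivative
       (\<Sum>k<N. kern (real k + 3 - ?\<gamma> - 1) (t - a) *\<^sub>R \<phi> (Suc k)) + rl (\<alpha> + 1 - 1) g t) (at t)"
      by (intro has_vector_derivative_add has_vector_derivative_sum kern_scaleR_has_vector_derivative
           rl_has_derivative[OF _ gi gz]) (use t assms(2) in auto)
    then have "(rl 1 (zext a b h) has_vector_derivative
       (\<Sum>k<N. kern (real k + 3 - ?\<gamma> - 1) (t - a) *\<^sub>R \<phi> (Suc k)) + rl (\<alpha> + 1 - 1) g t) (at t)"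
      using has_vector_derivative_cong_open[of "{a<..<b}" t, OF _ t main] by simp
    from vector_derivative_unique_at[OF 1 this]
    have "h t = (\<Sum>k<N. kern (real k + 3 - ?\<gamma> - 1) (t - a) *\<^sub>R \<phi> (Suc k)) + rl \<alpha> g t" by simp
    also have "(\<Sum>k<N. kern (real k + 3 - ?\<gamma> - 1) (t - a) *\<^sub>R \<phi> (Suc k)) = (\<Sum>j<N. kern (\<alpha> - real j) (t - a) *\<^sub>R c j)"
    proof (subst sum.nat_diff_reindex[symmetric], rule sum.cong[OF refl])
      fix j assume "j \<in> {..<N}"
      then have e: "real (N - Suc j) + 3 - ?\<gamma> - 1 = \<alpha> - real j" "Suc (N - Suc j) = N - j"
        using n by (auto simp: of_nat_diff)
      show "kern (real (N - Suc j) + 3 - ?\<gamma> - 1) (t - a) *\<^sub>R \<phi> (Suc (N - Suc j)) = kern (\<alpha> - real j) (t - a) *\<^sub>R c j"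
        unfolding e c_def by (rule refl)
    qed
    finally show ?thesis .
  qed
  then show ?thesis unfolding N_def by (rule that)
qed

section \<open>Duality of the left and the right integral\<close>

text \<open>The exceptional set need not be measurable, hence the detour through a null set \<open>N\<close> containing it.\<close>

lemma AE_lborel_reflect:
  assumes "AE t in lborel. P (t::real)" shows "AE t in lborel. P (- t)"
proof -
  obtain N where N: "{t. \<not> P t} \<subseteq> N" "N \<in> null_sets lborel"
    using assms by (auto simp: eventually_ae_filter)
  then have [measurable]: "N \<in> sets borel" by auto
  have "AE t in lborel. t \<notin> N" using N(2) by (rule AE_not_in)
  then have "AE t in lborel. 0 + (- 1) * t \<notin> N"
    by (intro AE_borel_affine) auto
  then show ?thesis by eventually_elim (use N(1) in auto)
qed

lemma integrable_lborel_reflect: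
  fixes f :: "real \<Rightarrow> complex"
  shows "integrable lborel f \<Longrightarrow> integrable lborel (\<lambda>t. f (- t))"
  using lborel_integrable_real_affine[of f "-1" 0] by simp

lemma borel_rep_reflect:
  assumes "borel_rep a b f g" "\<And>t. t \<in> {a<..<b} \<Longrightarrow> f t = F (- t)"
  shows "borel_rep (- b) (- a) F (\<lambda>t. g (- t))"
proof -
  have "AE t in lborel. - t \<in> {a..b} \<longrightarrow> f (- t) = g (- t)"
    by (rule AE_lborel_reflect) (use assms(1) in \<open>simp add: borel_rep_def\<close>)
  moreover have "AE t in lborel. t \<noteq> - a" "AE t in lborel. t \<noteq> - b"
    by (rule AE_lborel_singleton)+
  ultimately have "AE t in lborel. t \<in> {- b..- a} \<longrightarrow> F t = g (- t)"
  proof eventually_elim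
    case (elim t)
    then show ?case using assms(2)[of "- t"] by auto
  qed
  moreover have "integrable lborel (\<lambda>t. g (- t))"
    using assms(1) by (intro integrable_lborel_reflect) (simp add: borel_rep_def)
  moreover have "g (- t) = 0" if "t \<notin> {- b..- a}" for t
    using assms(1) that by (auto simp: borel_rep_def)
  ultimately show ?thesis unfolding borel_rep_def by blast
qed

lemma right_representation:
  assumes "a < b" "1 \<le> \<alpha>" "right_reg \<alpha> a b p" "borel_rep a b (right_RL \<alpha> b p) g"
  obtains d where "\<And>t. t \<in> {a<..<b} \<Longrightarrow>
    p t = (\<Sum>j<nat \<lfloor>\<alpha>\<rfloor>. kern (\<alpha> - real j) (b - t) *\<^sub>R d j) + rr \<alpha> g t"
proof -
  have \<alpha>: "0 < \<alpha>" using assms(2) by simp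
  note r = right_reg_reflect[OF \<alpha> assms(3)]
  have "borel_rep (- b) (- a) (left_RL \<alpha> (- b) (\<lambda>s. p (- s))) (\<lambda>t. g (- t))"
    by (rule borel_rep_reflect[OF assms(4)]) (rule r(2))
  then obtain d where d: "\<And>t. t \<in> {- b<..<- a} \<Longrightarrow>
    p (- t) = (\<Sum>j<nat \<lfloor>\<alpha>\<rfloor>. kern (\<alpha> - real j) (t - - b) *\<^sub>R d j) + rl \<alpha> (\<lambda>t. g (- t)) t"
    using left_representation[OF _ assms(2) r(1)] assms(1) by auto
  show ?thesis
  proof (rule that[of d])
    fix t assume "t \<in> {a<..<b}"
    then show "p t = (\<Sum>j<nat \<lfloor>\<alpha>\<rfloor>. kern (\<alpha> - real j) (b - t) *\<^sub>R d j) + rr \<alpha> g t"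
      using d[of "- t"] by (simp add: rr_eq_rl_reflect algebra_simps)
  qed
qed

lemma has_vector_derivative_iff_quotient:
  "(f has_vector_derivative v) (at t) \<longleftrightarrow> ((\<lambda>h. (f (t + h) - f t) /\<^sub>R h) \<longlongrightarrow> v) (at 0)"
proof -
  have "(f has_vector_derivative v) (at t) \<longleftrightarrow> ((\<lambda>h. norm (f (t + h) - f t - h *\<^sub>R v) / norm h) \<longlongrightarrow> 0) (at 0)"
    by (simp add: has_vector_derivative_def has_derivative_at bounded_linear_scaleR_left)
  also have "\<dots> \<longleftrightarrow> ((\<lambda>h. norm ((f (t + h) - f t) /\<^sub>R h - v)) \<longlongrightarrow> 0) (at 0)"
  proof (rule filterlim_cong[OF refl refl])
    have "norm (f (t + h) - f t - h *\<^sub>R v) / norm h = norm ((f (t + h) - f t) /\<^sub>R h - v)" if "h \<noteq> 0" for h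
    proof -
      have "(f (t + h) - f t) /\<^sub>R h - v = (f (t + h) - f t - h *\<^sub>R v) /\<^sub>R h"
        using that by (simp add: scaleR_diff_right)
      then show ?thesis by (simp add: divide_inverse mult.commute)
    qed
    then show "\<forall>\<^sub>F h in at 0. norm (f (t + h) - f t - h *\<^sub>R v) / norm h = norm ((f (t + h) - f t) /\<^sub>R h - v)"
      by (auto simp: eventually_at_filter)
  qed
  also have "\<dots> \<longleftrightarrow> ((\<lambda>h. (f (t + h) - f t) /\<^sub>R h) \<longlongrightarrow> v) (at 0)"
    by (simp add: tendsto_norm_zero_iff Lim_null[symmetric])
  finally show ?thesis .
qed

lemma pairing_of_integrable:
  assumes "integrable (lborel \<Otimes>\<^sub>M lborel) (\<lambda>(t, s). kern c (t - s) *\<^sub>R (p t * f s) :: complex)"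
  shows "(LINT t|lborel. p t * rl c f t) = (LINT s|lborel. f s * rr c p s)"
proof -
  have "(LINT s|lborel. LINT t|lborel. kern c (t - s) *\<^sub>R (p t * f s)) =
        (LINT t|lborel. LINT s|lborel. kern c (t - s) *\<^sub>R (p t * f s))"
    by (rule lborel_pair.Fubini_integral[OF assms])
  moreover have "(LINT t|lborel. kern c (t - s) *\<^sub>R (p t * f s)) = f s * rr c p s" for s
  proof -
    have "(LINT t|lborel. kern c (t - s) *\<^sub>R (p t * f s)) = (LINT t|lborel. f s * (kern c (t - s) *\<^sub>R p t))"
      by (simp add: mult.commute)
    also have "\<dots> = f s * rr c p s" unfolding rr_def by (rule integral_mult_right_zero)
    finally show ?thesis .
  qed
  moreover have "(LINT s|lborel. kern c (t - s) *\<^sub>R (p t * f s)) = p t * rl c f t" for t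
  proof -
    have "(LINT s|lborel. kern c (t - s) *\<^sub>R (p t * f s)) = (LINT s|lborel. p t * (kern c (t - s) *\<^sub>R f s))"
      by simp
    also have "\<dots> = p t * rl c f t" unfolding rl_def by (rule integral_mult_right_zero)
    finally show ?thesis .
  qed
  ultimately show ?thesis by simp
qed

text \<open>The kernel is bounded on the supports, so two integrable factors are enough for Fubini.\<close>

lemma pairing_L1:
  assumes "1 \<le> c" "integrable lborel f" "integrable lborel p"
    "\<And>s. s < a \<Longrightarrow> f s = 0" "\<And>t. b < t \<Longrightarrow> p t = 0"
  shows "(LINT t|lborel. p t * rl c f t) = (LINT s|lborel. f s * rr c p s)"
proof (rule pairing_of_integrable, rule Bochner_Integration.integrable_bound)
  have [measurable]: "f \<in> borel_measurable borel" "p \<in> borel_measurable borel"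
    using assms(2,3)[THEN borel_measurable_integrable] by auto
  have "integrable (lborel \<Otimes>\<^sub>M lborel) (\<lambda>(t, s). p t * f s)"
  proof (rule lborel_pair.Fubini_integrable)
    show "integrable lborel (\<lambda>t. LINT s|lborel. norm (case (t, s) of (t, s) \<Rightarrow> p t * f s))"
      using assms(2,3) by (simp add: norm_mult)
    show "AE t in lborel. integrable lborel (\<lambda>s. case (t, s) of (t, s) \<Rightarrow> p t * f s)"
      using assms(2) by simp
  qed measurable
  then show "integrable (lborel \<Otimes>\<^sub>M lborel) (\<lambda>x. kern c (b - a) *\<^sub>R (case x of (t, s) \<Rightarrow> p t * f s))"
    by simp
  show "(\<lambda>(t, s). kern c (t - s) *\<^sub>R (p t * f s)) \<in> borel_measurable (lborel \<Otimes>\<^sub>M lborel)"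
    by measurable
  show "AE x in lborel \<Otimes>\<^sub>M lborel. norm (case x of (t, s) \<Rightarrow> kern c (t - s) *\<^sub>R (p t * f s))
      \<le> norm (kern c (b - a) *\<^sub>R (case x of (t, s) \<Rightarrow> p t * f s))"
  proof (intro AE_I2)
    fix x :: "real \<times> real"
    obtain t s where x: "x = (t, s)" by force
    show "norm (case x of (t, s) \<Rightarrow> kern c (t - s) *\<^sub>R (p t * f s)) \<le> norm (kern c (b - a) *\<^sub>R (case x of (t, s) \<Rightarrow> p t * f s))"
      using assms(1,4,5) kern_mono[of c "t - s" "b - a"] unfolding x
      by (cases "s < a"; cases "b < t") (auto simp: kern_nonneg intro!: mult_right_mono)
  qed
qed

text \<open>Here the kernel may be singular, so both factors have to be bounded.\<close>

lemma pairing_bounded: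
  assumes "0 < c" and [measurable]: "f \<in> borel_measurable borel" "p \<in> borel_measurable borel"
    and "\<And>s. s \<notin> {a..b} \<Longrightarrow> f s = 0" "\<And>t. t \<notin> {a..b} \<Longrightarrow> p t = 0"
    and "\<And>s. norm (f s) \<le> M" "\<And>t. norm (p t) \<le> K"
  shows "(LINT t|lborel. p t * rl c f t) = (LINT s|lborel. f s * rr c p s)"
proof (rule pairing_of_integrable, rule lborel_pair.Fubini_integrable)
  define f' where "f' = (\<lambda>s. complex_of_real (norm (f s)))"
  have [measurable]: "f' \<in> borel_measurable borel" unfolding f'_def by measurable
  have K0: "0 \<le> K" using assms(7)[of 0] norm_ge_zero[of "p 0"] by linarith
  have M0: "0 \<le> M" using assms(6)[of 0] norm_ge_zero[of "f 0"] by linarith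
  show "(\<lambda>(t, s). kern c (t - s) *\<^sub>R (p t * f s)) \<in> borel_measurable (lborel \<Otimes>\<^sub>M lborel)"
    by measurable
  have int: "integrable lborel (\<lambda>s. kern c (t - s) *\<^sub>R f s)" for t
    by (rule kern_times_bounded_integrable(1)[of c f a t M]) (use assms in auto)
  show "AE t in lborel. integrable lborel (\<lambda>s. case (t, s) of (t, s) \<Rightarrow> kern c (t - s) *\<^sub>R (p t * f s))"
    using integrable_mult_right[OF int, of "p t" t for t] by simp
  have bd: "(LINT s|lborel. kern c (t - s) * norm (f s)) \<le> M * kern (c + 1) (t - a)" 
     "0 \<le> (LINT s|lborel. kern c (t - s) * norm (f s))" for t
  proof -
    have "norm (rl c f' t) \<le> M * kern (c + 1) (t - a)"
      by (rule kern_times_bounded_integrable(2)) (use assms in \<open>auto simp: f'_def\<close>)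
    moreover have "rl c f' t = complex_of_real (LINT s|lborel. kern c (t - s) * norm (f s))"
      unfolding rl_def f'_def by (simp add: scaleR_conv_of_real flip: of_real_mult)
    ultimately show "(LINT s|lborel. kern c (t - s) * norm (f s)) \<le> M * kern (c + 1) (t - a)" by simp
    show "0 \<le> (LINT s|lborel. kern c (t - s) * norm (f s))"
      using assms(1) by (intro integral_nonneg_AE) (auto simp: kern_nonneg)
  qed
  have eq: "(LINT s|lborel. norm (case (t, s) of (t, s) \<Rightarrow> kern c (t - s) *\<^sub>R (p t * f s)))
      = norm (p t) * (LINT s|lborel. kern c (t - s) * norm (f s))" for t
  proof -
    have "norm (case (t, s) of (t, s) \<Rightarrow> kern c (t - s) *\<^sub>R (p t * f s)) = norm (p t) * (kern c (t - s) * norm (f s))" for s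
      using assms(1) by (simp add: norm_mult kern_nonneg)
    then show ?thesis by (simp only: integral_mult_right_zero)
  qed
  show "integrable lborel (\<lambda>t. LINT s|lborel. norm (case (t, s) of (t, s) \<Rightarrow> kern c (t - s) *\<^sub>R (p t * f s)))"
    unfolding eq
  proof (rule Bochner_Integration.integrable_bound)
    show "integrable lborel (\<lambda>t. K * (M * kern (c + 1) (b - a)) * indicator {a..b} t)"
      by (intro integrable_mult_right) (simp add: integrable_indicator_iff emeasure_lborel_Icc_eq)
    show "AE t in lborel. norm (norm (p t) * (LINT s|lborel. kern c (t - s) * norm (f s)))
        \<le> norm (K * (M * kern (c + 1) (b - a)) * indicator {a..b} t)"
    proof (intro AE_I2)
      fix t
      show "norm (norm (p t) * (LINT s|lborel. kern c (t - s) * norm (f s)))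
        \<le> norm (K * (M * kern (c + 1) (b - a)) * indicator {a..b} t)"
      proof (cases "t \<in> {a..b}")
        case True
        have "M * kern (c + 1) (t - a) \<le> M * kern (c + 1) (b - a)"
          using True assms(1) M0 by (intro mult_left_mono kern_mono) auto
        then have "norm (p t) * (LINT s|lborel. kern c (t - s) * norm (f s)) \<le> K * (M * kern (c + 1) (b - a))"
          using bd[of t] assms(7)[of t] K0 by (intro mult_mono) auto
        moreover have "0 \<le> K * (M * kern (c + 1) (b - a))"
          using K0 M0 assms(1) by (simp add: kern_nonneg)
        ultimately show ?thesis using True bd(2)[of t] K0 M0 kern_nonneg[of "c + 1" "b - a"] assms(1)
          by (simp add: abs_mult)
      qed (use assms(5) in auto)
    qed
  qed measurable
qed

lemma rl_shift: "rl c f (t - \<delta>) = rl c (\<lambda>s. f (s - \<delta>)) t"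
  unfolding rl_def
  by (subst lborel_integral_real_affine[of 1 _ "- \<delta>"]) (auto simp: algebra_simps)

lemma lborel_integral_shift:
  fixes F :: "real \<Rightarrow> complex"
  shows "(LINT s|lborel. F (s - \<delta>)) = (LINT s|lborel. F s)"
  by (subst (2) lborel_integral_real_affine[of 1 _ "- \<delta>"]) (auto simp: algebra_simps)

lemma rl_1_increment_bound:
  assumes [measurable]: "f \<in> borel_measurable borel" and "\<And>s. s < a \<Longrightarrow> f s = 0" "\<And>s. norm (f s) \<le> M" "0 \<le> \<delta>"
  shows "norm (rl 1 f t - rl 1 f (t - \<delta>)) \<le> M * \<delta>"
proof -
  have i: "integrable lborel (\<lambda>s. kern 1 (t - s) *\<^sub>R f s)" for t
    by (rule kern_times_bounded_integrable(1)[of _ _ a]) (use assms in auto)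
  have "rl 1 f t - rl 1 f (t - \<delta>) = (LINT s|lborel. kern 1 (t - s) *\<^sub>R f s - kern 1 (t - \<delta> - s) *\<^sub>R f s)"
    unfolding rl_def by (rule Bochner_Integration.integral_diff[symmetric]) (rule i)+
  also have "norm \<dots> \<le> (LINT s|lborel. norm (kern 1 (t - s) *\<^sub>R f s - kern 1 (t - \<delta> - s) *\<^sub>R f s))"
    by (rule integral_norm_bound)
  also have "\<dots> \<le> (LINT s|lborel. M * indicator {t - \<delta>..t} s)"
  proof (rule integral_mono)
    show "integrable lborel (\<lambda>s. norm (kern 1 (t - s) *\<^sub>R f s - kern 1 (t - \<delta> - s) *\<^sub>R f s))"
      by (intro integrable_norm Bochner_Integration.integrable_diff i)
    show "norm (kern 1 (t - s) *\<^sub>R f s - kern 1 (t - \<delta> - s) *\<^sub>R f s) \<le> M * indicator {t - \<delta>..t} s" for s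
      using assms(3)[of s] assms(4) norm_ge_zero[of "f s"]
      by (auto simp: kern_1 indicator_def simp del: norm_ge_zero intro: order_trans)
  qed (simp add: integrable_indicator_iff emeasure_lborel_Icc_eq)
  also have "\<dots> = M * \<delta>" using assms(4) by simp
  finally show ?thesis .
qed

text \<open>The difference quotients of the primitive of \<open>h\<close> converge to \<open>h\<close> and stay below the bound of \<open>h\<close>, so
  that they may be integrated against the merely integrable \<open>g\<close>.\<close>

lemma rl_1_difference_quotient:
  assumes "continuous_on {a..b} h" "borel_rep a b G g"
  shows "(\<lambda>n. LINT t|lborel. of_real (real (Suc n)) * (g t * (rl 1 (zext a b h) t - rl 1 (zext a b h) (t - 1 / real (Suc n)))))
    \<longlonglongrightarrow> (LINT t|lborel. g t * zext a b h t)"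
proof -
  let ?h = "zext a b h"
  have [measurable]: "?h \<in> borel_measurable borel" "g \<in> borel_measurable borel"
    using zext_measurable[OF assms(1)] borel_rep_measurable[OF assms(2)] by auto
  have gi: "integrable lborel g" and gz: "\<And>t. t \<notin> {a..b} \<Longrightarrow> g t = 0"
    using assms(2) by (auto simp: borel_rep_def)
  have hz: "\<And>s. s < a \<Longrightarrow> ?h s = 0" by (simp add: zext_outside)
  obtain M where M: "M \<ge> 0" "\<And>s. norm (?h s) \<le> M" using zext_bounded[OF assms(1)] by blast
  show ?thesis
  proof (rule integral_dominated_convergence[where w = "\<lambda>t. M * norm (g t)"])
    show "integrable lborel (\<lambda>t. M * norm (g t))" using gi by simp
    show "AE t in lborel. norm (of_real (real (Suc n)) * (g t * (rl 1 ?h t - rl 1 ?h (t - 1 / real (Suc n))))) \<le> M * norm (g t)" for n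
    proof (intro AE_I2)
      fix t
      have "real (Suc n) * norm (rl 1 ?h t - rl 1 ?h (t - 1 / real (Suc n))) \<le> real (Suc n) * (M * (1 / real (Suc n)))"
        by (intro mult_left_mono rl_1_increment_bound[OF _ hz M(2)]) auto
      also have "\<dots> = M" by simp
      finally have *: "real (Suc n) * norm (rl 1 ?h t - rl 1 ?h (t - 1 / real (Suc n))) \<le> M" .
      have "norm (of_real (real (Suc n)) * (g t * (rl 1 ?h t - rl 1 ?h (t - 1 / real (Suc n)))))
         = norm (g t) * (real (Suc n) * norm (rl 1 ?h t - rl 1 ?h (t - 1 / real (Suc n))))"
        unfolding norm_mult norm_of_real abs_of_nat by (simp only: mult_ac)
      also have "\<dots> \<le> norm (g t) * M" by (rule mult_left_mono[OF *]) simp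
      finally show "norm (of_real (real (Suc n)) * (g t * (rl 1 ?h t - rl 1 ?h (t - 1 / real (Suc n))))) \<le> M * norm (g t)"
        by (simp only: mult.commute)
    qed
    have "AE t in lborel. t \<noteq> a" "AE t in lborel. t \<noteq> b" by (rule AE_lborel_singleton)+
    then show "AE t in lborel. (\<lambda>n. of_real (real (Suc n)) * (g t * (rl 1 ?h t - rl 1 ?h (t - 1 / real (Suc n)))))
        \<longlonglongrightarrow> g t * ?h t"
    proof eventually_elim
      case (elim t)
      show ?case
      proof (cases "t \<in> {a..b}")
        case True
        with elim have t: "a < t" "t < b" by auto
        have c: "continuous_on {a..b} ?h"
          by (rule continuous_on_eq[OF assms(1)]) (auto simp: zext_def)
        have "(rl 1 ?h has_vector_derivative ?h t) (at t)"
          by (rule rl_1_has_derivative[where a = a and ?t0.0 = a and ?t1.0 = b])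
             (use t hz c in \<open>auto intro: absolutely_integrable_continuous_real continuous_on_subset\<close>)
        then have "((\<lambda>h. (rl 1 ?h (t + h) - rl 1 ?h t) /\<^sub>R h) \<longlongrightarrow> ?h t) (at 0)"
          by (simp add: has_vector_derivative_iff_quotient)
        moreover have "filterlim (\<lambda>n. - (1 / real (Suc n))) (at 0) sequentially"
          unfolding filterlim_at using LIMSEQ_inverse_real_of_nat tendsto_minus[of "\<lambda>n. inverse (real (Suc n))" 0 sequentially]
          by (simp add: inverse_eq_divide)
        ultimately have "(\<lambda>n. (rl 1 ?h (t + - (1 / real (Suc n))) - rl 1 ?h t) /\<^sub>R - (1 / real (Suc n))) \<longlonglongrightarrow> ?h t"
          by (rule filterlim_compose)
        then have "(\<lambda>n. g t * ((rl 1 ?h (t + - (1 / real (Suc n))) - rl 1 ?h t) /\<^sub>R - (1 / real (Suc n)))) \<longlonglongrightarrow> g t * ?h t"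
          by (intro tendsto_intros)
        moreover have "g t * ((rl 1 ?h (t + - (1 / real (Suc n))) - rl 1 ?h t) /\<^sub>R - (1 / real (Suc n)))
          = of_real (real (Suc n)) * (g t * (rl 1 ?h t - rl 1 ?h (t - 1 / real (Suc n))))" for n
          by (simp add: scaleR_conv_of_real algebra_simps del: of_nat_Suc)
        ultimately show ?thesis by simp
      qed (simp add: gz)
    qed
  qed measurable
qed

section \<open>Integration by parts from primitives and from representations\<close>

lemma zext_reflect: "zext (- b) (- a) (\<lambda>s. p (- s)) s = zext a b p (- s)"
  by (auto simp: zext_def indicator_def)

lemma LINT_reflect:
  fixes F :: "real \<Rightarrow> complex"
  shows "(LINT t|lborel. F (- t)) = (LINT t|lborel. F t)"
  by (subst (2) lborel_integral_real_affine[of "-1" _ 0]) auto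

lemma bounded_times_integrable:
  fixes f \<phi> :: "real \<Rightarrow> complex"
  assumes "integrable lborel f" "\<phi> \<in> borel_measurable borel" "\<And>t. norm (\<phi> t) \<le> M"
  shows "integrable lborel (\<lambda>t. \<phi> t * f t)" "integrable lborel (\<lambda>t. f t * \<phi> t)"
proof -
  have [measurable]: "f \<in> borel_measurable borel"
    using borel_measurable_integrable[OF assms(1)] by simp
  note [measurable] = assms(2)
  show *: "integrable lborel (\<lambda>t. \<phi> t * f t)"
  proof (rule Bochner_Integration.integrable_bound)
    show "integrable lborel (\<lambda>t. M * norm (f t))" using assms(1) by simp
    show "AE t in lborel. norm (\<phi> t * f t) \<le> norm (M * norm (f t))"
    proof (intro AE_I2)
      fix t
      have "norm (\<phi> t * f t) \<le> M * norm (f t)"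
        unfolding norm_mult by (rule mult_right_mono[OF assms(3)]) simp
      then show "norm (\<phi> t * f t) \<le> norm (M * norm (f t))"
        by (simp only: real_norm_def abs_ge_self[THEN order_trans[rotated]])
    qed
  qed measurable
  then show "integrable lborel (\<lambda>t. f t * \<phi> t)" by (simp add: mult.commute)
qed

lemma rl_1_shift_integrable:
  assumes "continuous_on {a..b} h" "borel_rep a b G g" "0 \<le> \<delta>"
  shows "integrable lborel (\<lambda>t. g t * rl 1 (zext a b h) (t - \<delta>))"
proof -
  let ?h = "zext a b h"
  obtain M where M: "M \<ge> 0" "\<And>s. norm (?h s) \<le> M" using zext_bounded[OF assms(1)] by blast
  have [measurable]: "?h \<in> borel_measurable borel" "g \<in> borel_measurable borel"
    using zext_measurable[OF assms(1)] borel_rep_measurable[OF assms(2)] by auto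
  show ?thesis
  proof (rule Bochner_Integration.integrable_bound)
    show "integrable lborel (\<lambda>t. M * kern (1 + 1) (b - a) * norm (g t))"
      using assms(2) by (simp add: borel_rep_def)
    show "AE t in lborel. norm (g t * rl 1 ?h (t - \<delta>)) \<le> norm (M * kern (1 + 1) (b - a) * norm (g t))"
    proof (intro AE_I2)
      fix t
      show "norm (g t * rl 1 ?h (t - \<delta>)) \<le> norm (M * kern (1 + 1) (b - a) * norm (g t))"
      proof (cases "t \<in> {a..b}")
        case True
        have "norm (rl 1 ?h (t - \<delta>)) \<le> M * kern (1 + 1) (t - \<delta> - a)"
          by (rule kern_times_bounded_integrable(2)) (use M in \<open>auto intro: zext_outside\<close>)
        also have "\<dots> \<le> M * kern (1 + 1) (b - a)"
          using True assms(3) M by (intro mult_left_mono kern_mono) auto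
        finally have "norm (g t) * norm (rl 1 ?h (t - \<delta>)) \<le> norm (g t) * (M * kern (1 + 1) (b - a))"
          by (intro mult_left_mono) auto
        then show ?thesis using M by (simp add: norm_mult abs_mult kern_nonneg mult_ac)
      qed (use assms(2) in \<open>auto simp: borel_rep_def\<close>)
    qed
  qed measurable
qed

lemma rl_1_difference_quotient_split:
  assumes "continuous_on {a..b} h" "borel_rep a b G g"
  shows "(\<lambda>n. of_real (real (Suc n)) * ((LINT t|lborel. g t * rl 1 (zext a b h) t)
      - (LINT t|lborel. g t * rl 1 (zext a b h) (t - 1 / real (Suc n)))))
    \<longlonglongrightarrow> (LINT t|lborel. g t * zext a b h t)"
proof -
  let ?H = "rl 1 (zext a b h)"
  have "(LINT t|lborel. of_real (real (Suc n)) * (g t * (?H t - ?H (t - 1 / real (Suc n)))))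
    = of_real (real (Suc n)) * ((LINT t|lborel. g t * ?H t) - (LINT t|lborel. g t * ?H (t - 1 / real (Suc n))))" for n
    using rl_1_shift_integrable[OF assms, of 0] rl_1_shift_integrable[OF assms, of "1 / real (Suc n)"]
    by (simp add: right_diff_distrib del: of_nat_Suc)
  with rl_1_difference_quotient[OF assms] show ?thesis by (simp del: of_nat_Suc)
qed

lemma pairing_L1_shift:
  assumes "1 \<le> c" "integrable lborel f" "integrable lborel p"
    "\<And>s. s < a \<Longrightarrow> f s = 0" "\<And>t. b < t \<Longrightarrow> p t = 0" "0 \<le> \<delta>"
  shows "(LINT t|lborel. p t * rl c f (t - \<delta>)) = (LINT s|lborel. f s * rr c p (s + \<delta>))"
proof -
  have "integrable lborel (\<lambda>s. f (s - \<delta>))"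
    using lborel_integrable_real_affine[OF assms(2), of 1 "- \<delta>"] by simp
  then have "(LINT t|lborel. p t * rl c (\<lambda>s. f (s - \<delta>)) t) = (LINT s|lborel. f (s - \<delta>) * rr c p s)"
    by (rule pairing_L1[OF assms(1) _ assms(3) _ assms(5), where a = a]) (use assms(4,6) in auto)
  also have "\<dots> = (LINT s|lborel. f (s - \<delta>) * rr c p (s - \<delta> + \<delta>))" by simp
  also have "\<dots> = (LINT s|lborel. f s * rr c p (s + \<delta>))"
    by (rule lborel_integral_shift[where F = "\<lambda>s. f s * rr c p (s + \<delta>)"])
  finally show ?thesis by (simp add: rl_shift)
qed

lemma pairing_bounded_shift:
  assumes "0 < c" and [measurable]: "f \<in> borel_measurable borel" "p \<in> borel_measurable borel"
    and "\<And>s. s \<notin> {a..b} \<Longrightarrow> f s = 0" "\<And>t. t \<notin> {a..b} \<Longrightarrow> p t = 0"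
    and "\<And>s. norm (f s) \<le> M" "\<And>t. norm (p t) \<le> K" "0 \<le> \<delta>"
  shows "(LINT t|lborel. p t * rl c f (t - \<delta>)) = (LINT s|lborel. f s * rr c p (s + \<delta>))"
proof -
  have "(LINT t|lborel. p t * rl c (\<lambda>s. f (s - \<delta>)) t) = (LINT s|lborel. f (s - \<delta>) * rr c p s)"
    by (rule pairing_bounded[where a = a and b = "b + \<delta>" and M = M and K = K]) (use assms in auto)
  also have "\<dots> = (LINT s|lborel. f (s - \<delta>) * rr c p (s - \<delta> + \<delta>))" by simp
  also have "\<dots> = (LINT s|lborel. f s * rr c p (s + \<delta>))"
    by (rule lborel_integral_shift[where F = "\<lambda>s. f s * rr c p (s + \<delta>)"])
  finally show ?thesis by (simp add: rl_shift)
qed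

text \<open>For order below one, the fractional integral of order \<open>1 - \<alpha>\<close> is absolutely continuous with
  derivative \<open>f\<close> and without constant term.\<close>

lemma rl_eq_rl_1_low_order:
  assumes "a < b" "0 < \<alpha>" "\<alpha> < 1" "left_reg \<alpha> a b h" "borel_rep a b (left_RL \<alpha> a h) f" "t < b"
  shows "rl (1 - \<alpha>) (zext a b h) t = rl 1 f t"
proof (cases "a < t")
  case True
  have n: "frac_n \<alpha> = 1" using assms(2,3) by (simp add: frac_n_def floor_eq_iff)
  obtain \<phi> where "\<phi> 0 = 0" "\<And>t. t \<in> {a<..<b} \<Longrightarrow> rl (real (frac_n \<alpha>) - \<alpha>) (zext a b h) t
     = (\<Sum>k<frac_n \<alpha>. kern (real k + 1) (t - a) *\<^sub>R \<phi> k) + rl (real (frac_n \<alpha>)) f t"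
    using fractional_integral_taylor[OF assms(1,2,4,5)] by blast
  then show ?thesis using True assms(6) by (simp add: n)
next
  case False
  then show ?thesis
    using rl_before[of a "zext a b h" t] rl_before[of a f t] assms(5) by (simp add: zext_outside borel_rep_def)
qed

text \<open>For \<open>\<alpha> < 1\<close> one cannot write \<open>h = rl \<alpha> f\<close> and \<open>p = rr \<alpha> g\<close> and apply Fubini: the kernel is singular and
  both \<open>f\<close> and \<open>g\<close> are only integrable. Instead, primitives are shifted: for every shift \<open>\<delta>\<close> the pairing of \<open>f\<close>
  with the shifted primitive of \<open>p\<close> equals the pairing of \<open>g\<close> with the shifted primitive of \<open>h\<close>, because
  fractional integration of the bounded functions \<open>h\<close> and \<open>p\<close> commutes with translations and Fubini does
  apply to bounded functions. Difference quotients in \<open>\<delta>\<close> then give the claim.\<close>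

lemma integration_by_parts_low_order:
  assumes "a < b" "0 < \<alpha>" "\<alpha> < 1" and h: "left_reg \<alpha> a b h" and f: "borel_rep a b (left_RL \<alpha> a h) f"
    and p: "right_reg \<alpha> a b p" and g: "borel_rep a b (right_RL \<alpha> b p) g"
  shows "(LINT t|lborel. f t * zext a b p t) = (LINT t|lborel. g t * zext a b h t)"
proof -
  define p' f' g' where "p' = (\<lambda>s. p (- s))" and "f' = (\<lambda>s. f (- s))" and "g' = (\<lambda>s. g (- s))"
  note r = right_reg_reflect[OF assms(2) p, folded p'_def]
  have g': "borel_rep (- b) (- a) (left_RL \<alpha> (- b) p') g'"
    unfolding g'_def by (rule borel_rep_reflect[OF g]) (rule r(2))
  have f': "borel_rep (- b) (- a) (\<lambda>t. left_RL \<alpha> a h (- t)) f'"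
    unfolding f'_def by (rule borel_rep_reflect[OF f]) simp
  have hc: "continuous_on {a..b} h" and pc: "continuous_on {a..b} p" and p'c: "continuous_on {- b..- a} p'"
    using h p r(1) by (simp_all add: left_reg_def right_reg_def)
  let ?h = "zext a b h" and ?p = "zext a b p"
  obtain M where M: "\<And>s. norm (?h s) \<le> M" using zext_bounded[OF hc] by blast
  obtain K where K: "\<And>s. norm (?p s) \<le> K" using zext_bounded[OF pc] by blast
  have p0: "zext (- b) (- a) p' = (\<lambda>s. ?p (- s))"
    by (simp add: p'_def zext_reflect fun_eq_iff)
  have fi: "integrable lborel f" and gi: "integrable lborel g"
    using f g by (auto simp: borel_rep_def)
  \<comment> \<open>Two uses of Fubini with the bounded kernel of order \<open>1\<close> enclose one with the singular kernel of order \<open>1 - \<alpha>\<close>. To the left of \<open>b\<close>, the primitive of \<open>f\<close> is the fractional integral of \<open>h\<close>.\<close>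
  have key: "(LINT t|lborel. f' t * rl 1 (zext (- b) (- a) p') (t - \<delta>)) = (LINT t|lborel. g t * rl 1 ?h (t - \<delta>))"
    if "0 \<le> \<delta>" for \<delta>
  proof -
    have "(LINT t|lborel. f' t * rl 1 (zext (- b) (- a) p') (t - \<delta>)) = (LINT t|lborel. f (- t) * rr 1 ?p (- t + \<delta>))"
      by (simp add: f'_def rr_eq_rl_reflect p0)
    also have "\<dots> = (LINT t|lborel. f t * rr 1 ?p (t + \<delta>))"
      by (rule LINT_reflect[where F = "\<lambda>t. f t * rr 1 ?p (t + \<delta>)"])
    also have "\<dots> = (LINT t|lborel. ?p t * rl 1 f (t - \<delta>))"
      by (rule pairing_L1_shift[symmetric, where a = a and b = b])
         (use fi f zext_integrable[OF pc] that in \<open>auto simp: borel_rep_def zext_outside\<close>)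
    also have "\<dots> = (LINT t|lborel. ?p t * rl (1 - \<alpha>) ?h (t - \<delta>))"
    proof (rule integral_cong_AE)
      have "AE t in lborel. t \<noteq> b" by (rule AE_lborel_singleton)
      then show "AE t in lborel. ?p t * rl 1 f (t - \<delta>) = ?p t * rl (1 - \<alpha>) ?h (t - \<delta>)"
      proof eventually_elim
        case (elim t)
        show ?case
        proof (cases "t < b")
          case True
          then show ?thesis using rl_eq_rl_1_low_order[OF assms(1-3) h f, of "t - \<delta>"] that by simp
        qed (use elim in \<open>simp add: zext_outside\<close>)
      qed
    qed (use zext_measurable[OF hc] zext_measurable[OF pc] borel_rep_measurable[OF f] in measurable)
    also have "\<dots> = (LINT s|lborel. ?h s * rr (1 - \<alpha>) ?p (s + \<delta>))"
      by (rule pairing_bounded_shift[where a = a and b = b, OF _ zext_measurable[OF hc] zext_measurable[OF pc] _ _ M K that])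
         (use assms in \<open>auto simp: zext_outside\<close>)
    also have "\<dots> = (LINT s|lborel. ?h s * rr 1 g (s + \<delta>))"
    proof (rule integral_cong_AE)
      have "AE t in lborel. t \<noteq> a" by (rule AE_lborel_singleton)
      then show "AE s in lborel. ?h s * rr (1 - \<alpha>) ?p (s + \<delta>) = ?h s * rr 1 g (s + \<delta>)"
      proof eventually_elim
        case (elim s)
        show ?case
        proof (cases "a < s")
          case True
          then show ?thesis
            using rl_eq_rl_1_low_order[OF _ assms(2,3) r(1) g', of "- (s + \<delta>)"] that assms(1)
            by (simp add: rr_eq_rl_reflect p0 g'_def)
        qed (use elim in \<open>simp add: zext_outside\<close>)
      qed
    qed (use zext_measurable[OF hc] zext_measurable[OF pc] borel_rep_measurable[OF g] in \<open>simp_all add: rr_eq_rl_reflect\<close>)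
    also have "\<dots> = (LINT t|lborel. g t * rl 1 ?h (t - \<delta>))"
      by (rule pairing_L1_shift[symmetric, where a = a and b = b])
         (use gi g zext_integrable[OF hc] that in \<open>auto simp: borel_rep_def zext_outside\<close>)
    finally show ?thesis .
  qed
  have "(LINT t|lborel. f' t * zext (- b) (- a) p' t) = (LINT t|lborel. g t * ?h t)"
  proof (rule LIMSEQ_unique)
    show "(\<lambda>n. of_real (real (Suc n)) * ((LINT t|lborel. f' t * rl 1 (zext (- b) (- a) p') t)
        - (LINT t|lborel. f' t * rl 1 (zext (- b) (- a) p') (t - 1 / real (Suc n)))))
      \<longlonglongrightarrow> (LINT t|lborel. f' t * zext (- b) (- a) p' t)"
      by (rule rl_1_difference_quotient_split[OF p'c f'])
    show "(\<lambda>n. of_real (real (Suc n)) * ((LINT t|lborel. f' t * rl 1 (zext (- b) (- a) p') t)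
        - (LINT t|lborel. f' t * rl 1 (zext (- b) (- a) p') (t - 1 / real (Suc n)))))
      \<longlonglongrightarrow> (LINT t|lborel. g t * ?h t)"
      using rl_1_difference_quotient_split[OF hc g] key[of 0] key[of "1 / real (Suc n)" for n]
      by (simp del: of_nat_Suc)
  qed
  moreover have "(LINT t|lborel. f' t * zext (- b) (- a) p' t) = (LINT t|lborel. f t * ?p t)"
    using LINT_reflect[where F = "\<lambda>t. f t * ?p t"] by (simp add: f'_def p0)
  ultimately show ?thesis by simp
qed

text \<open>For \<open>\<alpha> \<ge> 1\<close> the kernel is bounded, so Fubini applies to the regular parts of the two representations,
  and only the homogeneous solutions have to be matched. The one in \<open>p\<close> contributes \<open>d\<close> times \<open>rl \<alpha> f b\<close>, which
  \<open>h b = 0\<close> expresses through the coefficients \<open>c j\<close>; the ones in \<open>h\<close> contribute \<open>c j\<close> times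
  \<open>rr (\<alpha> - j) g a\<close>, and the last hypothesis says that the two contributions agree. Up to sign that hypothesis
  is the vanishing at \<open>a\<close> of the derivative of order \<open>j\<close> of \<open>p\<close>.\<close>

lemma integration_by_parts_high_order:
  assumes "a < b" "1 \<le> \<alpha>" and N: "1 \<le> N" "real N \<le> \<alpha>"
    and f: "borel_rep a b Ff f" and g: "borel_rep a b Gg g"
    and hc: "continuous_on {a..b} h" and pc: "continuous_on {a..b} p" and hb: "h b = 0"
    and h: "\<And>t. t \<in> {a<..<b} \<Longrightarrow> h t = (\<Sum>j<N. kern (\<alpha> - real j) (t - a) *\<^sub>R c j) + rl \<alpha> f t"
    and p: "\<And>t. t \<in> {a<..<b} \<Longrightarrow> p t = kern \<alpha> (b - t) *\<^sub>R d + rr \<alpha> g t"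
    and pa: "\<And>j. j < N \<Longrightarrow> c j = 0 \<or> kern (\<alpha> - real j) (b - a) *\<^sub>R d + rr (\<alpha> - real j) g a = 0"
  shows "(LINT t|lborel. f t * zext a b p t) = (LINT t|lborel. g t * zext a b h t)"
proof -
  have fi: "integrable lborel f" and gi: "integrable lborel g"
    and fz: "\<And>t. t \<notin> {a..b} \<Longrightarrow> f t = 0" and gz: "\<And>t. t \<notin> {a..b} \<Longrightarrow> g t = 0"
    using f g by (auto simp: borel_rep_def)
  have fm [measurable]: "f \<in> borel_measurable borel" and gm [measurable]: "g \<in> borel_measurable borel"
    using borel_rep_measurable[OF f] borel_rep_measurable[OF g] by auto
  have ab: "AE t in lborel. t \<noteq> a" "AE t in lborel. t \<noteq> b" by (rule AE_lborel_singleton)+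
  have rrm [measurable]: "rr \<alpha> g \<in> borel_measurable borel"
    unfolding rr_def by measurable
  have k1: "integrable lborel (\<lambda>t. kern \<alpha> (b - t) *\<^sub>R f t)"
    by (rule kern_times_integrable[OF assms(2) fi, of a]) (simp add: fz)
  have fza: "f s = 0" if "s < a" for s using fz[of s] that by simp
  have contf: "isCont (rl \<alpha> f) t" for t by (rule rl_isCont[OF assms(2) fi fza])
  then have cont: "continuous_on {a..b} (rl \<alpha> f)"
    by (simp add: continuous_at_imp_continuous_on)
  have contr: "continuous_on {a..b} (rr \<alpha> g)"
  proof -
    have "isCont (rl \<alpha> (\<lambda>s. g (- s))) t" for t
      by (rule rl_isCont[OF assms(2) integrable_lborel_reflect[OF gi], where a = "- b"]) (simp add: gz)
    then have "isCont (\<lambda>t. rl \<alpha> (\<lambda>s. g (- s)) (- t)) t" for t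
      by (rule isCont_o2[where f = uminus, rotated]) simp
    then show ?thesis unfolding rr_eq_rl_reflect[abs_def] by (simp add: continuous_at_imp_continuous_on)
  qed
  have int: "integrable lborel (\<lambda>t. F t * G t)"
    if F: "integrable lborel F" "\<And>t. t \<notin> {a..b} \<Longrightarrow> F t = 0" and G: "continuous_on {a..b} G" for F G :: "real \<Rightarrow> complex"
  proof -
    obtain M where M: "\<And>s. norm (zext a b G s) \<le> M" using zext_bounded[OF G] by blast
    have "integrable lborel (\<lambda>t. F t * zext a b G t)"
      by (rule bounded_times_integrable(2)[OF F(1) zext_measurable[OF G] M])
    moreover have "F t * zext a b G t = F t * G t" for t
      using F(2)[of t] by (cases "t \<in> {a..b}") (auto simp: zext_def)
    ultimately show ?thesis by simp
  qed
  \<comment> \<open>the representation of \<open>h\<close> extends continuously to \<open>b\<close>, where \<open>h\<close> vanishes\<close>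
  have rl_b: "(\<Sum>j<N. kern (\<alpha> - real j) (b - a) *\<^sub>R c j) + rl \<alpha> f b = 0"
  proof (rule tendsto_unique)
    show "at_left b \<noteq> bot" by simp
    have "isCont (\<lambda>t. kern (\<alpha> - real j) (t - a) *\<^sub>R c j) b" for j
      by (rule has_vector_derivative_continuous[OF kern_scaleR_has_vector_derivative[OF assms(1)]])
    then have "isCont (\<lambda>t. (\<Sum>j<N. kern (\<alpha> - real j) (t - a) *\<^sub>R c j) + rl \<alpha> f t) b"
      by (intro isCont_add isCont_sum contf) auto
    then show "((\<lambda>t. (\<Sum>j<N. kern (\<alpha> - real j) (t - a) *\<^sub>R c j) + rl \<alpha> f t) \<longlongrightarrow>
        (\<Sum>j<N. kern (\<alpha> - real j) (b - a) *\<^sub>R c j) + rl \<alpha> f b) (at_left b)"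
      unfolding isCont_def by (simp add: filterlim_at_split)
    have "(h \<longlongrightarrow> h b) (at_left b)"
    proof -
      have "(h \<longlongrightarrow> h b) (at b within {a..b})"
        using hc assms(1) by (simp add: continuous_on_def)
      then show ?thesis by (simp only: at_within_Icc_at_left[OF assms(1)])
    qed
    then show "((\<lambda>t. (\<Sum>j<N. kern (\<alpha> - real j) (t - a) *\<^sub>R c j) + rl \<alpha> f t) \<longlongrightarrow> 0) (at_left b)"
      unfolding hb
    proof (rule Lim_transform_eventually)
      have "eventually (\<lambda>t. t \<in> {a<..<b}) (at_left b)"
        by (rule eventually_at_left_real[OF assms(1)])
      then show "eventually (\<lambda>t. h t = (\<Sum>j<N. kern (\<alpha> - real j) (t - a) *\<^sub>R c j) + rl \<alpha> f t) (at_left b)"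
        by eventually_elim (rule h)
    qed
  qed
  have "(LINT t|lborel. f t * zext a b p t) = (LINT t|lborel. d * (kern \<alpha> (b - t) *\<^sub>R f t) + f t * rr \<alpha> g t)"
  proof (rule integral_cong_AE)
    show "AE t in lborel. f t * zext a b p t = d * (kern \<alpha> (b - t) *\<^sub>R f t) + f t * rr \<alpha> g t"
      using ab
    proof eventually_elim
      case (elim t)
      show ?case
      proof (cases "t \<in> {a..b}")
        case True
        then show ?thesis using elim p[of t] by (simp add: zext_def scaleR_conv_of_real algebra_simps)
      qed (simp add: fz)
    qed
  qed (use zext_measurable[OF pc] in measurable)
  also have "\<dots> = d * rl \<alpha> f b + (LINT t|lborel. f t * rr \<alpha> g t)"
  proof -
    have "integrable lborel (\<lambda>t. f t * rr \<alpha> g t)" by (rule int[OF fi _ contr]) (simp add: fz)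
    from Bochner_Integration.integral_add[OF integrable_mult_right[OF k1, of d] this]
    show ?thesis by (simp only: integral_mult_right_zero rl_def[of \<alpha> f b])
  qed
  also have "(LINT t|lborel. f t * rr \<alpha> g t) = (LINT t|lborel. g t * rl \<alpha> f t)"
    by (rule pairing_L1[symmetric, where a = a and b = b]) (use assms(2) fi gi fz gz in auto)
  finally have 1: "(LINT t|lborel. f t * zext a b p t) = d * rl \<alpha> f b + (LINT t|lborel. g t * rl \<alpha> f t)" .
  have k2: "integrable lborel (\<lambda>s. c j * (kern (\<alpha> - real j) (s - a) *\<^sub>R g s))" if "j < N" for j
  proof -
    have "integrable lborel (\<lambda>s. kern (\<alpha> - real j) (- a - s) *\<^sub>R g (- s))"
      by (rule kern_times_integrable[where a = "- b"])
         (use that N integrable_lborel_reflect[OF gi] gz in auto)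
    then have "integrable lborel (\<lambda>s. kern (\<alpha> - real j) (s - a) *\<^sub>R g s)"
      using integrable_lborel_reflect[OF \<open>integrable lborel (\<lambda>s. kern (\<alpha> - real j) (- a - s) *\<^sub>R g (- s))\<close>] by simp
    then show ?thesis by (rule integrable_mult_right)
  qed
  have "(LINT t|lborel. g t * zext a b h t)
     = (LINT t|lborel. (\<Sum>j<N. c j * (kern (\<alpha> - real j) (t - a) *\<^sub>R g t)) + g t * rl \<alpha> f t)"
  proof (rule integral_cong_AE)
    show "AE t in lborel. g t * zext a b h t = (\<Sum>j<N. c j * (kern (\<alpha> - real j) (t - a) *\<^sub>R g t)) + g t * rl \<alpha> f t"
      using ab
    proof eventually_elim
      case (elim t)
      show ?case
      proof (cases "t \<in> {a..b}")
        case True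
        then show ?thesis using elim h[of t]
          by (simp add: zext_def scaleR_conv_of_real sum_distrib_left algebra_simps)
      qed (simp add: gz)
    qed
  qed (use zext_measurable[OF hc] in measurable)
  also have "\<dots> = (\<Sum>j<N. c j * rr (\<alpha> - real j) g a) + (LINT t|lborel. g t * rl \<alpha> f t)"
  proof -
    have 1: "integrable lborel (\<lambda>t. g t * rl \<alpha> f t)" by (rule int[OF gi _ cont]) (simp add: gz)
    have 2: "integrable lborel (\<lambda>t. \<Sum>j<N. c j * (kern (\<alpha> - real j) (t - a) *\<^sub>R g t))"
      by (rule Bochner_Integration.integrable_sum) (use k2 in auto)
    have "(LINT t|lborel. (\<Sum>j<N. c j * (kern (\<alpha> - real j) (t - a) *\<^sub>R g t)))
        = (\<Sum>j<N. (LINT t|lborel. c j * (kern (\<alpha> - real j) (t - a) *\<^sub>R g t)))"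
      by (rule Bochner_Integration.integral_sum) (use k2 in auto)
    also have "\<dots> = (\<Sum>j<N. c j * rr (\<alpha> - real j) g a)"
      unfolding rr_def by (simp only: integral_mult_right_zero)
    finally show ?thesis
      unfolding Bochner_Integration.integral_add[OF 2 1] by (simp only:)
  qed
  also have "(\<Sum>j<N. c j * rr (\<alpha> - real j) g a) = (\<Sum>j<N. - (d * (kern (\<alpha> - real j) (b - a) *\<^sub>R c j)))"
  proof (rule sum.cong[OF refl])
    fix j assume "j \<in> {..<N}"
    then have "c j = 0 \<or> rr (\<alpha> - real j) g a = - (kern (\<alpha> - real j) (b - a) *\<^sub>R d)"
      using pa[of j] by (auto simp: eq_neg_iff_add_eq_0 add.commute)
    then show "c j * rr (\<alpha> - real j) g a = - (d * (kern (\<alpha> - real j) (b - a) *\<^sub>R c j))"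
      by (auto simp: scaleR_conv_of_real)
  qed
  also have "\<dots> = d * rl \<alpha> f b"
  proof -
    have "rl \<alpha> f b = - (\<Sum>j<N. kern (\<alpha> - real j) (b - a) *\<^sub>R c j)"
      using rl_b by (simp add: eq_neg_iff_add_eq_0 add.commute)
    then show ?thesis by (simp add: sum_negf sum_distrib_left)
  qed
  finally show ?thesis using 1 by simp
qed

section \<open>Boundary behaviour and fractional integration by parts\<close>

text \<open>The shape of the conclusion of \<open>left_representation\<close>, with coefficients \<open>e\<close> and fractional derivative \<open>f\<close>;
  only the values of \<open>p\<close> in the open interval matter.\<close>

definition left_repr where
  "left_repr \<alpha> a b N p e f \<longleftrightarrow> integrable lborel f \<and> (\<forall>s<a. f s = 0)
    \<and> (\<forall>t\<in>{a<..<b}. p t = (\<Sum>i<N. kern (\<alpha> - real i) (t - a) *\<^sub>R e i) + rl \<alpha> f t)"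

definition right_repr where
  "right_repr \<alpha> a b N p d g \<longleftrightarrow> integrable lborel g \<and> (\<forall>s>b. g s = 0)
    \<and> (\<forall>t\<in>{a<..<b}. p t = (\<Sum>i<N. kern (\<alpha> - real i) (b - t) *\<^sub>R d i) + rr \<alpha> g t)"

lemma right_repr_reflect:
  assumes "right_repr \<alpha> a b N p d g"
  shows "left_repr \<alpha> (- b) (- a) N (\<lambda>s. p (- s)) d (\<lambda>s. g (- s))"
  unfolding left_repr_def
proof (intro conjI ballI allI impI)
  show "integrable lborel (\<lambda>s. g (- s))"
    using assms by (intro integrable_lborel_reflect) (simp add: right_repr_def)
  show "g (- s) = 0" if "s < - b" for s using assms that by (simp add: right_repr_def)
  fix t assume "t \<in> {- b<..<- a}"
  then have "- t \<in> {a<..<b}" by auto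
  then have "p (- t) = (\<Sum>i<N. kern (\<alpha> - real i) (b - - t) *\<^sub>R d i) + rr \<alpha> g (- t)"
    using assms by (simp add: right_repr_def)
  then show "p (- t) = (\<Sum>i<N. kern (\<alpha> - real i) (t - - b) *\<^sub>R d i) + rl \<alpha> (\<lambda>s. g (- s)) t"
    by (simp add: rr_eq_rl_reflect add.commute)
qed

lemma left_repr_reflect:
  assumes "left_repr \<alpha> a b N p e f"
  shows "right_repr \<alpha> (- b) (- a) N (\<lambda>s. p (- s)) e (\<lambda>s. f (- s))"
  unfolding right_repr_def
proof (intro conjI ballI allI impI)
  show "integrable lborel (\<lambda>s. f (- s))"
    using assms by (intro integrable_lborel_reflect) (simp add: left_repr_def)
  show "f (- s) = 0" if "- a < s" for s using assms that by (simp add: left_repr_def)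
  fix t assume "t \<in> {- b<..<- a}"
  then have "- t \<in> {a<..<b}" by auto
  then have "p (- t) = (\<Sum>i<N. kern (\<alpha> - real i) (- t - a) *\<^sub>R e i) + rl \<alpha> f (- t)"
    using assms by (simp add: left_repr_def)
  then show "p (- t) = (\<Sum>i<N. kern (\<alpha> - real i) (- a - t) *\<^sub>R e i) + rr \<alpha> (\<lambda>s. f (- s)) t"
    by (simp add: rr_eq_rl_reflect minus_diff_commute add.commute)
qed

text \<open>Differentiation lowers the index of every kernel by one; it is possible \<open>N - 1\<close> times, as long as the
  order of the remaining fractional integral is at least \<open>1\<close>.\<close>

lemma left_repr_deriv_tower:
  assumes r: "left_repr \<alpha> a b N p e f" and N: "real N \<le> \<alpha>"
  shows "deriv_tower (N - 1)
    (\<lambda>k t. (\<Sum>i<N. kern (\<alpha> - real i - real k) (t - a) *\<^sub>R e i) + rl (\<alpha> - real k) f t) {a<..<b}"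
    (is "deriv_tower _ ?L _")
  unfolding deriv_tower_def
proof (intro allI impI ballI)
  fix k t assume k: "k < N - 1" and t: "t \<in> {a<..<b}"
  have fi: "integrable lborel f" and fz: "\<And>s. s < a \<Longrightarrow> f s = 0"
    using r by (auto simp: left_repr_def)
  have "2 \<le> \<alpha> - real k" using k N by linarith
  then have "(?L k has_vector_derivative (\<Sum>i<N. kern (\<alpha> - real i - real k - 1) (t - a) *\<^sub>R e i)
      + rl (\<alpha> - real k - 1) f t) (at t)"
    by (intro has_vector_derivative_add has_vector_derivative_sum kern_scaleR_has_vector_derivative
         rl_has_derivative[OF _ fi fz]) (use t in auto)
  moreover have "\<alpha> - real i - real k - 1 = \<alpha> - real i - real (Suc k)" "\<alpha> - real k - 1 = \<alpha> - real (Suc k)" for i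
    by simp_all
  ultimately show "(?L k has_vector_derivative ?L (Suc k) t) (at t)"
    by (simp only:)
qed

lemma left_repr_vderiv:
  assumes r: "left_repr \<alpha> a b N p e f" and N: "real N \<le> \<alpha>" "k < N" and t: "t \<in> {a<..<b}"
  shows "(vderiv ^^ k) p t = (\<Sum>i<N. kern (\<alpha> - real i - real k) (t - a) *\<^sub>R e i) + rl (\<alpha> - real k) f t"
  using r N t by (subst deriv_tower_vderiv[OF _ left_repr_deriv_tower[OF r N(1)]]) (auto simp: left_repr_def)

lemma right_repr_vderiv:
  assumes r: "right_repr \<alpha> a b N p d g" and N: "real N \<le> \<alpha>" "k < N" and t: "t \<in> {a<..<b}"
  shows "(vderiv ^^ k) p t = (- 1) ^ k *\<^sub>R
    ((\<Sum>i<N. kern (\<alpha> - real i - real k) (b - t) *\<^sub>R d i) + rr (\<alpha> - real k) g t)"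
proof -
  have "deriv_tower (N - 1) (\<lambda>k t. (- 1) ^ k *\<^sub>R
      ((\<Sum>i<N. kern (\<alpha> - real i - real k) (- t - - b) *\<^sub>R d i) + rl (\<alpha> - real k) (\<lambda>s. g (- s)) (- t))) {a<..<b}"
    using deriv_tower_reflect[OF left_repr_deriv_tower[OF right_repr_reflect[OF r] N(1)]] by simp
  then show ?thesis
    using r N t by (subst deriv_tower_vderiv[of "{a<..<b}" "N - 1"]) (auto simp: right_repr_def rr_eq_rl_reflect)
qed

text \<open>Seen from the right representation the point \<open>a\<close> is a regular point: there the derivatives of \<open>p\<close> up to
  order \<open>N - 1\<close> have finite limits.\<close>

lemma right_repr_limit:
  assumes r: "right_repr \<alpha> a b N p d g" and N: "real N \<le> \<alpha>" "k < N" and ab: "a < b"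
  shows "((\<lambda>t. (- 1) ^ k *\<^sub>R (vderiv ^^ k) p t) \<longlongrightarrow>
    (\<Sum>i<N. kern (\<alpha> - real i - real k) (b - a) *\<^sub>R d i) + rr (\<alpha> - real k) g a) (at_right a)"
proof -
  have ev: "eventually (\<lambda>t. t \<in> {a<..<b}) (at_right a)"
    by (rule eventually_at_right_real[OF ab])
  have gi: "integrable lborel (\<lambda>s. g (- s))"
    using r by (intro integrable_lborel_reflect) (simp add: right_repr_def)
  have "isCont (rl (\<alpha> - real k) (\<lambda>s. g (- s))) (- a)"
    by (rule rl_isCont[OF _ gi, of _ "- b"]) (use r N in \<open>auto simp: right_repr_def\<close>)
  then have "isCont (\<lambda>t. rl (\<alpha> - real k) (\<lambda>s. g (- s)) (- t)) a"
    by (rule isCont_o2[where f = uminus, rotated]) simp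
  then have "isCont (rr (\<alpha> - real k) g) a" unfolding rr_eq_rl_reflect[abs_def] .
  moreover have "isCont (\<lambda>t. kern c (b - t)) a" for c
    by (rule isCont_o2[where f = "\<lambda>t. b - t"]) (use kern_continuous_at[of "b - a" c] ab in auto)
  ultimately have "isCont (\<lambda>t. (\<Sum>i<N. kern (\<alpha> - real i - real k) (b - t) *\<^sub>R d i) + rr (\<alpha> - real k) g t) a"
    by (intro isCont_add isCont_sum isCont_scaleR) auto
  then have "((\<lambda>t. (\<Sum>i<N. kern (\<alpha> - real i - real k) (b - t) *\<^sub>R d i) + rr (\<alpha> - real k) g t) \<longlongrightarrow>
    (\<Sum>i<N. kern (\<alpha> - real i - real k) (b - a) *\<^sub>R d i) + rr (\<alpha> - real k) g a) (at_right a)"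
    unfolding isCont_def by (simp add: filterlim_at_split)
  then show ?thesis
  proof (rule Lim_transform_eventually)
    show "\<forall>\<^sub>F t in at_right a. (\<Sum>i<N. kern (\<alpha> - real i - real k) (b - t) *\<^sub>R d i) + rr (\<alpha> - real k) g t
       = (- 1) ^ k *\<^sub>R (vderiv ^^ k) p t"
      using ev
    proof eventually_elim
      case (elim t)
      then show ?case
        using right_repr_vderiv[OF r N elim] by (simp flip: power_mult_distrib)
    qed
  qed
qed

text \<open>For \<open>i \<ge> 1\<close> the terms behave like \<open>(t - a)^(\<theta>-i)\<close> and blow up at different rates. Multiplying by
  \<open>(t - a)^(M-\<theta>)\<close> isolates the worst one, so a finite limit forces its coefficient to vanish.\<close>

lemma singular_coefficients_vanish:
  fixes e :: "nat \<Rightarrow> complex"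
  assumes "0 < \<theta>" "\<theta> < 1" "((\<lambda>t. \<Sum>i<N. kern (\<theta> + 1 - real i) (t - a) *\<^sub>R e i) \<longlongrightarrow> l) (at_right a)"
    "1 \<le> i" "i < N"
  shows "e i = 0"
  using assms(3,5)
proof (induction N arbitrary: l)
  case (Suc M)
  show ?case
  proof (cases "M = 0")
    case False
    have pos: "eventually (\<lambda>t. a < t) (at_right a)" by (rule eventually_at_right_less)
    have pw: "((\<lambda>t. (t - a) powr c) \<longlongrightarrow> 0) (at_right a)" if "0 < c" for c
      using that by (intro tendsto_zero_powrI) (auto intro!: tendsto_eq_intros simp: eventually_at_filter)
    have "((\<lambda>t. (t - a) powr (real M - \<theta>) *\<^sub>R (\<Sum>i<Suc M. kern (\<theta> + 1 - real i) (t - a) *\<^sub>R e i)) \<longlongrightarrow> 0 *\<^sub>R l) (at_right a)"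
      using False assms(2) by (intro tendsto_scaleR pw Suc.prems(1)) linarith
    moreover have "((\<lambda>t. (t - a) powr (real M - \<theta>) *\<^sub>R (\<Sum>i<Suc M. kern (\<theta> + 1 - real i) (t - a) *\<^sub>R e i)) \<longlongrightarrow>
        (\<Sum>i<M. 0 *\<^sub>R e i) + rGamma (\<theta> + 1 - real M) *\<^sub>R e M) (at_right a)"
    proof (rule Lim_transform_eventually)
      show "((\<lambda>t. (\<Sum>i<M. (rGamma (\<theta> + 1 - real i) * (t - a) powr (real M - real i)) *\<^sub>R e i) + rGamma (\<theta> + 1 - real M) *\<^sub>R e M) \<longlongrightarrow>
        (\<Sum>i<M. 0 *\<^sub>R e i) + rGamma (\<theta> + 1 - real M) *\<^sub>R e M) (at_right a)"
        by (intro tendsto_add tendsto_sum tendsto_const tendsto_scaleR tendsto_mult_right_zero pw) auto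
      show "\<forall>\<^sub>F t in at_right a. (\<Sum>i<M. (rGamma (\<theta> + 1 - real i) * (t - a) powr (real M - real i)) *\<^sub>R e i) + rGamma (\<theta> + 1 - real M) *\<^sub>R e M
         = (t - a) powr (real M - \<theta>) *\<^sub>R (\<Sum>i<Suc M. kern (\<theta> + 1 - real i) (t - a) *\<^sub>R e i)"
        using pos
      proof eventually_elim
        case (elim t)
        have *: "(t - a) powr (real M - \<theta>) * kern (\<theta> + 1 - real i) (t - a) = rGamma (\<theta> + 1 - real i) * (t - a) powr (real M - real i)" for i
        proof -
          have "(t - a) powr (real M - \<theta>) * (t - a) powr (\<theta> - real i) = (t - a) powr (real M - real i)"
            by (simp flip: powr_add)
          then show ?thesis using elim by (simp add: kern_def)
        qed
        show ?case using elim
          by (simp add: scaleR_sum_right scaleR_add_right *)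
      qed
    qed
    ultimately have "0 *\<^sub>R l = (\<Sum>i<M. 0 *\<^sub>R e i) + rGamma (\<theta> + 1 - real M) *\<^sub>R e M"
      by (rule tendsto_unique[rotated]) simp
    moreover have "rGamma (\<theta> + 1 - real M) \<noteq> 0"
    proof
      assume "rGamma (\<theta> + 1 - real M) = 0"
      then obtain n where "\<theta> + 1 - real M = of_int n" by (auto simp: rGamma_eq_zero_iff nonpos_Ints_def)
      then have n: "\<theta> = of_int (n + int M - 1)" by simp
      then have "0 < n + int M - 1" "n + int M - 1 < 1"
        using assms(1,2) by (simp_all only: of_int_0_less_iff of_int_less_1_iff)
      then show False by simp
    qed
    ultimately have eM: "e M = 0" by simp
    show ?thesis
    proof (cases "i = M")
      case False
      then have "i < M" using Suc.prems(2) by simp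
      moreover have "((\<lambda>t. \<Sum>i<M. kern (\<theta> + 1 - real i) (t - a) *\<^sub>R e i) \<longlongrightarrow> l) (at_right a)"
        using Suc.prems(1) by (simp add: eM)
      ultimately show ?thesis by (rule Suc.IH[rotated])
    qed (simp add: eM)
  qed (use Suc.prems assms(4) in auto)
qed simp

text \<open>If \<open>p\<close> has fractional derivatives of the same noninteger order from both sides, its behaviour at \<open>a\<close> is
  described twice. By the right representation the derivative of order \<open>N - 1\<close> has a finite limit at \<open>a\<close>,
  so the left representation has no blowing-up term; what remains of the left representation, together with
  its derivatives up to order \<open>N - 1\<close>, tends to \<open>0\<close> at \<open>a\<close>. Two-sided regularity thus does for
  noninteger orders what the natural boundary condition does for integer ones.\<close>

lemma two_sided_noninteger_order:
  assumes ab: "a < b" and N: "real N < \<alpha>" "\<alpha> < real N + 1" "1 \<le> N"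
    and l: "left_repr \<alpha> a b N p e f" and r: "right_repr \<alpha> a b N p d g"
  shows "\<And>i. 1 \<le> i \<Longrightarrow> i < N \<Longrightarrow> e i = 0"
    "\<And>k. k < N \<Longrightarrow> (\<Sum>i<N. kern (\<alpha> - real i - real k) (b - a) *\<^sub>R d i) + rr (\<alpha> - real k) g a = 0"
proof -
  have fi: "integrable lborel f" and fz: "\<And>s. s < a \<Longrightarrow> f s = 0"
    using l by (auto simp: left_repr_def)
  have ev: "eventually (\<lambda>t. t \<in> {a<..<b}) (at_right a)"
    by (rule eventually_at_right_real[OF ab])
  have rl0: "(rl (\<alpha> - real k) f \<longlongrightarrow> 0) (at_right a)" if "k < N" for k
    by (rule rl_tendsto_0[OF _ fi fz]) (use that N in auto)
  show e0: "e i = 0" if "1 \<le> i" "i < N" for i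
  proof (rule singular_coefficients_vanish[OF _ _ _ that])
    define m where "m = N - 1"
    have m: "m < N" "real m = real N - 1" using N by (auto simp: m_def of_nat_diff)
    let ?l = "(- 1) ^ m *\<^sub>R ((\<Sum>i<N. kern (\<alpha> - real i - real m) (b - a) *\<^sub>R d i) + rr (\<alpha> - real m) g a)"
    have "((\<lambda>t. (- 1) ^ m *\<^sub>R ((- 1) ^ m *\<^sub>R (vderiv ^^ m) p t)) \<longlongrightarrow> ?l) (at_right a)"
      by (intro tendsto_scaleR tendsto_const right_repr_limit[OF r _ m(1) ab]) (use N in simp)
    then have "((vderiv ^^ m) p \<longlongrightarrow> ?l) (at_right a)"
      by (simp flip: power_mult_distrib)
    then have "((\<lambda>t. (vderiv ^^ m) p t - rl (\<alpha> - real m) f t) \<longlongrightarrow> ?l - 0) (at_right a)"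
      by (intro tendsto_diff rl0 m)
    then show "((\<lambda>t. \<Sum>i<N. kern ((\<alpha> - real N) + 1 - real i) (t - a) *\<^sub>R e i) \<longlongrightarrow> ?l - 0) (at_right a)"
    proof (rule Lim_transform_eventually)
      show "\<forall>\<^sub>F t in at_right a. (vderiv ^^ m) p t - rl (\<alpha> - real m) f t
        = (\<Sum>i<N. kern ((\<alpha> - real N) + 1 - real i) (t - a) *\<^sub>R e i)"
        using ev
      proof eventually_elim
        case (elim t)
        have idx: "\<alpha> - real i - real m = (\<alpha> - real N) + 1 - real i" for i using m by simp
        have "(vderiv ^^ m) p t = (\<Sum>i<N. kern (\<alpha> - real i - real m) (t - a) *\<^sub>R e i) + rl (\<alpha> - real m) f t"
          by (rule left_repr_vderiv[OF l _ m(1) elim]) (use N in simp)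
        then show ?case by (simp only: idx add_diff_cancel_right')
      qed
    qed
  qed (use N in auto)
  show "(\<Sum>i<N. kern (\<alpha> - real i - real k) (b - a) *\<^sub>R d i) + rr (\<alpha> - real k) g a = 0" if k: "k < N" for k
  proof (rule tendsto_unique)
    show "((\<lambda>t. (- 1) ^ k *\<^sub>R (vderiv ^^ k) p t) \<longlongrightarrow>
      (\<Sum>i<N. kern (\<alpha> - real i - real k) (b - a) *\<^sub>R d i) + rr (\<alpha> - real k) g a) (at_right a)"
      by (rule right_repr_limit[OF r _ k ab]) (use N in simp)
    have k1: "((\<lambda>t. kern (\<alpha> - real k) (t - a)) \<longlongrightarrow> 0) (at_right a)"
      by (rule kern_tendsto_0) (use N k in linarith)
    have "((\<lambda>t. (- 1) ^ k *\<^sub>R (kern (\<alpha> - real k) (t - a) *\<^sub>R e 0 + rl (\<alpha> - real k) f t)) \<longlongrightarrow>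
        (- 1) ^ k *\<^sub>R (0 *\<^sub>R e 0 + 0)) (at_right a)"
      by (intro tendsto_intros k1 rl0 k)
    then have "((\<lambda>t. (- 1) ^ k *\<^sub>R (kern (\<alpha> - real k) (t - a) *\<^sub>R e 0 + rl (\<alpha> - real k) f t)) \<longlongrightarrow> 0) (at_right a)"
      by simp
    then show "((\<lambda>t. (- 1) ^ k *\<^sub>R (vderiv ^^ k) p t) \<longlongrightarrow> 0) (at_right a)"
    proof (rule Lim_transform_eventually)
      show "\<forall>\<^sub>F t in at_right a. (- 1) ^ k *\<^sub>R (kern (\<alpha> - real k) (t - a) *\<^sub>R e 0 + rl (\<alpha> - real k) f t)
        = (- 1) ^ k *\<^sub>R (vderiv ^^ k) p t"
        using ev
      proof eventually_elim
        case (elim t)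
        have "(\<Sum>i<N. kern (\<alpha> - real i - real k) (t - a) *\<^sub>R e i) = (\<Sum>i\<in>{0}. kern (\<alpha> - real i - real k) (t - a) *\<^sub>R e i)"
          using N(3) by (intro sum.mono_neutral_right) (auto simp: e0)
        then show ?case using left_repr_vderiv[OF l _ k elim] N by simp
      qed
    qed
  qed simp
qed

text \<open>At integer indices there are no blowing-up kernels: those of index \<open>z \<le> 0\<close> vanish identically.\<close>

lemma kern_integer_tendsto:
  "((\<lambda>t. kern (of_int z) (t - a)) \<longlongrightarrow> (if z = 1 then 1 else 0)) (at_right a)"
proof -
  consider "z \<le> 0" | "z = 1" | "1 < z" by linarith
  then show ?thesis
  proof cases
    case 1
    then have "kern (of_int z) u = 0" for u by (simp add: kern_def rGamma_of_int)
    then show ?thesis using 1 by simp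
  next
    case 2
    have "eventually (\<lambda>t. 1 = kern (of_int z) (t - a)) (at_right a)"
      using eventually_at_right_less[of a] by eventually_elim (simp add: 2 kern_1)
    then have "((\<lambda>t. kern (of_int z) (t - a)) \<longlongrightarrow> 1) (at_right a)"
      by (rule Lim_transform_eventually[OF tendsto_const])
    then show ?thesis using 2 by simp
  next
    case 3
    then show ?thesis using kern_tendsto_0[of "of_int z" a] by simp
  qed
qed

lemma left_repr_limit_integer:
  assumes ab: "a < b" and l: "left_repr (real N) a b N p e f" and k: "k < N"
  shows "((vderiv ^^ k) p \<longlongrightarrow> e (N - 1 - k)) (at_right a)"
proof -
  have ev: "eventually (\<lambda>t. t \<in> {a<..<b}) (at_right a)"
    by (rule eventually_at_right_real[OF ab])
  have fi: "integrable lborel f" and fz: "\<And>s. s < a \<Longrightarrow> f s = 0"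
    using l by (auto simp: left_repr_def)
  have "((\<lambda>t. kern (real N - real i - real k) (t - a) *\<^sub>R e i) \<longlongrightarrow> (if i = N - 1 - k then e i else 0)) (at_right a)" for i
  proof -
    have z: "real N - real i - real k = of_int (int N - int i - int k)" by simp
    have "((\<lambda>t. kern (real N - real i - real k) (t - a) *\<^sub>R e i) \<longlongrightarrow>
        (if int N - int i - int k = 1 then 1 else 0) *\<^sub>R e i) (at_right a)"
      unfolding z by (intro tendsto_scaleR tendsto_const kern_integer_tendsto)
    moreover have "int N - int i - int k = 1 \<longleftrightarrow> i = N - 1 - k" using k by auto
    ultimately show ?thesis by (cases "i = N - 1 - k") simp_all
  qed
  then have "((\<lambda>t. (\<Sum>i<N. kern (real N - real i - real k) (t - a) *\<^sub>R e i) + rl (real N - real k) f t) \<longlongrightarrow>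
      (\<Sum>i<N. if i = N - 1 - k then e i else 0) + 0) (at_right a)"
    by (intro tendsto_add tendsto_sum rl_tendsto_0[OF _ fi fz]) (use k in auto)
  moreover have "(\<Sum>i<N. if i = N - 1 - k then e i else 0) = e (N - 1 - k)"
    using k by (simp add: sum.delta)
  ultimately have "((\<lambda>t. (\<Sum>i<N. kern (real N - real i - real k) (t - a) *\<^sub>R e i) + rl (real N - real k) f t) \<longlongrightarrow>
      e (N - 1 - k)) (at_right a)" by simp
  then show ?thesis
    by (rule Lim_transform_eventually)
       (rule eventually_mono[OF ev], rule left_repr_vderiv[OF l _ k, symmetric], simp_all)
qed

lemma sum_only_first:
  fixes d :: "nat \<Rightarrow> complex"
  assumes "\<And>i. 1 \<le> i \<Longrightarrow> i < N \<Longrightarrow> d i = 0" "1 \<le> N"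
  shows "(\<Sum>i<N. w i *\<^sub>R d i) = w 0 *\<^sub>R d 0"
proof -
  have "(\<Sum>i<N. w i *\<^sub>R d i) = (\<Sum>i\<in>{0}. w i *\<^sub>R d i)"
    using assms by (intro sum.mono_neutral_right) auto
  then show ?thesis by simp
qed

text \<open>The hypotheses on \<open>p\<close> in \<open>integration_by_parts_high_order\<close> hold: for noninteger order by the two-sided
  regularity at both endpoints, for integer order \<open>N\<close> by the natural boundary condition, which fixes the
  derivatives of order at most \<open>N - 2\<close>. In the integer case the index \<open>k = N - 1\<close> remains, and is
  excluded here.\<close>

lemma boundary_coefficients:
  fixes p :: "real \<Rightarrow> complex"
  assumes ab: "a < b" and N: "1 \<le> N" "real N \<le> \<alpha>" "\<alpha> < real N + 1"
    and l: "left_repr \<alpha> a b N p e f" and r: "right_repr \<alpha> a b N p d g" and nb: "natural_boundary \<alpha> a b p"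
  shows "\<And>i. 1 \<le> i \<Longrightarrow> i < N \<Longrightarrow> d i = 0"
    "\<And>k. k < N \<Longrightarrow> \<alpha> \<noteq> real N \<or> k + 1 < N \<Longrightarrow> kern (\<alpha> - real k) (b - a) *\<^sub>R d 0 + rr (\<alpha> - real k) g a = 0"
proof -
  note rr' = right_repr_reflect[OF r] and ll' = left_repr_reflect[OF l]
  have ab': "- b < - a" using ab by simp
  show d0: "d i = 0" if i: "1 \<le> i" "i < N" for i
  proof (cases "\<alpha> = real N")
    case False
    then show ?thesis using two_sided_noninteger_order(1)[OF ab' _ _ _ rr' ll' i] N by simp
  next
    case True
    \<comment> \<open>the coefficient \<open>d i\<close> is, up to sign, the limit at \<open>b\<close> of the derivative of order \<open>N - 1 - i\<close>\<close>
    define k where "k = N - 1 - i"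
    have k: "k < N" "real k + 1 < \<alpha>" "N - 1 - k = i" using i True by (auto simp: k_def)
    have "(vderiv ^^ k) (\<lambda>s. p (- s)) t = (- 1) ^ k *\<^sub>R (vderiv ^^ k) p (- t)" if t: "t \<in> {- b<..<- a}" for t
    proof -
      have t': "- t \<in> {a<..<b}" using t by auto
      show ?thesis
        using left_repr_vderiv[OF rr' N(2) k(1) t] right_repr_vderiv[OF r N(2) k(1) t']
        by (simp add: rr_eq_rl_reflect add.commute flip: power_mult_distrib)
    qed
    note eq = this
    have "((vderiv ^^ k) p \<longlongrightarrow> 0) (at_left b)"
      using nb k True by (auto simp: natural_boundary_def)
    then have "((\<lambda>t. (vderiv ^^ k) p (- t)) \<longlongrightarrow> 0) (at_right (- b))"
      by (simp add: at_left_minus filterlim_filtermap)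
    then have "((\<lambda>t. (- 1) ^ k *\<^sub>R (vderiv ^^ k) p (- t)) \<longlongrightarrow> (- 1) ^ k *\<^sub>R 0) (at_right (- b))"
      by (intro tendsto_intros)
    then have 1: "((vderiv ^^ k) (\<lambda>s. p (- s)) \<longlongrightarrow> (- 1) ^ k *\<^sub>R 0) (at_right (- b))"
      by (rule Lim_transform_eventually)
         (rule eventually_mono[OF eventually_at_right_real[OF ab']], rule eq[symmetric])
    have "((vderiv ^^ k) (\<lambda>s. p (- s)) \<longlongrightarrow> d (N - 1 - k)) (at_right (- b))"
      by (rule left_repr_limit_integer[OF ab' _ k(1)]) (use rr' True in simp)
    from tendsto_unique[OF _ this 1] k(3) show ?thesis by simp
  qed
  show "kern (\<alpha> - real k) (b - a) *\<^sub>R d 0 + rr (\<alpha> - real k) g a = 0"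
    if k: "k < N" "\<alpha> \<noteq> real N \<or> k + 1 < N" for k
  proof -
    have "(\<Sum>i<N. kern (\<alpha> - real i - real k) (b - a) *\<^sub>R d i) + rr (\<alpha> - real k) g a = 0"
    proof (cases "\<alpha> = real N")
      case False
      then show ?thesis using two_sided_noninteger_order(2)[OF ab _ _ _ l r k(1)] N by simp
    next
      case True
      have "((vderiv ^^ k) p \<longlongrightarrow> 0) (at_right a)"
        using nb k True by (auto simp: natural_boundary_def)
      then have "((\<lambda>t. (- 1) ^ k *\<^sub>R (vderiv ^^ k) p t) \<longlongrightarrow> (- 1) ^ k *\<^sub>R 0) (at_right a)"
        by (intro tendsto_intros)
      from tendsto_unique[OF _ right_repr_limit[OF r N(2) k(1) ab] this] show ?thesis by simp
    qed
    then show ?thesis using sum_only_first[OF d0 N(1), where w = "\<lambda>i. kern (\<alpha> - real i - real k) (b - a)"] by simp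
  qed
qed

text \<open>The higher derivatives of \<open>h\<close> may be arbitrary at the endpoints, where only \<open>h\<close> itself vanishes; this is
  paid for by the two-sided regularity of \<open>p\<close> and, for integer orders, by its boundary behaviour.\<close>

theorem fractional_integration_by_parts:
  fixes h p :: "real \<Rightarrow> complex"
  assumes ab: "a < b" and \<alpha>: "0 < \<alpha>" and h: "left_reg \<alpha> a b h" "h a = 0" "h b = 0"
    and p: "left_reg \<alpha> a b p" "right_reg \<alpha> a b p" "natural_boundary \<alpha> a b p"
  shows "integral {a..b} (\<lambda>t. p t * left_RL \<alpha> a h t) = integral {a..b} (\<lambda>t. h t * right_RL \<alpha> b p t)"
proof -
  have hc: "continuous_on {a..b} h" and pc: "continuous_on {a..b} p"
    using h p by (simp_all add: left_reg_def)
  obtain f where f: "borel_rep a b (left_RL \<alpha> a h) f"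
    using borel_rep_exists h(1) unfolding left_reg_def by blast
  obtain g where g: "borel_rep a b (right_RL \<alpha> b p) g"
    using borel_rep_exists p(2) unfolding right_reg_def by blast
  obtain q where q: "borel_rep a b (left_RL \<alpha> a p) q"
    using borel_rep_exists p(1) unfolding left_reg_def by blast
  have main: "(LINT t|lborel. f t * zext a b p t) = (LINT t|lborel. g t * zext a b h t)"
  proof (cases "\<alpha> < 1")
    case True
    then show ?thesis by (rule integration_by_parts_low_order[OF ab \<alpha> _ h(1) f p(2) g])
  next
    case False
    then have \<alpha>1: "1 \<le> \<alpha>" by simp
    define N where "N = nat \<lfloor>\<alpha>\<rfloor>"
    have N: "1 \<le> N" "real N \<le> \<alpha>" "\<alpha> < real N + 1"
    proof -
      have "1 \<le> \<lfloor>\<alpha>\<rfloor>" using \<alpha>1 by simp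
      then have "real N = of_int \<lfloor>\<alpha>\<rfloor>" "1 \<le> N" unfolding N_def by linarith+
      then show "1 \<le> N" "real N \<le> \<alpha>" "\<alpha> < real N + 1" by linarith+
    qed
    obtain c where c: "\<And>t. t \<in> {a<..<b} \<Longrightarrow> h t = (\<Sum>j<N. kern (\<alpha> - real j) (t - a) *\<^sub>R c j) + rl \<alpha> f t"
      unfolding N_def using left_representation[OF ab \<alpha>1 h(1) f] by blast
    obtain e where e: "\<And>t. t \<in> {a<..<b} \<Longrightarrow> p t = (\<Sum>j<N. kern (\<alpha> - real j) (t - a) *\<^sub>R e j) + rl \<alpha> q t"
      unfolding N_def using left_representation[OF ab \<alpha>1 p(1) q] by blast
    obtain d where d: "\<And>t. t \<in> {a<..<b} \<Longrightarrow> p t = (\<Sum>j<N. kern (\<alpha> - real j) (b - t) *\<^sub>R d j) + rr \<alpha> g t"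
      unfolding N_def using right_representation[OF ab \<alpha>1 p(2) g] by blast
    have l: "left_repr \<alpha> a b N p e q"
      unfolding left_repr_def using e q by (auto simp: borel_rep_def)
    have r: "right_repr \<alpha> a b N p d g"
      unfolding right_repr_def using d g by (auto simp: borel_rep_def)
    have hl: "left_repr \<alpha> a b N h c f"
      unfolding left_repr_def using c f by (auto simp: borel_rep_def)
    note bc = boundary_coefficients[OF ab N l r p(3)]
    show ?thesis
    proof (rule integration_by_parts_high_order[OF ab \<alpha>1 N(1,2) f g hc pc h(3) c])
      show "p t = kern \<alpha> (b - t) *\<^sub>R d 0 + rr \<alpha> g t" if "t \<in> {a<..<b}" for t
        using d[OF that] sum_only_first[OF bc(1) N(1), where w = "\<lambda>i. kern (\<alpha> - real i) (b - t)"] by simp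
      show "c j = 0 \<or> kern (\<alpha> - real j) (b - a) *\<^sub>R d 0 + rr (\<alpha> - real j) g a = 0" if j: "j < N" for j
      proof (cases "\<alpha> = real N \<and> j = N - 1")
        case False
        have "j + 1 < N" if "j \<noteq> N - 1" using that j by linarith
        then have "\<alpha> \<noteq> real N \<or> j + 1 < N" using False by blast
        then show ?thesis using bc(2)[of j] j by blast
      next
        case True
        \<comment> \<open>at integer order the remaining coefficient is the value of \<open>h\<close> at \<open>a\<close>\<close>
        have "((vderiv ^^ 0) h \<longlongrightarrow> c (N - 1 - 0)) (at_right a)"
          by (rule left_repr_limit_integer[OF ab]) (use hl N(1) True in auto)
        then have 1: "(h \<longlongrightarrow> c j) (at_right a)" using True by simp
        have "(h \<longlongrightarrow> h a) (at a within {a..b})"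
          using hc ab by (simp add: continuous_on_def)
        then have "(h \<longlongrightarrow> 0) (at_right a)"
          by (simp only: at_within_Icc_at_right[OF ab] h(2))
        from tendsto_unique[OF _ 1 this] show ?thesis by simp
      qed
    qed
  qed
  obtain M where M: "\<And>s. norm (zext a b h s) \<le> M" using zext_bounded[OF hc] by blast
  obtain K where K: "\<And>s. norm (zext a b p s) \<le> K" using zext_bounded[OF pc] by blast
  have "integral {a..b} (\<lambda>t. p t * left_RL \<alpha> a h t) = integral {a..b} (\<lambda>t. zext a b p t * left_RL \<alpha> a h t)"
    by (rule Henstock_Kurzweil_Integration.integral_cong) (simp add: zext_def)
  also have "\<dots> = (LINT t|lborel. zext a b p t * f t)"
    by (rule borel_rep_integral(1)[OF f]) (rule bounded_times_integrable(1)[OF _ zext_measurable[OF pc] K], use f in \<open>simp add: borel_rep_def\<close>)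
  also have "\<dots> = (LINT t|lborel. zext a b h t * g t)"
    using main by (simp add: mult.commute)
  also have "\<dots> = integral {a..b} (\<lambda>t. zext a b h t * right_RL \<alpha> b p t)"
    by (rule borel_rep_integral(1)[OF g, symmetric]) (rule bounded_times_integrable(1)[OF _ zext_measurable[OF hc] M], use g in \<open>simp add: borel_rep_def\<close>)
  also have "\<dots> = integral {a..b} (\<lambda>t. h t * right_RL \<alpha> b p t)"
    by (rule Henstock_Kurzweil_Integration.integral_cong) (simp add: zext_def)
  finally show ?thesis .
qed

section \<open>Test functions and the fundamental lemma\<close>

text \<open>A real function vanishing outside \<open>(c, d)\<close>, with its derivatives up to order \<open>m\<close>. Finite smoothness is
  enough for a fixed pair of orders.\<close>

definition test_tower :: "nat \<Rightarrow> (nat \<Rightarrow> real \<Rightarrow> real) \<Rightarrow> real \<Rightarrow> real \<Rightarrow> bool" where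
  "test_tower m D c d \<longleftrightarrow> (\<forall>k<m. \<forall>t. (D k has_real_derivative D (Suc k) t) (at t))
     \<and> continuous_on UNIV (D m) \<and> (\<forall>k\<le>m. \<forall>t. t \<le> c \<or> d \<le> t \<longrightarrow> D k t = 0)"

text \<open>Smoothing by averaging over a short interval gains one derivative, which is the difference quotient
  below. Iterated averages are splines.\<close>

definition avg :: "real \<Rightarrow> (real \<Rightarrow> real) \<Rightarrow> real \<Rightarrow> real" where
  "avg \<delta> f t = integral {t..t + \<delta>} f / \<delta>"

definition diffq :: "real \<Rightarrow> (real \<Rightarrow> real) \<Rightarrow> real \<Rightarrow> real" where
  "diffq \<delta> f t = (f (t + \<delta>) - f t) / \<delta>"

lemma avg_has_derivative:
  assumes "0 < \<delta>" "continuous_on UNIV f"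
  shows "(avg \<delta> f has_real_derivative diffq \<delta> f t) (at t)"
proof -
  define T where "T = t - 1"
  define F where "F = (\<lambda>u. integral {T..u} f)"
  have i: "f integrable_on {u..v}" for u v
    by (rule integrable_continuous_real[OF continuous_on_subset[OF assms(2)]]) simp
  have F: "(F has_real_derivative f u) (at u)" if "T < u" for u
  proof -
    have "(F has_real_derivative f u) (at u within {T..u + 1})"
      unfolding F_def
      by (rule integral_has_real_derivative[OF continuous_on_subset[OF assms(2)]]) (use that in auto)
    then show ?thesis using that by (simp add: at_within_Icc_at)
  qed
  have "((\<lambda>u. F (u + \<delta>)) has_real_derivative f (t + \<delta>)) (at t)"
    using F[of "t + \<delta>"] assms(1) by (simp add: DERIV_shift T_def)
  then have "((\<lambda>u. (F (u + \<delta>) - F u) / \<delta>) has_real_derivative (f (t + \<delta>) - f t) / \<delta>) (at t)"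
    by (intro DERIV_cdivide DERIV_diff F) (simp_all add: T_def)
  then show ?thesis
    unfolding diffq_def
  proof (rule has_field_derivative_transform_within_open)
    show "open {T<..}" "t \<in> {T<..}" by (simp_all add: T_def)
    fix u assume "u \<in> {T<..}"
    then have "integral {T..u} f + integral {u..u + \<delta>} f = integral {T..u + \<delta>} f"
      using assms(1) i by (intro Henstock_Kurzweil_Integration.integral_combine) auto
    then show "(F (u + \<delta>) - F u) / \<delta> = avg \<delta> f u"
      by (simp add: F_def avg_def field_simps)
  qed
qed

lemma diffq_has_derivative:
  assumes "\<And>t. (f has_real_derivative f' t) (at t)"
  shows "(diffq \<delta> f has_real_derivative diffq \<delta> f' t) (at t)"
proof -
  have "((\<lambda>t. f (t + \<delta>)) has_real_derivative f' (t + \<delta>)) (at t)"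
    using assms[of "t + \<delta>"] by (simp add: DERIV_shift)
  then show ?thesis
    unfolding diffq_def[abs_def] by (intro DERIV_cdivide DERIV_diff assms)
qed

lemma avg_continuous: "0 < \<delta> \<Longrightarrow> continuous_on UNIV f \<Longrightarrow> continuous_on UNIV (avg \<delta> f)"
  by (rule continuous_at_imp_continuous_on) (simp add: DERIV_isCont[OF avg_has_derivative])

lemma diffq_continuous: "continuous_on UNIV f \<Longrightarrow> continuous_on UNIV (diffq \<delta> f)"
proof -
  assume f: "continuous_on UNIV f"
  have "continuous_on UNIV (\<lambda>t. f (t + \<delta>))"
    by (rule continuous_on_compose2[OF f]) (auto intro!: continuous_intros)
  then show ?thesis
    unfolding diffq_def[abs_def] divide_inverse
    by (rule continuous_on_mult_right[OF continuous_on_diff[OF _ f]])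
qed

lemma avg_pow_continuous: "0 < \<delta> \<Longrightarrow> continuous_on UNIV f \<Longrightarrow> continuous_on UNIV ((avg \<delta> ^^ m) f)"
  by (induction m) (auto intro: avg_continuous)

lemma diffq_pow_continuous: "continuous_on UNIV f \<Longrightarrow> continuous_on UNIV ((diffq \<delta> ^^ m) f)"
  by (induction m) (auto intro: diffq_continuous)

lemma diffq_pow_avg_has_derivative:
  assumes "0 < \<delta>" "continuous_on UNIV f"
  shows "((diffq \<delta> ^^ k) (avg \<delta> f) has_real_derivative (diffq \<delta> ^^ Suc k) f t) (at t)"
proof (induction k arbitrary: t)
  case 0
  then show ?case using avg_has_derivative[OF assms] by simp
next
  case (Suc k)
  show ?case using diffq_has_derivative[OF Suc.IH, of \<delta> t] by simp
qed

lemma avg_pow_const: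
  assumes "0 < \<delta>" "\<And>s. s \<in> {t..t + real m * \<delta>} \<Longrightarrow> f s = v"
  shows "(avg \<delta> ^^ m) f t = v"
  using assms(2)
proof (induction m arbitrary: t)
  case (Suc m)
  have "(avg \<delta> ^^ m) f s = v" if "s \<in> {t..t + \<delta>}" for s
    by (rule Suc.IH) (use Suc.prems that assms(1) in \<open>auto simp: algebra_simps\<close>)
  then have "integral {t..t + \<delta>} ((avg \<delta> ^^ m) f) = integral {t..t + \<delta>} (\<lambda>_. v)"
    by (rule Henstock_Kurzweil_Integration.integral_cong)
  then show ?case using assms(1) by (simp add: avg_def[of \<delta> "(avg \<delta> ^^ m) f"])
qed simp

lemma diffq_pow_zero:
  assumes "0 < \<delta>" "\<And>s. s \<in> {t..t + real m * \<delta>} \<Longrightarrow> f s = 0"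
  shows "(diffq \<delta> ^^ m) f t = 0"
  using assms(2)
proof (induction m arbitrary: t)
  case (Suc m)
  have "(diffq \<delta> ^^ m) f s = 0" if "s \<in> {t, t + \<delta>}" for s
    by (rule Suc.IH) (use Suc.prems that assms(1) in \<open>auto simp: algebra_simps\<close>)
  then show ?case by (simp add: diffq_def[of \<delta> "(diffq \<delta> ^^ m) f"])
qed simp

lemma avg_pow_bounds:
  assumes "0 < \<delta>" "continuous_on UNIV f" "\<And>t. 0 \<le> f t \<and> f t \<le> 1"
  shows "0 \<le> (avg \<delta> ^^ m) f t \<and> (avg \<delta> ^^ m) f t \<le> 1"
proof (induction m arbitrary: t)
  case (Suc m)
  have i: "(avg \<delta> ^^ m) f integrable_on {t..t + \<delta>}"
    by (rule integrable_continuous_real[OF continuous_on_subset[OF avg_pow_continuous[OF assms(1,2)]]]) simp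
  have "0 \<le> integral {t..t + \<delta>} ((avg \<delta> ^^ m) f)"
    using Suc by (intro Henstock_Kurzweil_Integration.integral_nonneg i) auto
  moreover have "integral {t..t + \<delta>} ((avg \<delta> ^^ m) f) \<le> integral {t..t + \<delta>} (\<lambda>_. 1)"
    using Suc by (intro integral_le i) auto
  ultimately show ?case using assms(1) by (simp add: avg_def[of \<delta> "(avg \<delta> ^^ m) f"])
qed (use assms(3) in simp)

text \<open>An \<open>m\<close>-fold average of a trapezoid. Averaging looks to the right, so the trapezoid starts at
  \<open>c + m \<delta>\<close> to keep the support inside \<open>(c, d)\<close>.\<close>

lemma plateau_exists:
  assumes "0 < \<delta>" "c < d"
  obtains D where "test_tower m D c d" "\<And>t. 0 \<le> D 0 t \<and> D 0 t \<le> 1"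
    "\<And>t. c + real (Suc m) * \<delta> \<le> t \<Longrightarrow> t + real (Suc m) * \<delta> \<le> d \<Longrightarrow> D 0 t = 1"
proof -
  define g where "g = (\<lambda>t. max 0 (min 1 (min ((t - (c + real m * \<delta>)) / \<delta>) ((d - t) / \<delta>))))"
  have g: "continuous_on UNIV g"
    unfolding g_def using assms(1) by (intro continuous_intros) auto
  have g0: "g t = 0" if "t \<le> c + real m * \<delta> \<or> d \<le> t" for t
  proof -
    have "(t - (c + real m * \<delta>)) / \<delta> \<le> 0 \<or> (d - t) / \<delta> \<le> 0"
      using that assms(1) by (auto simp: divide_le_0_iff)
    then show ?thesis by (simp add: g_def min_le_iff_disj max_absorb1)
  qed
  define D where "D = (\<lambda>k. (diffq \<delta> ^^ k) ((avg \<delta> ^^ (m - k)) g))"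
  show ?thesis
  proof (rule that[of D])
    show "test_tower m D c d"
      unfolding test_tower_def
    proof (intro conjI allI impI)
      fix k t assume "k < m"
      then have "m - k = Suc (m - Suc k)" by simp
      then show "(D k has_real_derivative D (Suc k) t) (at t)"
        unfolding D_def
        using diffq_pow_avg_has_derivative[OF assms(1) avg_pow_continuous[OF assms(1) g, of "m - Suc k"], of k t]
        by simp
    next
      show "continuous_on UNIV (D m)"
        unfolding D_def by (intro diffq_pow_continuous avg_pow_continuous assms(1) g)
    next
      fix k t assume k: "k \<le> m" and t: "t \<le> c \<or> d \<le> t"
      show "D k t = 0"
        unfolding D_def
      proof (rule diffq_pow_zero[OF assms(1)], rule avg_pow_const[OF assms(1)])
        fix s r assume s: "s \<in> {t..t + real k * \<delta>}" and r: "r \<in> {s..s + real (m - k) * \<delta>}"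
        have "real (m - k) * \<delta> = real m * \<delta> - real k * \<delta>"
          using k by (simp add: of_nat_diff algebra_simps)
        then have "t \<le> r" "r \<le> t + real m * \<delta>" using s r by auto
        then show "g r = 0" using t by (intro g0) auto
      qed
    qed
    have "0 \<le> g t \<and> g t \<le> 1" for t by (auto simp: g_def)
    from avg_pow_bounds[OF assms(1) g this]
    show "0 \<le> D 0 t \<and> D 0 t \<le> 1" for t by (simp add: D_def)
    fix t assume t: "c + real (Suc m) * \<delta> \<le> t" "t + real (Suc m) * \<delta> \<le> d"
    have "(avg \<delta> ^^ m) g t = 1"
    proof (rule avg_pow_const[OF assms(1)])
      fix s assume "s \<in> {t..t + real m * \<delta>}"
      then have "\<delta> \<le> s - (c + real m * \<delta>)" "\<delta> \<le> d - s"
        using t by (auto simp: algebra_simps)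
      then show "g s = 1" using assms(1) by (simp add: g_def)
    qed
    then show "D 0 t = 1" by (simp add: D_def)
  qed
qed

text \<open>Plateau functions approximate the indicator of \<open>(c, d)\<close>; by dominated convergence the integral of \<open>u\<close> over
  every \<open>[c, d]\<close> vanishes, so the primitive \<open>U\<close> is constant. Because \<open>u\<close> is a derivative at every point, it
  vanishes at every point and not just almost everywhere.\<close>

lemma fundamental_lemma:
  fixes u U :: "real \<Rightarrow> complex"
  assumes u: "u absolutely_integrable_on {a..b}"
    and U: "\<And>t. t \<in> {a<..<b} \<Longrightarrow> (U has_vector_derivative u t) (at t)"
    and test: "\<And>D c d. a < c \<Longrightarrow> c < d \<Longrightarrow> d < b \<Longrightarrow> test_tower m D c d \<Longrightarrow>
       integral {a..b} (\<lambda>t. of_real (D 0 t) * u t) = 0"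
    and t: "t \<in> {a<..<b}"
  shows "u t = 0"
proof -
  have inc: "U d = U c" if cd: "a < c" "c < d" "d < b" for c d
  proof -
    have "\<exists>D. test_tower m D c d \<and> (\<forall>t. 0 \<le> D 0 t \<and> D 0 t \<le> 1) \<and>
      (\<forall>t. c + real (Suc m) * (1 / real (Suc n)) \<le> t \<longrightarrow> t + real (Suc m) * (1 / real (Suc n)) \<le> d \<longrightarrow> D 0 t = 1)" for n
    proof (rule plateau_exists[OF _ cd(2)])
      show "0 < 1 / real (Suc n)" by simp
      fix D
      assume D: "test_tower m D c d" "\<And>t. 0 \<le> D 0 t \<and> D 0 t \<le> 1"
        "\<And>t. c + real (Suc m) * (1 / real (Suc n)) \<le> t \<Longrightarrow> t + real (Suc m) * (1 / real (Suc n)) \<le> d \<Longrightarrow> D 0 t = 1"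
      show ?thesis
        by (rule exI[of _ D], intro conjI allI impI) (rule D D(2)[THEN conjunct1] D(2)[THEN conjunct2]; assumption)+
    qed
    then have "\<forall>n. \<exists>D. test_tower m D c d \<and> (\<forall>t. 0 \<le> D 0 t \<and> D 0 t \<le> 1) \<and>
      (\<forall>t. c + real (Suc m) * (1 / real (Suc n)) \<le> t \<longrightarrow> t + real (Suc m) * (1 / real (Suc n)) \<le> d \<longrightarrow> D 0 t = 1)"
      by (rule allI)
    from choice[OF this] obtain D where DD: "\<forall>n. test_tower m (D n) c d \<and> (\<forall>t. 0 \<le> D n 0 t \<and> D n 0 t \<le> 1) \<and>
      (\<forall>t. c + real (Suc m) * (1 / real (Suc n)) \<le> t \<longrightarrow> t + real (Suc m) * (1 / real (Suc n)) \<le> d \<longrightarrow> D n 0 t = 1)" ..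
    note DDn = spec[OF DD]
    have D1: "test_tower m (D n) c d" for n
      by (rule conjunct1[OF DDn])
    have D2: "0 \<le> D n 0 t \<and> D n 0 t \<le> 1" for n t
      by (rule spec[OF conjunct1[OF conjunct2[OF DDn]]])
    have D3: "D n 0 t = 1" if "c + real (Suc m) * (1 / real (Suc n)) \<le> t" "t + real (Suc m) * (1 / real (Suc n)) \<le> d" for n t
      by (rule mp[OF mp[OF spec[OF conjunct2[OF conjunct2[OF DDn]]] that(1)] that(2)])
    have D0: "continuous_on UNIV (D n 0)" for n
    proof (cases "m = 0")
      case True then show ?thesis using D1[of n] by (simp add: test_tower_def)
    next
      case False
      then have "(D n 0 has_real_derivative D n (Suc 0) t) (at t)" for t
        using D1[of n] by (simp add: test_tower_def)
      then show ?thesis by (intro continuous_at_imp_continuous_on ballI DERIV_isCont)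
    qed
    define w where "w = (\<lambda>t. if t \<in> {c<..<d} then u t else 0)"
    have lim: "(\<lambda>n. integral {a..b} (\<lambda>t. of_real (D n 0 t) * u t)) \<longlonglongrightarrow> integral {a..b} w"
    proof (rule dominated_convergence(2))
      show "(\<lambda>t. of_real (D n 0 t) * u t) integrable_on {a..b}" for n
      proof -
        have "continuous_on {a..b} (\<lambda>t. complex_of_real (D n 0 t))"
          by (intro continuous_intros continuous_on_subset[OF D0]) simp
        note c = this
        have "(\<lambda>t. complex_of_real (D n 0 t)) \<in> borel_measurable (lebesgue_on {a..b})"
          by (rule continuous_imp_measurable_on_sets_lebesgue[OF c]) simp
        moreover have "bounded ((\<lambda>t. complex_of_real (D n 0 t)) ` {a..b})"
          by (rule compact_imp_bounded[OF compact_continuous_image[OF c]]) simp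
        ultimately have "(\<lambda>t. of_real (D n 0 t) * u t) absolutely_integrable_on {a..b}"
          by (intro absolutely_integrable_bounded_measurable_product[OF bilinear_times _ _ _ u]) simp_all
        then show ?thesis by (rule set_lebesgue_integral_eq_integral(1))
      qed
      show "(\<lambda>t. norm (u t)) integrable_on {a..b}"
        using u by (simp add: absolutely_integrable_on_def)
      show "norm (of_real (D n 0 t) * u t) \<le> norm (u t)" for n t
        using D2[of n t] by (simp add: norm_mult mult_left_le_one_le)
      show "(\<lambda>n. of_real (D n 0 t) * u t) \<longlonglongrightarrow> w t" for t
      proof (cases "t \<in> {c<..<d}")
        case True
        have "(\<lambda>n. real (Suc m) * (1 / real (Suc n))) \<longlonglongrightarrow> real (Suc m) * 0"
          using LIMSEQ_inverse_real_of_nat by (intro tendsto_mult tendsto_const) (simp add: inverse_eq_divide)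
        moreover have "0 < min (t - c) (d - t)" using True by auto
        ultimately have "eventually (\<lambda>n. real (Suc m) * (1 / real (Suc n)) < min (t - c) (d - t)) sequentially"
          by (intro order_tendstoD(2)) auto
        then have "eventually (\<lambda>n. u t = of_real (D n 0 t) * u t) sequentially"
        proof eventually_elim
          case (elim n)
          have "D n 0 t = 1" by (rule D3) (use elim in linarith)+
          then show ?case by simp
        qed
        then have "(\<lambda>n. of_real (D n 0 t) * u t) \<longlonglongrightarrow> u t"
          by (rule Lim_transform_eventually[OF tendsto_const])
        then show ?thesis using True by (simp add: w_def)
      next
        case False
        then have "D n 0 t = 0" for n using D1[of n] by (auto simp: test_tower_def)
        then show ?thesis using False by (simp add: w_def del: greaterThanLessThan_iff)
      qed
    qed
    have "integral {a..b} (\<lambda>t. of_real (D n 0 t) * u t) = 0" for n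
      using test[OF cd D1] .
    with lim have "(\<lambda>n::nat. 0) \<longlonglongrightarrow> integral {a..b} w" by simp
    from LIMSEQ_unique[OF this tendsto_const] have "integral {a..b} w = 0" .
    moreover have "(w has_integral U d - U c) {a..b}"
    proof (rule has_integral_on_superset)
      have ftc: "(u has_integral U d - U c) {c..d}"
      proof (rule fundamental_theorem_of_calculus)
        fix s assume "s \<in> {c..d}"
        then have "(U has_vector_derivative u s) (at s)" by (intro U) (use cd in auto)
        then show "(U has_vector_derivative u s) (at s within {c..d})" by (rule has_vector_derivative_at_within)
      qed (use cd in simp)
      show "(w has_integral U d - U c) {c..d}"
        by (rule has_integral_spike[OF _ _ ftc, of "{c, d}"]) (auto simp: w_def)
      show "w s = 0" if "s \<notin> {c..d}" for s using that by (auto simp: w_def)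
      show "{c..d} \<subseteq> {a..b}" using cd by simp
    qed
    ultimately have "U d - U c = 0" by (simp add: has_integral_iff)
    then show ?thesis by simp
  qed
  have eqU: "U s = U t" if "s \<in> {a<..<b}" for s
    using inc[of s t] inc[of t s] that t by (cases s t rule: linorder_cases) simp_all
  have "(U has_vector_derivative u t) (at t) \<longleftrightarrow> ((\<lambda>_. U t) has_vector_derivative u t) (at t)"
    by (rule has_vector_derivative_cong_open[OF open_greaterThanLessThan t]) (rule eqU)
  with U[OF t] have "((\<lambda>_. U t) has_vector_derivative u t) (at t)" by simp
  from vector_derivative_unique_at[OF this has_vector_derivative_const] show ?thesis .
qed

lemma test_tower_continuous:
  assumes "test_tower m D c d" "k \<le> m" shows "continuous_on UNIV (D k)"
proof (cases "k = m")
  case True then show ?thesis using assms by (simp add: test_tower_def)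
next
  case False
  then have "(D k has_real_derivative D (Suc k) t) (at t)" for t
    using assms by (simp add: test_tower_def)
  then have "isCont (D k) t" for t by (rule DERIV_isCont)
  then show ?thesis by (simp add: continuous_at_imp_continuous_on)
qed

lemma test_tower_complex_continuous:
  "test_tower m D c d \<Longrightarrow> k \<le> m \<Longrightarrow> continuous_on S (\<lambda>t. complex_of_real (D k t))"
  by (rule continuous_on_of_real, rule continuous_on_subset[OF test_tower_continuous]) simp_all

lemma test_tower_zero: "test_tower m D c d \<Longrightarrow> k \<le> m \<Longrightarrow> t \<le> c \<or> d \<le> t \<Longrightarrow> D k t = 0"
  by (auto simp: test_tower_def)

lemma test_tower_integrable:
  assumes "test_tower m D c d" "k \<le> m"
  shows "integrable lborel (\<lambda>t. complex_of_real (D k t))"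
proof -
  have "zext c d (\<lambda>t. complex_of_real (D k t)) = (\<lambda>t. complex_of_real (D k t))"
    using test_tower_zero[OF assms] by (auto simp: zext_def indicator_def fun_eq_iff)
  with zext_integrable[OF test_tower_complex_continuous[OF assms], of c d] show ?thesis by (simp only:)
qed

lemma test_tower_rl_1:
  assumes T: "test_tower m D c d" and k: "k < m"
  shows "rl 1 (\<lambda>t. complex_of_real (D (Suc k) t)) t = complex_of_real (D k t)"
proof -
  define e where "e = min c t"
  have e: "e \<le> c" "e \<le> t" by (auto simp: e_def)
  have c: "continuous_on S (\<lambda>t. complex_of_real (D (Suc k) t))" for S
    by (rule test_tower_complex_continuous[OF T]) (use k in simp)
  have "rl 1 (\<lambda>t. complex_of_real (D (Suc k) t)) t = integral {e..t} (\<lambda>t. complex_of_real (D (Suc k) t))"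
    by (rule rl_1_eq_integral[OF absolutely_integrable_continuous_real[OF c] borel_measurable_continuous_onI[OF c]])
       (use test_tower_zero[OF T, of "Suc k"] k e in simp)
  also have "((\<lambda>t. complex_of_real (D (Suc k) t)) has_integral complex_of_real (D k t) - complex_of_real (D k e)) {e..t}"
  proof (rule fundamental_theorem_of_calculus[OF e(2)])
    fix s
    have "(D k has_real_derivative D (Suc k) s) (at s)" using T k by (simp add: test_tower_def)
    then show "((\<lambda>t. complex_of_real (D k t)) has_vector_derivative complex_of_real (D (Suc k) s)) (at s within {e..t})"
      by (intro has_vector_derivative_of_real)
         (simp add: has_real_derivative_iff_has_vector_derivative has_vector_derivative_at_within)
  qed
  then have "integral {e..t} (\<lambda>t. complex_of_real (D (Suc k) t)) = complex_of_real (D k t)"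
    using test_tower_zero[OF T, of k e] k e by (simp add: has_integral_iff)
  finally show ?thesis .
qed

text \<open>A fractional integral of a test function can be differentiated under the integral sign: writing
  the test function as a double primitive raises the order of the integral to \<open>\<gamma> + 2\<close>, where
  \<open>rl_has_derivative\<close> applies.\<close>

lemma test_tower_rl_has_derivative:
  assumes T: "test_tower m D c d" and k: "Suc k < m" and \<gamma>: "0 < \<gamma>"
  shows "(rl \<gamma> (\<lambda>t. complex_of_real (D k t)) has_vector_derivative rl \<gamma> (\<lambda>t. complex_of_real (D (Suc k) t)) t) (at t)"
    "isCont (rl \<gamma> (\<lambda>t. complex_of_real (D (Suc k) t))) t"
proof -
  let ?\<phi> = "\<lambda>k t. complex_of_real (D k t)"
  have i: "integrable lborel (?\<phi> (Suc (Suc k)))" by (rule test_tower_integrable[OF T]) (use k in simp)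
  have z: "?\<phi> (Suc (Suc k)) s = 0" if "s < c" for s using test_tower_zero[OF T, of "Suc (Suc k)" s] k that by simp
  have m [measurable]: "?\<phi> j \<in> borel_measurable borel" if "j \<le> m" for j
    by (rule borel_measurable_continuous_onI[OF test_tower_complex_continuous[OF T that]])
  have m2: "?\<phi> (Suc (Suc k)) \<in> borel_measurable borel" by (rule m) (use k in simp)
  have r1: "?\<phi> (Suc k) = rl 1 (?\<phi> (Suc (Suc k)))" using test_tower_rl_1[OF T, of "Suc k"] k by (simp add: fun_eq_iff)
  have "?\<phi> k = rl 1 (?\<phi> (Suc k))" using test_tower_rl_1[OF T, of k] k by (simp add: fun_eq_iff)
  also have "\<dots> = rl 1 (rl 1 (?\<phi> (Suc (Suc k))))" by (simp only: r1)
  also have "\<dots> = rl (1 + 1) (?\<phi> (Suc (Suc k)))"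
    by (rule ext, rule rl_semigroup[OF _ _ m2 kern_times_integrable[OF _ i z]]) auto
  finally have r2: "?\<phi> k = rl (1 + 1) (?\<phi> (Suc (Suc k)))" .
  have 1: "rl \<gamma> (?\<phi> (Suc k)) = rl (\<gamma> + 1) (?\<phi> (Suc (Suc k)))"
    unfolding r1
    by (rule ext, rule rl_semigroup[OF \<gamma> _ m2 kern_times_integrable[OF _ i z]]) (use \<gamma> in auto)
  have 2: "rl \<gamma> (?\<phi> k) = rl (\<gamma> + (1 + 1)) (?\<phi> (Suc (Suc k)))"
    unfolding r2
    by (rule ext, rule rl_semigroup[OF \<gamma> _ m2 kern_times_integrable[OF _ i z]]) (use \<gamma> in auto)
  have "(rl (\<gamma> + (1 + 1)) (?\<phi> (Suc (Suc k))) has_vector_derivative rl (\<gamma> + (1 + 1) - 1) (?\<phi> (Suc (Suc k))) t) (at t)"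
    by (rule rl_has_derivative[OF _ i z]) (use \<gamma> in auto)
  moreover have "\<gamma> + (1 + 1) - 1 = \<gamma> + 1" by simp
  ultimately show "(rl \<gamma> (?\<phi> k) has_vector_derivative rl \<gamma> (?\<phi> (Suc k)) t) (at t)"
    unfolding 1 2 by (simp only:)
  show "isCont (rl \<gamma> (?\<phi> (Suc k))) t"
    unfolding 1 by (rule rl_isCont[OF _ i z]) (use \<gamma> in auto)
qed

lemma test_function_left_reg:
  assumes \<alpha>: "0 < \<alpha>" and T: "test_tower m D c d" and m: "frac_n \<alpha> < m" and ab: "a < c" "d < b"
  shows "left_reg \<alpha> a b (\<lambda>t. complex_of_real (D 0 t))"
    "t \<in> {a<..<b} \<Longrightarrow> left_RL \<alpha> a (\<lambda>t. complex_of_real (D 0 t)) t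
       = rl (real (frac_n \<alpha>) - \<alpha>) (\<lambda>t. complex_of_real (D (frac_n \<alpha>) t)) t"
proof -
  let ?\<phi> = "\<lambda>k t. complex_of_real (D k t)" and ?\<gamma> = "real (frac_n \<alpha>) - \<alpha>" and ?n = "frac_n \<alpha>"
  have \<gamma>: "0 < ?\<gamma>" by (rule frac_n_bounds[OF \<alpha>])
  then have G: "Gamma ?\<gamma> \<noteq> 0" by (simp add: Gamma_real_pos less_imp_neq[symmetric])
  have n: "0 < ?n" by (simp add: frac_n_def)
  define F where "F = (\<lambda>k t. Gamma ?\<gamma> *\<^sub>R rl ?\<gamma> (?\<phi> k) t)"
  have cont: "continuous_on {a..b} (?\<phi> 0)" by (rule test_tower_complex_continuous[OF T]) simp
  have ze: "zext a b (?\<phi> 0) = ?\<phi> 0"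
    using test_tower_zero[OF T, of 0] ab by (auto simp: zext_def indicator_def fun_eq_iff)
  have tower: "deriv_tower ?n F {a<..<b}"
    unfolding deriv_tower_def F_def using m
    by (auto intro!: bounded_linear.has_vector_derivative[OF bounded_linear_scaleR_right]
         test_tower_rl_has_derivative(1)[OF T _ \<gamma>])
  have K: "left_kernel_int \<alpha> a (?\<phi> 0) t = F 0 t" if "t \<in> {a<..<b}" for t
    using left_kernel_int_eq_rl[OF \<alpha> cont, of t] that G
    by (simp add: ze F_def rGamma_inverse_Gamma)
  have int: "F ?n absolutely_integrable_on {a..b}"
  proof (rule absolutely_integrable_continuous_real, rule continuous_at_imp_continuous_on, rule ballI)
    fix t
    have "Suc (?n - 1) = ?n" using n by simp
    then have "isCont (rl ?\<gamma> (?\<phi> ?n)) t"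
      using test_tower_rl_has_derivative(2)[OF T _ \<gamma>, of "?n - 1" t] m by simp
    then show "isCont (F ?n) t" unfolding F_def by (intro continuous_intros)
  qed
  note * = left_reg_of_tower[OF cont tower K int]
  show "left_reg \<alpha> a b (?\<phi> 0)" by (rule *(1))
  show "left_RL \<alpha> a (?\<phi> 0) t = rl ?\<gamma> (?\<phi> ?n) t" if "t \<in> {a<..<b}"
    using *(2)[OF _ that] G by (simp add: F_def)
qed

lemma test_tower_reflect:
  assumes "test_tower m D c d"
  shows "test_tower m (\<lambda>k t. (- 1) ^ k * D k (- t)) (- d) (- c)"
  unfolding test_tower_def
proof (intro conjI allI impI)
  fix k t assume "k < m"
  then have "(D k has_real_derivative D (Suc k) (- t)) (at (- t))" using assms by (simp add: test_tower_def)
  then have "((\<lambda>t. D k (- t)) has_real_derivative - D (Suc k) (- t)) (at t)"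
    by (simp add: DERIV_mirror)
  then show "((\<lambda>t. (- 1) ^ k * D k (- t)) has_real_derivative (- 1) ^ Suc k * D (Suc k) (- t)) (at t)"
    by (auto intro!: derivative_eq_intros)
next
  show "continuous_on UNIV (\<lambda>t. (- 1) ^ m * D m (- t))"
    by (rule continuous_on_mult_left, rule continuous_on_compose2[of UNIV "D m"])
       (use assms in \<open>auto simp: test_tower_def intro!: continuous_intros\<close>)
next
  fix k t assume "k \<le> m" "t \<le> - d \<or> - c \<le> t"
  then show "(- 1) ^ k * D k (- t) = 0" using test_tower_zero[OF assms, of k "- t"] by auto
qed

lemma test_function_right_reg:
  assumes \<alpha>: "0 < \<alpha>" and T: "test_tower m D c d" and m: "frac_n \<alpha> < m" and ab: "a < c" "d < b"
  shows "right_reg \<alpha> a b (\<lambda>t. complex_of_real (D 0 t))"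
  using left_reg_reflect(1)[OF \<alpha> test_function_left_reg(1)[OF \<alpha> test_tower_reflect[OF T] m, of "- b" "- a"]] ab
  by simp

lemma LINT_zext:
  "continuous_on {a..b} F \<Longrightarrow> (LINT t|lborel. zext a b F t) = integral {a..b} F"
proof -
  assume c: "continuous_on {a..b} F"
  have "integral UNIV (zext a b F) = (LINT t|lborel. zext a b F t)"
    by (rule integral_unique) (rule has_integral_integral_lborel[OF zext_integrable[OF c]])
  moreover have "integral UNIV (zext a b F) = integral UNIV (\<lambda>t. if t \<in> {a..b} then F t else 0)"
    by (rule arg_cong[of _ _ "integral UNIV"]) (auto simp: zext_def fun_eq_iff)
  ultimately show ?thesis
    using integral_restrict_UNIV[of "{a..b}" F] by simp
qed

text \<open>For a test function all derivatives in the fractional derivative fall on the test function, so that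
  Fubini for bounded functions moves the kernel to \<open>p\<close>, and \<open>n\<close> ordinary integrations by parts inside
  \<open>[c, d]\<close> move the derivatives; the boundary terms vanish with the test function.\<close>

lemma test_function_integration_by_parts:
  assumes \<alpha>: "0 < \<alpha>" and T: "test_tower m D c d" and m: "frac_n \<alpha> < m" and ab: "a < c" "c < d" "d < b"
    and p: "right_reg \<alpha> a b p"
  shows "integral {a..b} (\<lambda>t. p t * left_RL \<alpha> a (\<lambda>t. complex_of_real (D 0 t)) t)
       = integral {a..b} (\<lambda>t. complex_of_real (D 0 t) * right_RL \<alpha> b p t)"
proof -
  let ?\<phi> = "\<lambda>k t. complex_of_real (D k t)" and ?\<gamma> = "real (frac_n \<alpha>) - \<alpha>" and ?n = "frac_n \<alpha>"
  have \<gamma>: "0 < ?\<gamma>" by (rule frac_n_bounds[OF \<alpha>])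
  have n: "0 < ?n" by (simp add: frac_n_def)
  have pc: "continuous_on {a..b} p" using p by (simp add: right_reg_def)
  define \<Psi> where "\<Psi> = (\<lambda>k t. rGamma ?\<gamma> *\<^sub>R (vderiv ^^ k) (right_kernel_int \<alpha> b p) t)"
  have tower: "deriv_tower ?n \<Psi> {a<..<b}"
    using p unfolding right_reg_def \<Psi>_def
    by (auto simp: deriv_tower_def dest!: times_differentiable_deriv_tower
        intro!: bounded_linear.has_vector_derivative[OF bounded_linear_scaleR_right])
  have \<Psi>0: "rr ?\<gamma> (zext a b p) t = \<Psi> 0 t" if "t \<in> {a<..<b}" for t
  proof -
    have c: "continuous_on {- b..- a} (\<lambda>s. p (- s))"
      by (rule continuous_on_compose2[OF pc]) (auto intro!: continuous_intros)
    have "rl ?\<gamma> (zext (- b) (- a) (\<lambda>s. p (- s))) (- t) = rGamma ?\<gamma> *\<^sub>R left_kernel_int \<alpha> (- b) (\<lambda>s. p (- s)) (- t)"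
      by (rule left_kernel_int_eq_rl[OF \<alpha> c]) (use that in auto)
    then show ?thesis
      by (simp add: \<Psi>_def right_kernel_int_reflect rr_eq_rl_reflect zext_reflect[abs_def])
  qed
  have cn: "continuous_on {a..b} (rl ?\<gamma> (?\<phi> ?n))"
  proof (rule continuous_at_imp_continuous_on, rule ballI)
    fix t
    have "Suc (?n - 1) = ?n" using n by simp
    then show "isCont (rl ?\<gamma> (?\<phi> ?n)) t"
      using test_tower_rl_has_derivative(2)[OF T _ \<gamma>, of "?n - 1" t] m by simp
  qed
  have \<phi>c: "continuous_on S (?\<phi> k)" if "k \<le> ?n" for k S
    by (rule test_tower_complex_continuous[OF T]) (use m that in simp)
  have \<phi>z: "?\<phi> k t = 0" if "k \<le> ?n" "t \<le> c \<or> d \<le> t" for k t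
    using test_tower_zero[OF T, of k t] m that by simp
  have \<Psi>c: "continuous_on {c..d} (\<Psi> j)" if "j < ?n" for j
  proof (rule continuous_at_imp_continuous_on, rule ballI)
    fix t assume "t \<in> {c..d}"
    then have "(\<Psi> j has_vector_derivative \<Psi> (Suc j) t) (at t)"
      using deriv_towerD[OF tower that, of t] ab by auto
    then show "isCont (\<Psi> j) t" by (rule has_vector_derivative_continuous)
  qed
  obtain K where K: "\<And>s. norm (zext a b p s) \<le> K" using zext_bounded[OF pc] by blast
  obtain M where M: "\<And>s. norm (zext a b (?\<phi> ?n) s) \<le> M" using zext_bounded[OF \<phi>c[OF order_refl]] by blast
  have ze: "zext a b (?\<phi> ?n) = ?\<phi> ?n"
    using \<phi>z[of ?n] ab by (auto simp: zext_def indicator_def fun_eq_iff)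
  have step: "integral {c..d} (\<lambda>t. ?\<phi> (?n - j) t * \<Psi> j t) = (- 1) ^ j * integral {c..d} (\<lambda>t. ?\<phi> ?n t * \<Psi> 0 t)"
    if "j \<le> ?n" for j
    using that
  proof (induction j)
    case (Suc j)
    define k where "k = ?n - Suc j"
    have k: "?n - j = Suc k" "k < ?n" "j < ?n" using Suc.prems by (auto simp: k_def)
    have "((\<lambda>t. ?\<phi> k t * \<Psi> (Suc j) t + ?\<phi> (Suc k) t * \<Psi> j t) has_integral ?\<phi> k d * \<Psi> j d - ?\<phi> k c * \<Psi> j c) {c..d}"
    proof (rule fundamental_theorem_of_calculus)
      fix t assume t: "t \<in> {c..d}"
      have "(D k has_real_derivative D (Suc k) t) (at t)" using T k m by (simp add: test_tower_def)
      then have "(?\<phi> k has_vector_derivative ?\<phi> (Suc k) t) (at t)"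
        by (intro has_vector_derivative_of_real) (simp add: has_real_derivative_iff_has_vector_derivative)
      moreover have "(\<Psi> j has_vector_derivative \<Psi> (Suc j) t) (at t)"
        using deriv_towerD[OF tower k(3), of t] ab t by auto
      ultimately show "((\<lambda>t. ?\<phi> k t * \<Psi> j t) has_vector_derivative ?\<phi> k t * \<Psi> (Suc j) t + ?\<phi> (Suc k) t * \<Psi> j t) (at t within {c..d})"
        by (intro has_vector_derivative_at_within[OF has_vector_derivative_mult])
    qed (use ab in simp)
    then have 1: "((\<lambda>t. ?\<phi> k t * \<Psi> (Suc j) t + ?\<phi> (Suc k) t * \<Psi> j t) has_integral 0) {c..d}"
      using \<phi>z[of k d] \<phi>z[of k c] k by simp
    have "(\<lambda>t. ?\<phi> (Suc k) t * \<Psi> j t) integrable_on {c..d}"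
      by (intro integrable_continuous_real continuous_on_mult \<phi>c \<Psi>c k(3)) (use k in simp)
    from has_integral_diff[OF 1 integrable_integral[OF this]]
    have "integral {c..d} (\<lambda>t. ?\<phi> k t * \<Psi> (Suc j) t) = - integral {c..d} (\<lambda>t. ?\<phi> (Suc k) t * \<Psi> j t)"
      by (simp add: has_integral_iff)
    then show ?case using Suc by (simp add: k_def[symmetric] k(1))
  qed simp
  have "integral {a..b} (\<lambda>t. p t * left_RL \<alpha> a (?\<phi> 0) t) = integral {a..b} (\<lambda>t. p t * rl ?\<gamma> (?\<phi> ?n) t)"
    by (rule integral_spike[of "{a, b}"])
       (use test_function_left_reg(2)[OF \<alpha> T m ab(1,3)] in auto)
  also have "\<dots> = (LINT t|lborel. zext a b (\<lambda>t. p t * rl ?\<gamma> (?\<phi> ?n) t) t)"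
    by (rule LINT_zext[symmetric]) (intro continuous_on_mult pc cn)
  also have "\<dots> = (LINT t|lborel. zext a b p t * rl ?\<gamma> (?\<phi> ?n) t)"
    by (simp add: zext_def)
  also have "\<dots> = (LINT s|lborel. ?\<phi> ?n s * rr ?\<gamma> (zext a b p) s)"
    by (rule pairing_bounded[OF \<gamma> _ zext_measurable[OF pc] _ zext_outside M[unfolded ze] K])
       (use \<phi>z[of ?n] ab borel_measurable_continuous_onI[OF \<phi>c[OF order_refl]] in auto)
  also have "\<dots> = (LINT s|lborel. zext c d (\<lambda>s. ?\<phi> ?n s * \<Psi> 0 s) s)"
  proof (rule Bochner_Integration.integral_cong[OF refl])
    fix s
    show "?\<phi> ?n s * rr ?\<gamma> (zext a b p) s = zext c d (\<lambda>s. ?\<phi> ?n s * \<Psi> 0 s) s"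
      using \<phi>z[of ?n s] \<Psi>0[of s] ab by (cases "s \<in> {c..d}") (auto simp: zext_def)
  qed
  also have "\<dots> = integral {c..d} (\<lambda>s. ?\<phi> ?n s * \<Psi> 0 s)"
    by (rule LINT_zext) (intro continuous_on_mult \<phi>c \<Psi>c n order_refl)
  also have "\<dots> = integral {c..d} (\<lambda>t. (- 1) ^ ?n * (?\<phi> 0 t * \<Psi> ?n t))"
  proof -
    have "integral {c..d} (\<lambda>t. (- 1) ^ ?n * (?\<phi> 0 t * \<Psi> ?n t)) = (- 1) ^ ?n * integral {c..d} (\<lambda>t. ?\<phi> 0 t * \<Psi> ?n t)"
      by (rule integral_mult_right)
    also have "\<dots> = (- 1) ^ ?n * ((- 1) ^ ?n * integral {c..d} (\<lambda>t. ?\<phi> ?n t * \<Psi> 0 t))"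
      using step[OF order_refl] by simp
    also have "\<dots> = integral {c..d} (\<lambda>t. ?\<phi> ?n t * \<Psi> 0 t)"
      by (simp flip: mult.assoc power_mult_distrib)
    finally show ?thesis by simp
  qed
  also have "\<dots> = integral {c..d} (\<lambda>t. ?\<phi> 0 t * right_RL \<alpha> b p t)"
    by (simp add: \<Psi>_def right_RL_def rGamma_inverse_Gamma scaleR_conv_of_real inverse_eq_divide mult_ac)
  also have "\<dots> = integral {a..b} (\<lambda>t. ?\<phi> 0 t * right_RL \<alpha> b p t)"
  proof -
    have "integral {a..b} (\<lambda>t. ?\<phi> 0 t * right_RL \<alpha> b p t)
      = integral {a..b} (\<lambda>t. if t \<in> {c..d} then ?\<phi> 0 t * right_RL \<alpha> b p t else 0)"
      by (rule Henstock_Kurzweil_Integration.integral_cong) (use \<phi>z[of 0] in auto)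
    also have "\<dots> = integral {c..d} (\<lambda>t. ?\<phi> 0 t * right_RL \<alpha> b p t)"
    proof -
      have "{c..d} \<inter> {a..b} = {c..d}" using ab by (intro Int_absorb2) simp
      then show ?thesis by (simp only: integral_restrict_Int)
    qed
    finally show ?thesis by simp
  qed
  finally show ?thesis .
qed

section \<open>The scalar operator and its adjoint\<close>

lemma continuous_times_absolutely_integrable:
  fixes p f :: "real \<Rightarrow> complex"
  assumes "continuous_on {a..b} p" "f absolutely_integrable_on {a..b}"
  shows "(\<lambda>t. p t * f t) absolutely_integrable_on {a..b}"
proof -
  have "p \<in> borel_measurable (lebesgue_on {a..b})"
    by (rule continuous_imp_measurable_on_sets_lebesgue[OF assms(1)]) simp
  moreover have "bounded (p ` {a..b})"
    by (rule compact_imp_bounded[OF compact_continuous_image[OF assms(1)]]) simp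
  ultimately show ?thesis
    by (intro absolutely_integrable_bounded_measurable_product[OF bilinear_times _ _ _ assms(2)]) simp_all
qed

lemma continuous_times_integrable:
  fixes p f :: "real \<Rightarrow> complex"
  assumes "continuous_on {a..b} p" "f absolutely_integrable_on {a..b}"
  shows "(\<lambda>t. p t * f t) integrable_on {a..b}"
  by (rule set_lebesgue_integral_eq_integral(1)[OF continuous_times_absolutely_integrable[OF assms]])

text \<open>The scalar version of \<^const>\<open>frac_D\<close>, sorted by left and right derivatives.\<close>

definition sD :: "real \<Rightarrow> real \<Rightarrow> complex \<Rightarrow> real \<Rightarrow> real \<Rightarrow> (real \<Rightarrow> complex) \<Rightarrow> real \<Rightarrow> complex" where
  "sD \<alpha> \<beta> \<mu> a b y t = (1 / 2 + \<i> * \<mu> / 2) * left_RL \<alpha> a y t + (\<i> * \<mu> / 2 - 1 / 2) * right_RL \<beta> b y t"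

lemma sD_absolutely_integrable:
  assumes "left_reg \<alpha> a b y" "right_reg \<beta> a b y"
  shows "sD \<alpha> \<beta> \<mu> a b y absolutely_integrable_on {a..b}"
  unfolding sD_def[abs_def] using assms
  by (intro set_integral_add continuous_times_absolutely_integrable continuous_on_const)
     (simp_all add: left_reg_def right_reg_def)

lemma frac_D_nth:
  assumes "0 < \<alpha>" "0 < \<beta>" "left_reg \<alpha> a b y" "right_reg \<beta> a b y" "t \<in> {a<..<b}"
  shows "frac_D \<alpha> \<beta> \<mu> a b y t $ i = sD \<alpha> \<beta> \<mu> a b (\<lambda>s. y s $ i) t"
  using left_reg_linear(2)[OF assms(1,3) bounded_linear_vec_nth assms(5), of i]
    right_reg_linear(2)[OF assms(2,4) bounded_linear_vec_nth assms(5), of i]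
  by (simp add: frac_D_def sD_def algebra_simps)

lemma sD_combine:
  assumes "0 < \<alpha>" "0 < \<beta>" "left_reg \<alpha> a b x" "right_reg \<beta> a b x" "left_reg \<alpha> a b y" "right_reg \<beta> a b y"
    "t \<in> {a<..<b}"
  shows "sD \<alpha> \<beta> \<mu> a b (\<lambda>s. c *\<^sub>R x s + d *\<^sub>R y s) t = c *\<^sub>R sD \<alpha> \<beta> \<mu> a b x t + d *\<^sub>R sD \<alpha> \<beta> \<mu> a b y t"
  unfolding sD_def left_reg_combine(2)[OF assms(1,3,5,7)] right_reg_combine(2)[OF assms(2,4,6,7)]
  by (simp add: scaleR_conv_of_real algebra_simps)

text \<open>A fractional derivative is a pointwise derivative everywhere in the open interval, which is what
  \<open>fundamental_lemma\<close> needs.\<close>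

lemma left_RL_has_primitive:
  assumes "left_reg \<alpha> a b y"
  obtains U where "\<And>t. t \<in> {a<..<b} \<Longrightarrow> (U has_vector_derivative left_RL \<alpha> a y t) (at t)"
proof -
  let ?n = "frac_n \<alpha>" and ?\<gamma> = "real (frac_n \<alpha>) - \<alpha>"
  have "?n - 1 < ?n" "Suc (?n - 1) = ?n" by (simp_all add: frac_n_def)
  then have "((vderiv ^^ (?n - 1)) (left_kernel_int \<alpha> a y) has_vector_derivative (vderiv ^^ ?n) (left_kernel_int \<alpha> a y) t) (at t)"
    if "t \<in> {a<..<b}" for t
    using deriv_towerD[OF left_reg_tower[OF assms] _ that, of "?n - 1"] by simp
  then show ?thesis
    by (intro that[of "\<lambda>t. (1 / Gamma ?\<gamma>) *\<^sub>R (vderiv ^^ (?n - 1)) (left_kernel_int \<alpha> a y) t"])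
       (auto simp: left_RL_def intro: bounded_linear.has_vector_derivative[OF bounded_linear_scaleR_right])
qed

lemma right_RL_has_primitive:
  assumes "right_reg \<alpha> a b y"
  obtains U where "\<And>t. t \<in> {a<..<b} \<Longrightarrow> (U has_vector_derivative right_RL \<alpha> b y t) (at t)"
proof -
  let ?n = "frac_n \<alpha>" and ?\<gamma> = "real (frac_n \<alpha>) - \<alpha>"
  have tow: "deriv_tower ?n (\<lambda>k. (vderiv ^^ k) (right_kernel_int \<alpha> b y)) {a<..<b}"
    using assms by (intro times_differentiable_deriv_tower) (simp add: right_reg_def)
  have "?n - 1 < ?n" "Suc (?n - 1) = ?n" by (simp_all add: frac_n_def)
  then have "((vderiv ^^ (?n - 1)) (right_kernel_int \<alpha> b y) has_vector_derivative (vderiv ^^ ?n) (right_kernel_int \<alpha> b y) t) (at t)"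
    if "t \<in> {a<..<b}" for t
    using deriv_towerD[OF tow _ that, of "?n - 1"] by simp
  then show ?thesis
    by (intro that[of "\<lambda>t. (1 / Gamma ?\<gamma>) *\<^sub>R ((- 1) ^ ?n *\<^sub>R (vderiv ^^ (?n - 1)) (right_kernel_int \<alpha> b y) t)"])
       (auto simp only: right_RL_def intro!: bounded_linear.has_vector_derivative[OF bounded_linear_scaleR_right])
qed

lemma sD_eq_of_test_functions:
  assumes ab: "a < b" and y: "left_reg \<alpha> a b y" "right_reg \<beta> a b y" and g: "continuous_on {a..b} g"
    and test: "\<And>D c d. a < c \<Longrightarrow> c < d \<Longrightarrow> d < b \<Longrightarrow> test_tower m D c d \<Longrightarrow>
       integral {a..b} (\<lambda>t. of_real (D 0 t) * (sD \<alpha> \<beta> \<mu> a b y t - g t)) = 0"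
    and t: "t \<in> {a<..<b}"
  shows "sD \<alpha> \<beta> \<mu> a b y t = g t"
proof -
  obtain U where U: "\<And>t. t \<in> {a<..<b} \<Longrightarrow> (U has_vector_derivative left_RL \<alpha> a y t) (at t)"
    using left_RL_has_primitive[OF y(1)] by blast
  obtain V where V: "\<And>t. t \<in> {a<..<b} \<Longrightarrow> (V has_vector_derivative right_RL \<beta> b y t) (at t)"
    using right_RL_has_primitive[OF y(2)] by blast
  define G where "G = (\<lambda>t. integral {a..t} g)"
  have G: "(G has_vector_derivative g t) (at t)" if "t \<in> {a<..<b}" for t
    using integral_has_vector_derivative[OF g, of t] that unfolding G_def
    by (simp add: at_within_Icc_at)
  have "sD \<alpha> \<beta> \<mu> a b y t - g t = 0"
  proof (rule fundamental_lemma[where u = "\<lambda>t. sD \<alpha> \<beta> \<mu> a b y t - g t" and a = a and b = b and m = m, OF _ _ _ t])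
    show "integral {a..b} (\<lambda>t. of_real (D 0 t) * (sD \<alpha> \<beta> \<mu> a b y t - g t)) = 0"
      if "a < c" "c < d" "d < b" "test_tower m D c d" for D c d
      using that by (rule test)
    show "(\<lambda>t. sD \<alpha> \<beta> \<mu> a b y t - g t) absolutely_integrable_on {a..b}"
      by (intro set_integral_diff sD_absolutely_integrable y absolutely_integrable_continuous_real g)
    show "((\<lambda>t. ((1 / 2 + \<i> * \<mu> / 2) * U t + (\<i> * \<mu> / 2 - 1 / 2) * V t) - G t) has_vector_derivative sD \<alpha> \<beta> \<mu> a b y t - g t) (at t)"
      if "t \<in> {a<..<b}" for t
      unfolding sD_def
      by (intro has_vector_derivative_diff has_vector_derivative_add G that
          bounded_linear.has_vector_derivative[OF bounded_linear_mult_right] U V)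
  qed
  then show ?thesis by simp
qed

lemma sD_integral:
  assumes "continuous_on {a..b} p" "left_reg \<alpha> a b h" "right_reg \<beta> a b h"
  shows "integral {a..b} (\<lambda>t. p t * sD \<alpha> \<beta> \<mu> a b h t)
    = (1 / 2 + \<i> * \<mu> / 2) * integral {a..b} (\<lambda>t. p t * left_RL \<alpha> a h t)
    + (\<i> * \<mu> / 2 - 1 / 2) * integral {a..b} (\<lambda>t. p t * right_RL \<beta> b h t)"
proof -
  have 1: "(\<lambda>t. p t * left_RL \<alpha> a h t) integrable_on {a..b}" "(\<lambda>t. p t * right_RL \<beta> b h t) integrable_on {a..b}"
    using assms by (auto simp: left_reg_def right_reg_def intro!: continuous_times_integrable)
  have "integral {a..b} (\<lambda>t. p t * sD \<alpha> \<beta> \<mu> a b h t)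
     = integral {a..b} (\<lambda>t. (1 / 2 + \<i> * \<mu> / 2) * (p t * left_RL \<alpha> a h t) + (\<i> * \<mu> / 2 - 1 / 2) * (p t * right_RL \<beta> b h t))"
    by (rule Henstock_Kurzweil_Integration.integral_cong) (simp add: sD_def algebra_simps)
  also have "\<dots> = integral {a..b} (\<lambda>t. (1 / 2 + \<i> * \<mu> / 2) * (p t * left_RL \<alpha> a h t))
      + integral {a..b} (\<lambda>t. (\<i> * \<mu> / 2 - 1 / 2) * (p t * right_RL \<beta> b h t))"
    by (intro Henstock_Kurzweil_Integration.integral_add integrable_on_mult_right 1)
  finally show ?thesis by (simp only: integral_mult_right)
qed

text \<open>The adjoint of the operator for \<open>(\<alpha>, \<beta>, \<mu>)\<close> is minus the operator for \<open>(\<beta>, \<alpha>, -\<mu>)\<close>; this is where the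
  second Hamilton equation gets its form.\<close>

lemma sD_integration_by_parts:
  assumes "left_reg \<alpha> a b h" "right_reg \<beta> a b h" "left_reg \<beta> a b p" "right_reg \<alpha> a b p"
    and "integral {a..b} (\<lambda>t. p t * left_RL \<alpha> a h t) = integral {a..b} (\<lambda>t. h t * right_RL \<alpha> b p t)"
    and "integral {a..b} (\<lambda>t. p t * right_RL \<beta> b h t) = integral {a..b} (\<lambda>t. h t * left_RL \<beta> a p t)"
  shows "integral {a..b} (\<lambda>t. p t * sD \<alpha> \<beta> \<mu> a b h t) = - integral {a..b} (\<lambda>t. h t * sD \<beta> \<alpha> (- \<mu>) a b p t)"
proof -
  have "continuous_on {a..b} p" "continuous_on {a..b} h" using assms(1,3) by (simp_all add: left_reg_def)
  moreover have "(1 / 2 + \<i> * \<mu> / 2) * A + (\<i> * \<mu> / 2 - 1 / 2) * B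
      = - ((1 / 2 + \<i> * (- \<mu>) / 2) * B + (\<i> * (- \<mu>) / 2 - 1 / 2) * A)" for A B
    by (simp add: field_simps)
  ultimately show ?thesis
    by (simp only: sD_integral[OF _ assms(1,2), of p \<mu>] sD_integral[OF _ assms(3,4), of h "- \<mu>"] assms(5,6))
qed

lemma integral_reflect_Icc:
  fixes f :: "real \<Rightarrow> complex"
  shows "integral {- b..- a} (\<lambda>t. f (- t)) = integral {a..b} f"
  by (rule Henstock_Kurzweil_Integration.integral_reflect_real)

text \<open>The right derivative of order \<open>\<beta>\<close> is handled by reflecting the interval.\<close>

lemma integration_by_parts_mirror:
  fixes h p :: "real \<Rightarrow> complex"
  assumes \<beta>: "0 < \<beta>" and h: "right_reg \<beta> a b h" and p: "left_reg \<beta> a b p"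
    and ibp: "integral {- b..- a} (\<lambda>t. p (- t) * left_RL \<beta> (- b) (\<lambda>s. h (- s)) t)
      = integral {- b..- a} (\<lambda>t. h (- t) * right_RL \<beta> (- a) (\<lambda>s. p (- s)) t)"
  shows "integral {a..b} (\<lambda>t. p t * right_RL \<beta> b h t) = integral {a..b} (\<lambda>t. h t * left_RL \<beta> a p t)"
proof -
  have "integral {a..b} (\<lambda>t. p t * right_RL \<beta> b h t) = integral {- b..- a} (\<lambda>t. p (- t) * right_RL \<beta> b h (- t))"
    by (rule integral_reflect_Icc[symmetric])
  also have "\<dots> = integral {- b..- a} (\<lambda>t. p (- t) * left_RL \<beta> (- b) (\<lambda>s. h (- s)) t)"
    by (rule integral_spike[of "{- b, - a}"]) (use right_reg_reflect(2)[OF \<beta> h] in auto)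
  also note ibp
  also have "integral {- b..- a} (\<lambda>t. h (- t) * right_RL \<beta> (- a) (\<lambda>s. p (- s)) t)
      = integral {- b..- a} (\<lambda>t. h (- t) * left_RL \<beta> a p (- t))"
    by (rule integral_spike[of "{- b, - a}"]) (use left_reg_reflect(2)[OF \<beta> p] in auto)
  also have "\<dots> = integral {a..b} (\<lambda>t. h t * left_RL \<beta> a p t)"
    by (rule integral_reflect_Icc)
  finally show ?thesis .
qed

text \<open>At integer order \<open>N\<close> the kernel integral is the plain primitive of \<open>p\<close>, so \<open>p\<close> itself is \<open>N\<close> times
  differentiable. This makes the iterated derivatives in the natural boundary condition meaningful, and
  hence compatible with linear maps and with reflection.\<close>

lemma integer_order_deriv_tower:
  fixes p :: "real \<Rightarrow> 'v::euclidean_space"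
  assumes p: "left_reg (real N) a b p"
  shows "deriv_tower N (\<lambda>k. (vderiv ^^ k) p) {a<..<b}"
proof -
  have n: "frac_n (real N) = Suc N" by (simp add: frac_n_def)
  have pc: "continuous_on {a..b} p" using p by (simp add: left_reg_def)
  define K where "K = left_kernel_int (real N) a p"
  have tow: "deriv_tower (Suc N) (\<lambda>k. (vderiv ^^ k) K) {a<..<b}"
    using left_reg_tower[OF p] by (simp add: n K_def)
  then have tow': "deriv_tower N (\<lambda>k. (vderiv ^^ Suc k) K) {a<..<b}"
    unfolding deriv_tower_def by (metis Suc_less_eq)
  have "p t = (vderiv ^^ Suc 0) K t" if t: "t \<in> {a<..<b}" for t
  proof -
    have "((\<lambda>t. integral {a..t} p) has_vector_derivative p t) (at t within {a..b})"
      by (rule integral_has_vector_derivative[OF pc]) (use t in simp)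
    then have "((\<lambda>t. integral {a..t} p) has_vector_derivative p t) (at t)"
      using t by (simp add: at_within_Icc_at)
    moreover have "integral {a..t} p = K t" for t
      unfolding K_def left_kernel_int_def
      by (rule integral_spike[of "{t}"]) (auto simp: n)
    ultimately have "(K has_vector_derivative p t) (at t)" by simp
    then show ?thesis by (simp add: vderiv_def vector_derivative_at)
  qed
  from deriv_tower_times_differentiable[OF _ tow' this] show ?thesis
    by (intro times_differentiable_deriv_tower) simp
qed

lemma natural_boundary_linear:
  fixes p :: "real \<Rightarrow> 'v::euclidean_space" and T :: "'v \<Rightarrow> 'w::euclidean_space"
  assumes ab: "a < b" and p: "left_reg \<beta> a b p" and nb: "natural_boundary \<beta> a b p" and T: "bounded_linear T"
  shows "natural_boundary \<beta> a b (\<lambda>s. T (p s))"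
  unfolding natural_boundary_def
proof (intro impI allI conjI)
  fix k assume \<beta>: "\<beta> \<in> \<nat>" and k: "real k + 1 < \<beta>"
  interpret T: bounded_linear T by fact
  obtain N where N: "\<beta> = real N" using \<beta> by (auto elim: Nats_cases)
  have "deriv_tower N (\<lambda>k t. T ((vderiv ^^ k) p t)) {a<..<b}"
    using integer_order_deriv_tower[of N a b p] p N by (auto simp: deriv_tower_def intro: T.has_vector_derivative)
  from deriv_tower_vderiv[OF _ this, of "\<lambda>s. T (p s)" k]
  have eq: "(vderiv ^^ k) (\<lambda>s. T (p s)) t = T ((vderiv ^^ k) p t)" if "t \<in> {a<..<b}" for t
    using that k N by simp
  have la: "((vderiv ^^ k) p \<longlongrightarrow> 0) (at_right a)" and lb: "((vderiv ^^ k) p \<longlongrightarrow> 0) (at_left b)"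
    using nb \<beta> k by (auto simp: natural_boundary_def)
  show "((vderiv ^^ k) (\<lambda>s. T (p s)) \<longlongrightarrow> 0) (at_right a)"
    by (rule Lim_transform_eventually[OF T.tendsto_zero[OF la]])
       (rule eventually_mono[OF eventually_at_right_real[OF ab]], rule eq[symmetric])
  show "((vderiv ^^ k) (\<lambda>s. T (p s)) \<longlongrightarrow> 0) (at_left b)"
    by (rule Lim_transform_eventually[OF T.tendsto_zero[OF lb]])
       (rule eventually_mono[OF eventually_at_left_real[OF ab]], rule eq[symmetric])
qed

lemma natural_boundary_reflect:
  fixes p :: "real \<Rightarrow> 'v::euclidean_space"
  assumes ab: "a < b" and p: "left_reg \<beta> a b p" and nb: "natural_boundary \<beta> a b p"
  shows "natural_boundary \<beta> (- b) (- a) (\<lambda>s. p (- s))"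
  unfolding natural_boundary_def
proof (intro impI allI conjI)
  fix k assume \<beta>: "\<beta> \<in> \<nat>" and k: "real k + 1 < \<beta>"
  obtain N where N: "\<beta> = real N" using \<beta> by (auto elim: Nats_cases)
  have "deriv_tower N (\<lambda>k t. (- 1) ^ k *\<^sub>R (vderiv ^^ k) p (- t)) {- b<..<- a}"
    using deriv_tower_reflect[OF integer_order_deriv_tower[of N a b p]] p N by simp
  from deriv_tower_vderiv[OF _ this, of "\<lambda>s. p (- s)" k]
  have eq: "(vderiv ^^ k) (\<lambda>s. p (- s)) t = (- 1) ^ k *\<^sub>R (vderiv ^^ k) p (- t)" if "t \<in> {- b<..<- a}" for t
    using that k N by simp
  have la: "((vderiv ^^ k) p \<longlongrightarrow> 0) (at_right a)" and lb: "((vderiv ^^ k) p \<longlongrightarrow> 0) (at_left b)"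
    using nb \<beta> k by (auto simp: natural_boundary_def)
  have ab': "- b < - a" using ab by simp
  have "((\<lambda>t. (vderiv ^^ k) p (- t)) \<longlongrightarrow> 0) (at_right (- b))"
    using lb by (simp add: at_left_minus filterlim_filtermap)
  from tendsto_scaleR[OF tendsto_const[of "(- 1) ^ k"] this]
  have 1: "((\<lambda>t. (- 1) ^ k *\<^sub>R (vderiv ^^ k) p (- t)) \<longlongrightarrow> 0) (at_right (- b))" by simp
  have "((\<lambda>t. (vderiv ^^ k) p (- t)) \<longlongrightarrow> 0) (at_left (- a))"
    using la by (simp add: at_right_minus filterlim_filtermap)
  from tendsto_scaleR[OF tendsto_const[of "(- 1) ^ k"] this]
  have 2: "((\<lambda>t. (- 1) ^ k *\<^sub>R (vderiv ^^ k) p (- t)) \<longlongrightarrow> 0) (at_left (- a))" by simp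
  show "((vderiv ^^ k) (\<lambda>s. p (- s)) \<longlongrightarrow> 0) (at_right (- b))"
    by (rule Lim_transform_eventually[OF 1])
       (rule eventually_mono[OF eventually_at_right_real[OF ab']], rule eq[symmetric])
  show "((vderiv ^^ k) (\<lambda>s. p (- s)) \<longlongrightarrow> 0) (at_left (- a))"
    by (rule Lim_transform_eventually[OF 2])
       (rule eventually_mono[OF eventually_at_left_real[OF ab']], rule eq[symmetric])
qed

definition dH :: "(real ^ 'd \<Rightarrow> complex ^ 'd \<Rightarrow> complex) \<Rightarrow> real ^ 'd \<Rightarrow> complex ^ 'd \<Rightarrow> real ^ 'd::finite \<Rightarrow> complex ^ 'd \<Rightarrow> complex" where
  "dH H x p u v = (\<Sum>i\<in>UNIV. grad_x H x p $ i * of_real (u $ i) + grad_p H x p $ i * v $ i)"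

text \<open>The full derivative splits along the coordinate axes; along a complex axis it is complex linear,
  because the Hamiltonian is holomorphic in each coordinate of \<open>p\<close>.\<close>

lemma hamiltonian_directional_derivative:
  fixes H :: "real ^ 'd::finite \<Rightarrow> complex ^ 'd \<Rightarrow> complex"
  assumes H: "hamiltonian_function H"
  shows "((\<lambda>\<epsilon>. H (x + \<epsilon> *\<^sub>R u) (p + \<epsilon> *\<^sub>R v)) has_vector_derivative
    dH H (x + \<epsilon> *\<^sub>R u) (p + \<epsilon> *\<^sub>R v) u v) (at \<epsilon>)"
proof -
  define x' p' where "x' = x + \<epsilon> *\<^sub>R u" and "p' = p + \<epsilon> *\<^sub>R v"
  let ?F = "\<lambda>y. H (fst y) (snd y)"
  obtain L where L: "(?F has_derivative L) (at (x', p'))"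
    using H unfolding hamiltonian_function_def differentiable_def by blast
  interpret L: bounded_linear L by (rule has_derivative_bounded_linear[OF L])
  have Lx: "L (axis i 1, 0) = grad_x H x' p' $ i" for i
  proof -
    have "((\<lambda>s. (x' + s *\<^sub>R axis i 1, p')) has_derivative (\<lambda>s. (s *\<^sub>R axis i 1, 0))) (at (0::real))"
      by (auto intro!: derivative_eq_intros)
    from has_derivative_compose[OF this, of ?F L] L
    have "((\<lambda>s. H (x' + s *\<^sub>R axis i 1) p') has_derivative (\<lambda>s. L (s *\<^sub>R axis i 1, 0))) (at 0)" by simp
    moreover have "L (s *\<^sub>R axis i 1, 0) = s *\<^sub>R L (axis i 1, 0)" for s
      using L.scaleR[of s "(axis i 1, 0)"] by simp
    ultimately have "((\<lambda>s. H (x' + s *\<^sub>R axis i 1) p') has_vector_derivative L (axis i 1, 0)) (at 0)"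
      by (simp add: has_vector_derivative_def)
    then show ?thesis by (simp add: grad_x_def vector_derivative_at)
  qed
  have Lp: "L (0, w *s axis i 1) = grad_p H x' p' $ i * w" for i w
  proof -
    have bl: "bounded_linear (\<lambda>z::complex. (0 :: real ^ 'd, z *s axis i (1::complex)))"
    proof -
      have "linear (\<lambda>z::complex. (0 :: real ^ 'd, z *s axis i (1::complex)))"
        by (rule linearI) (auto simp: vec_eq_iff algebra_simps)
      then show ?thesis by (simp add: linear_conv_bounded_linear)
    qed
    have "((\<lambda>z. (x', p') + (0, z *s axis i 1)) has_derivative (\<lambda>z. 0 + (0, z *s axis i 1))) (at (0::complex))"
      by (intro has_derivative_add has_derivative_const bounded_linear_imp_has_derivative bl)
    then have "((\<lambda>z. (x', p' + z *s axis i 1)) has_derivative (\<lambda>z. (0, z *s axis i 1))) (at (0::complex))"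
      by simp
    from has_derivative_compose[OF this, of ?F L] L
    have 1: "((\<lambda>z. H x' (p' + z *s axis i 1)) has_derivative (\<lambda>z. L (0, z *s axis i 1))) (at 0)" by simp
    have "((\<lambda>z. H x' (p' + z *s axis i 1)) has_field_derivative grad_p H x' p' $ i) (at 0)"
      using H by (simp add: hamiltonian_function_def grad_p_def DERIV_deriv_iff_field_differentiable)
    then have "((\<lambda>z. H x' (p' + z *s axis i 1)) has_derivative (*) (grad_p H x' p' $ i)) (at 0)"
      by (simp add: has_field_derivative_def)
    from has_derivative_unique[OF 1 this] show ?thesis by (simp add: fun_eq_iff)
  qed
  have "((\<lambda>\<epsilon>. (x + \<epsilon> *\<^sub>R u, p + \<epsilon> *\<^sub>R v)) has_derivative (\<lambda>s. (s *\<^sub>R u, s *\<^sub>R v))) (at \<epsilon>)"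
    by (auto intro!: derivative_eq_intros)
  from has_derivative_compose[OF this, of ?F L] L
  have "((\<lambda>\<epsilon>. H (x + \<epsilon> *\<^sub>R u) (p + \<epsilon> *\<^sub>R v)) has_derivative (\<lambda>s. L (s *\<^sub>R u, s *\<^sub>R v))) (at \<epsilon>)"
    by (simp add: x'_def p'_def)
  moreover have "L (s *\<^sub>R u, s *\<^sub>R v) = s *\<^sub>R L (u, v)" for s
    using L.scaleR[of s "(u, v)"] by simp
  ultimately have "((\<lambda>\<epsilon>. H (x + \<epsilon> *\<^sub>R u) (p + \<epsilon> *\<^sub>R v)) has_vector_derivative L (u, v)) (at \<epsilon>)"
    by (simp add: has_vector_derivative_def)
  moreover have "L (u, v) = dH H x' p' u v"
  proof -
    have u: "u = (\<Sum>i\<in>UNIV. u $ i *\<^sub>R axis i 1)" and v: "v = (\<Sum>i\<in>UNIV. v $ i *s axis i 1)"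
      by (simp_all add: basis_expansion flip: scalar_mult_eq_scaleR)
    have "(u, v) = (\<Sum>i\<in>UNIV. u $ i *\<^sub>R (axis i 1, 0) + (0, v $ i *s axis i 1))"
      by (subst u, subst v) (simp add: sum.distrib prod_eq_iff fst_sum snd_sum)
    then have "L (u, v) = (\<Sum>i\<in>UNIV. u $ i *\<^sub>R L (axis i 1, 0) + L (0, v $ i *s axis i 1))"
      by (simp only: L.sum L.add L.scaleR)
    then show ?thesis by (simp add: Lx Lp dH_def scaleR_conv_of_real mult.commute)
  qed
  ultimately show ?thesis by (simp add: x'_def p'_def)
qed

section \<open>The first variation of the action\<close>

abbreviation ccomp :: "(real \<Rightarrow> real ^ 'd) \<Rightarrow> 'd \<Rightarrow> real \<Rightarrow> complex" where
  "ccomp x i \<equiv> (\<lambda>s. complex_of_real (x s $ i))"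

lemma bounded_linear_ccomp: "bounded_linear (\<lambda>v :: real ^ 'd::finite. complex_of_real (v $ i))"
  by (rule bounded_linear_compose[OF bounded_linear_of_real bounded_linear_vec_nth])

lemma bounded_linear_cvec: "bounded_linear (cvec :: real ^ 'd::finite \<Rightarrow> complex ^ 'd)"
proof -
  have "linear (cvec :: real ^ 'd \<Rightarrow> complex ^ 'd)"
    by (rule linearI) (simp_all add: cvec_def vec_eq_iff complex_eq_iff)
  then show ?thesis by (simp add: linear_conv_bounded_linear)
qed

lemma frac_E_ccomp:
  fixes x :: "real \<Rightarrow> real ^ 'd::finite"
  assumes "0 < \<alpha>" "0 < \<beta>" "x \<in> frac_E \<alpha> \<beta> a b"
  shows "left_reg \<alpha> a b (ccomp x i)" "right_reg \<beta> a b (ccomp x i)"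
  using assms left_reg_linear(1)[OF _ _ bounded_linear_ccomp] right_reg_linear(1)[OF _ _ bounded_linear_ccomp]
  by (auto simp: frac_E_iff)

lemma frac_E_vec_nth:
  fixes y :: "real \<Rightarrow> complex ^ 'd::finite"
  assumes "0 < \<alpha>" "0 < \<beta>" "y \<in> frac_E \<alpha> \<beta> a b"
  shows "left_reg \<alpha> a b (\<lambda>s. y s $ i)" "right_reg \<beta> a b (\<lambda>s. y s $ i)"
  using assms left_reg_linear(1)[OF _ _ bounded_linear_vec_nth] right_reg_linear(1)[OF _ _ bounded_linear_vec_nth]
  by (auto simp: frac_E_iff)

lemma frac_D_cvec_nth:
  fixes x :: "real \<Rightarrow> real ^ 'd::finite"
  assumes "0 < \<alpha>" "0 < \<beta>" "x \<in> frac_E \<alpha> \<beta> a b" "t \<in> {a<..<b}"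
  shows "frac_D \<alpha> \<beta> \<mu> a b (\<lambda>s. cvec (x s)) t $ i = sD \<alpha> \<beta> \<mu> a b (ccomp x i) t"
proof -
  have "left_reg \<alpha> a b (\<lambda>s. cvec (x s))" "right_reg \<beta> a b (\<lambda>s. cvec (x s))"
    using assms left_reg_linear(1)[OF _ _ bounded_linear_cvec] right_reg_linear(1)[OF _ _ bounded_linear_cvec]
    by (auto simp: frac_E_iff)
  from frac_D_nth[OF assms(1,2) this assms(4)] show ?thesis by (simp add: cvec_def)
qed

lemma frac_E_combine:
  fixes x y :: "real \<Rightarrow> 'v::euclidean_space"
  assumes "0 < \<alpha>" "0 < \<beta>" "x \<in> frac_E \<alpha> \<beta> a b" "y \<in> frac_E \<alpha> \<beta> a b"
  shows "(\<lambda>t. c *\<^sub>R x t + d *\<^sub>R y t) \<in> frac_E \<alpha> \<beta> a b"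
  using assms(3,4) by (simp add: frac_E_iff left_reg_combine(1)[OF assms(1)] right_reg_combine(1)[OF assms(2)])

lemma action_componentwise:
  fixes x :: "real \<Rightarrow> real ^ 'd::finite"
  assumes "0 < \<alpha>" "0 < \<beta>" "x \<in> frac_E \<alpha> \<beta> a b"
  shows "action H \<alpha> \<beta> \<mu> a b (x, p) =
    integral {a..b} (\<lambda>t. (\<Sum>i\<in>UNIV. p t $ i * sD \<alpha> \<beta> \<mu> a b (ccomp x i) t) - H (x t) (p t))"
  unfolding action_def
  by (rule integral_spike[of "{a, b}"])
     (use frac_D_cvec_nth[OF assms] in \<open>auto simp: cdot_def\<close>)

lemma continuous_on_frac_E: "x \<in> frac_E \<alpha> \<beta> a b \<Longrightarrow> continuous_on {a..b} x"
  by (simp add: frac_E_def)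

text \<open>The derivative of the action at \<open>(x, p)\<close> in the direction \<open>(u, v)\<close>.\<close>

definition first_variation where
  "first_variation H \<alpha> \<beta> \<mu> a b x p u v = integral {a..b} (\<lambda>t.
     (\<Sum>i\<in>UNIV. v t $ i * sD \<alpha> \<beta> \<mu> a b (ccomp x i) t + p t $ i * sD \<alpha> \<beta> \<mu> a b (ccomp u i) t)
     - dH H (x t) (p t) (u t) (v t))"

lemma hamiltonian_continuous:
  assumes "hamiltonian_function H" "continuous_on S x" "continuous_on S p"
  shows "continuous_on S (\<lambda>t. H (x t) (p t))"
    "continuous_on S (\<lambda>t. grad_x H (x t) (p t) $ i)" "continuous_on S (\<lambda>t. grad_p H (x t) (p t) $ i)"
proof -
  have "isCont (\<lambda>y. H (fst y) (snd y)) (x', p')" for x' p'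
    using assms(1) unfolding hamiltonian_function_def by (intro differentiable_imp_continuous_within) blast
  then have c: "continuous_on UNIV (\<lambda>y. H (fst y) (snd y))"
    by (intro continuous_at_imp_continuous_on ballI) (metis prod.collapse)
  have xp: "continuous_on S (\<lambda>t. (x t, p t))" using assms by (intro continuous_on_Pair)
  show "continuous_on S (\<lambda>t. H (x t) (p t))"
    using continuous_on_compose2[OF c xp] by simp
  have gx: "continuous_on UNIV (\<lambda>y. grad_x H (fst y) (snd y))" and gp: "continuous_on UNIV (\<lambda>y. grad_p H (fst y) (snd y))"
    using assms(1) by (simp_all add: hamiltonian_function_def)
  show "continuous_on S (\<lambda>t. grad_x H (x t) (p t) $ i)"
    using continuous_on_compose2[OF gx xp] by (intro continuous_on_component) simp
  show "continuous_on S (\<lambda>t. grad_p H (x t) (p t) $ i)"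
    using continuous_on_compose2[OF gp xp] by (intro continuous_on_component) simp
qed

lemma dH_continuous:
  assumes "hamiltonian_function H" "continuous_on S x" "continuous_on S p" "continuous_on S u" "continuous_on S v"
  shows "continuous_on S (\<lambda>t. dH H (x t) (p t) (u t) (v t))"
  unfolding dH_def
  by (intro continuous_on_sum continuous_on_add continuous_on_mult hamiltonian_continuous[OF assms(1-3)]
      continuous_on_of_real continuous_on_component assms)

lemma hamiltonian_integral_derivative:
  fixes H :: "real ^ 'd::finite \<Rightarrow> complex ^ 'd \<Rightarrow> complex"
    and x u :: "real \<Rightarrow> real ^ 'd" and p v :: "real \<Rightarrow> complex ^ 'd"
  assumes H: "hamiltonian_function H" and c: "continuous_on {a..b} x" "continuous_on {a..b} p"
    "continuous_on {a..b} u" "continuous_on {a..b} v"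
  shows "((\<lambda>\<epsilon>. integral {a..b} (\<lambda>t. H (x t + \<epsilon> *\<^sub>R u t) (p t + \<epsilon> *\<^sub>R v t))) has_vector_derivative
    integral {a..b} (\<lambda>t. dH H (x t) (p t) (u t) (v t))) (at 0)"
proof -
  have "((\<lambda>\<epsilon>. integral (cbox a b) (\<lambda>t. H (x t + \<epsilon> *\<^sub>R u t) (p t + \<epsilon> *\<^sub>R v t))) has_vector_derivative
    integral (cbox a b) (\<lambda>t. dH H (x t + 0 *\<^sub>R u t) (p t + 0 *\<^sub>R v t) (u t) (v t))) (at 0 within UNIV)"
  proof (rule leibniz_rule_vector_derivative)
    show "((\<lambda>\<epsilon>. H (x t + \<epsilon> *\<^sub>R u t) (p t + \<epsilon> *\<^sub>R v t)) has_vector_derivative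
        dH H (x t + \<epsilon> *\<^sub>R u t) (p t + \<epsilon> *\<^sub>R v t) (u t) (v t)) (at \<epsilon> within UNIV)" for \<epsilon> t
      using hamiltonian_directional_derivative[OF H] .
    show "(\<lambda>t. H (x t + \<epsilon> *\<^sub>R u t) (p t + \<epsilon> *\<^sub>R v t)) integrable_on cbox a b" for \<epsilon>
    proof -
      have "(\<lambda>t. H (x t + \<epsilon> *\<^sub>R u t) (p t + \<epsilon> *\<^sub>R v t)) integrable_on {a..b}"
      by (intro integrable_continuous_real hamiltonian_continuous(1)[OF H] continuous_on_add continuous_on_scaleR continuous_on_const c)
      then show ?thesis by simp
    qed
    have s: "continuous_on (UNIV \<times> {a..b}) (\<lambda>y. f (snd y))" if "continuous_on {a..b} f" for f :: "real \<Rightarrow> 'z::topological_space"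
      by (rule continuous_on_compose2[OF that continuous_on_snd[OF continuous_on_id]]) auto
    show "continuous_on (UNIV \<times> cbox a b) (\<lambda>(\<epsilon>, t). dH H (x t + \<epsilon> *\<^sub>R u t) (p t + \<epsilon> *\<^sub>R v t) (u t) (v t))"
      unfolding case_prod_beta box_real
      by (intro dH_continuous H continuous_on_add continuous_on_scaleR continuous_on_fst continuous_on_id s[OF c(1)] s[OF c(2)] s[OF c(3)] s[OF c(4)])
  qed simp_all
  then show ?thesis by simp
qed

text \<open>The fractional part of the action is a quadratic polynomial in \<open>\<epsilon>\<close>; the Hamiltonian part is
  differentiated under the integral sign.\<close>

lemma action_has_derivative:
  fixes H :: "real ^ 'd::finite \<Rightarrow> complex ^ 'd \<Rightarrow> complex"
  assumes \<alpha>\<beta>: "0 < \<alpha>" "0 < \<beta>" and H: "hamiltonian_function H"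
    and x: "x \<in> frac_E \<alpha> \<beta> a b" and u: "u \<in> frac_E \<alpha> \<beta> a b"
    and p: "continuous_on {a..b} p" and v: "continuous_on {a..b} v"
  shows "((\<lambda>\<epsilon>. action H \<alpha> \<beta> \<mu> a b (lincomb 1 (x, p) \<epsilon> (u, v))) has_vector_derivative
    first_variation H \<alpha> \<beta> \<mu> a b x p u v) (at 0)"
proof -
  let ?X = "\<lambda>i. sD \<alpha> \<beta> \<mu> a b (ccomp x i)" and ?U = "\<lambda>i. sD \<alpha> \<beta> \<mu> a b (ccomp u i)"
  have xc: "continuous_on {a..b} x" and uc: "continuous_on {a..b} u"
    using continuous_on_frac_E x u by auto
  have int: "(\<lambda>t. \<Sum>i\<in>UNIV. w t $ i * sD \<alpha> \<beta> \<mu> a b (ccomp y i) t) integrable_on {a..b}"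
    if w: "continuous_on {a..b} w" and y: "y \<in> frac_E \<alpha> \<beta> a b" for w :: "real \<Rightarrow> complex ^ 'd" and y :: "real \<Rightarrow> real ^ 'd"
    by (intro integrable_sum finite continuous_times_integrable continuous_on_component w
        sD_absolutely_integrable frac_E_ccomp[OF \<alpha>\<beta> y])
  define PX PU VX VU where "PX = (\<lambda>t. \<Sum>i\<in>UNIV. p t $ i * ?X i t)" and "PU = (\<lambda>t. \<Sum>i\<in>UNIV. p t $ i * ?U i t)"
    and "VX = (\<lambda>t. \<Sum>i\<in>UNIV. v t $ i * ?X i t)" and "VU = (\<lambda>t. \<Sum>i\<in>UNIV. v t $ i * ?U i t)"
  have i: "PX integrable_on {a..b}" "PU integrable_on {a..b}" "VX integrable_on {a..b}" "VU integrable_on {a..b}"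
    unfolding PX_def PU_def VX_def VU_def by (intro int p v x u)+
  define J where "J = (\<lambda>\<epsilon>. integral {a..b} (\<lambda>t. H (x t + \<epsilon> *\<^sub>R u t) (p t + \<epsilon> *\<^sub>R v t)))"
  have act: "action H \<alpha> \<beta> \<mu> a b (lincomb 1 (x, p) \<epsilon> (u, v)) =
      integral {a..b} PX + \<epsilon> *\<^sub>R (integral {a..b} VX + integral {a..b} PU) + \<epsilon>\<^sup>2 *\<^sub>R integral {a..b} VU - J \<epsilon>" for \<epsilon>
  proof -
    have E: "(\<lambda>t. x t + \<epsilon> *\<^sub>R u t) \<in> frac_E \<alpha> \<beta> a b"
      using frac_E_combine[OF \<alpha>\<beta> x u, of 1 \<epsilon>] by simp
    have s: "sD \<alpha> \<beta> \<mu> a b (ccomp (\<lambda>t. x t + \<epsilon> *\<^sub>R u t) i) t = ?X i t + \<epsilon> *\<^sub>R ?U i t" if "t \<in> {a<..<b}" for i t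
    proof -
      have "ccomp (\<lambda>t. x t + \<epsilon> *\<^sub>R u t) i = (\<lambda>s. 1 *\<^sub>R ccomp x i s + \<epsilon> *\<^sub>R ccomp u i s)"
        by (simp add: fun_eq_iff complex_eq_iff)
      then show ?thesis
        using sD_combine[OF \<alpha>\<beta> frac_E_ccomp[OF \<alpha>\<beta> x, of i] frac_E_ccomp[OF \<alpha>\<beta> u, of i] that, of \<mu> 1 \<epsilon>]
        by (simp only: scaleR_one)
    qed
    have "action H \<alpha> \<beta> \<mu> a b (lincomb 1 (x, p) \<epsilon> (u, v)) =
        action H \<alpha> \<beta> \<mu> a b (\<lambda>t. x t + \<epsilon> *\<^sub>R u t, \<lambda>t. p t + \<epsilon> *\<^sub>R v t)"
      by (simp add: lincomb_def)
    also have "\<dots> = integral {a..b} (\<lambda>t. (\<Sum>i\<in>UNIV. (p t + \<epsilon> *\<^sub>R v t) $ i * sD \<alpha> \<beta> \<mu> a b (ccomp (\<lambda>t. x t + \<epsilon> *\<^sub>R u t) i) t)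
        - H (x t + \<epsilon> *\<^sub>R u t) (p t + \<epsilon> *\<^sub>R v t))"
      by (rule action_componentwise[OF \<alpha>\<beta> E])
    also have "\<dots> = integral {a..b} (\<lambda>t. PX t + \<epsilon> *\<^sub>R (VX t + PU t) + \<epsilon>\<^sup>2 *\<^sub>R VU t - H (x t + \<epsilon> *\<^sub>R u t) (p t + \<epsilon> *\<^sub>R v t))"
    proof (rule integral_spike[of "{a, b}"])
      fix t assume "t \<in> {a..b} - {a, b}"
      then have t: "t \<in> {a<..<b}" by auto
      show "PX t + \<epsilon> *\<^sub>R (VX t + PU t) + \<epsilon>\<^sup>2 *\<^sub>R VU t - H (x t + \<epsilon> *\<^sub>R u t) (p t + \<epsilon> *\<^sub>R v t) =
        (\<Sum>i\<in>UNIV. (p t + \<epsilon> *\<^sub>R v t) $ i * sD \<alpha> \<beta> \<mu> a b (ccomp (\<lambda>t. x t + \<epsilon> *\<^sub>R u t) i) t)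
        - H (x t + \<epsilon> *\<^sub>R u t) (p t + \<epsilon> *\<^sub>R v t)"
        unfolding s[OF t] unfolding PX_def VX_def PU_def VU_def vector_add_component vector_scaleR_component
        by (simp add: scaleR_conv_of_real sum_distrib_left power2_eq_square algebra_simps flip: sum.distrib)
    qed simp
    also have "\<dots> = integral {a..b} PX + \<epsilon> *\<^sub>R (integral {a..b} VX + integral {a..b} PU) + \<epsilon>\<^sup>2 *\<^sub>R integral {a..b} VU - J \<epsilon>"
    proof -
      have h: "(\<lambda>t. H (x t + \<epsilon> *\<^sub>R u t) (p t + \<epsilon> *\<^sub>R v t)) integrable_on {a..b}"
        by (intro integrable_continuous_real hamiltonian_continuous(1)[OF H] continuous_on_add continuous_on_scaleR continuous_on_const xc p uc v)
      show ?thesis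
        unfolding J_def
        by (intro integral_unique has_integral_diff has_integral_add has_integral_cmul integrable_integral i h)
    qed
    finally show ?thesis .
  qed
  have J: "(J has_vector_derivative integral {a..b} (\<lambda>t. dH H (x t) (p t) (u t) (v t))) (at 0)"
    unfolding J_def by (rule hamiltonian_integral_derivative[OF H xc p uc v])
  have d: "((\<lambda>\<epsilon>. integral {a..b} PX + \<epsilon> *\<^sub>R (integral {a..b} VX + integral {a..b} PU) + \<epsilon>\<^sup>2 *\<^sub>R integral {a..b} VU - J \<epsilon>)
     has_vector_derivative integral {a..b} VX + integral {a..b} PU - integral {a..b} (\<lambda>t. dH H (x t) (p t) (u t) (v t))) (at 0)"
    by (auto intro!: derivative_eq_intros J)
  have "first_variation H \<alpha> \<beta> \<mu> a b x p u v = integral {a..b} (\<lambda>t. VX t + PU t - dH H (x t) (p t) (u t) (v t))"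
    by (simp add: first_variation_def VX_def PU_def sum.distrib)
  also have "\<dots> = integral {a..b} VX + integral {a..b} PU - integral {a..b} (\<lambda>t. dH H (x t) (p t) (u t) (v t))"
    by (intro integral_unique has_integral_diff has_integral_add integrable_integral i integrable_continuous_real
        dH_continuous H xc p uc v)
  finally show ?thesis using d by (simp only: act)
qed

lemma smallo_iff_has_vector_derivative:
  fixes f :: "real \<Rightarrow> complex"
  shows "(\<lambda>\<epsilon>. f \<epsilon> - f 0 - of_real \<epsilon> * D) \<in> o[at 0](\<lambda>\<epsilon>. of_real \<epsilon>) \<longleftrightarrow> (f has_vector_derivative D) (at 0)"
proof -
  have ev: "eventually (\<lambda>\<epsilon>. complex_of_real \<epsilon> \<noteq> 0) (at 0)" by (simp add: eventually_at_filter)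
  have "(\<lambda>\<epsilon>. f \<epsilon> - f 0 - of_real \<epsilon> * D) \<in> o[at 0](\<lambda>\<epsilon>. of_real \<epsilon>) \<longleftrightarrow>
      ((\<lambda>\<epsilon>. (f \<epsilon> - f 0 - of_real \<epsilon> * D) / of_real \<epsilon>) \<longlongrightarrow> 0) (at 0)"
    by (rule iffI) (rule smalloD_tendsto, assumption, rule smalloI_tendsto[OF _ ev], assumption)
  also have "\<dots> \<longleftrightarrow> ((\<lambda>\<epsilon>. (f (0 + \<epsilon>) - f 0) /\<^sub>R \<epsilon> - D) \<longlongrightarrow> 0) (at 0)"
  proof (rule filterlim_cong[OF refl refl])
    show "\<forall>\<^sub>F \<epsilon> in at 0. (f \<epsilon> - f 0 - of_real \<epsilon> * D) / of_real \<epsilon> = (f (0 + \<epsilon>) - f 0) /\<^sub>R \<epsilon> - D"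
      using ev by eventually_elim (simp add: scaleR_conv_of_real field_simps)
  qed
  also have "\<dots> \<longleftrightarrow> (f has_vector_derivative D) (at 0)"
    unfolding has_vector_derivative_iff_quotient by (rule Lim_null[symmetric])
  finally show ?thesis .
qed

text \<open>The differential of the action in a direction is unique, and the zero map is linear, so the
  existential over differentials in the definition of an extremal disappears.\<close>

lemma extremal_iff_first_variation_zero:
  fixes H :: "real ^ 'd::finite \<Rightarrow> complex ^ 'd \<Rightarrow> complex"
  assumes \<alpha>\<beta>: "0 < \<alpha>" "0 < \<beta>" and H: "hamiltonian_function H"
    and x: "x \<in> frac_E \<alpha> \<beta> a b" and p: "continuous_on {a..b} p"
  shows "extremal (action H \<alpha> \<beta> \<mu> a b) (variations \<alpha> \<beta> a b) (x, p) \<longleftrightarrow>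
    (\<forall>(u, v) \<in> variations \<alpha> \<beta> a b. first_variation H \<alpha> \<beta> \<mu> a b x p u v = 0)"
proof -
  let ?F = "action H \<alpha> \<beta> \<mu> a b" and ?V = "variations \<alpha> \<beta> a b :: 'd couple set"
  have d: "((\<lambda>\<epsilon>. ?F (lincomb 1 (x, p) \<epsilon> (u, v))) has_vector_derivative first_variation H \<alpha> \<beta> \<mu> a b x p u v) (at 0)"
    if "(u, v) \<in> ?V" for u :: "real \<Rightarrow> real ^ 'd" and v :: "real \<Rightarrow> complex ^ 'd"
    by (rule action_has_derivative[OF \<alpha>\<beta> H x _ p]) (use that in \<open>auto simp: variations_def continuous_on_frac_E\<close>)
  have iff: "(\<lambda>\<epsilon>::real. ?F (lincomb 1 (x, p) \<epsilon> h) - ?F (x, p) - of_real \<epsilon> * D) \<in> o[at 0](\<lambda>\<epsilon>. of_real \<epsilon>)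
    \<longleftrightarrow> ((\<lambda>\<epsilon>. ?F (lincomb 1 (x, p) \<epsilon> h)) has_vector_derivative D) (at 0)" for h D
  proof -
    have "lincomb 1 (x, p) 0 h = (x, p)" by (simp add: lincomb_def)
    then show ?thesis using smallo_iff_has_vector_derivative[of "\<lambda>\<epsilon>. ?F (lincomb 1 (x, p) \<epsilon> h)" D] by simp
  qed
  show ?thesis
  proof
    assume "extremal ?F ?V (x, p)"
    then obtain dF where dF: "has_differential ?F ?V (x, p) dF" "\<And>h. h \<in> ?V \<Longrightarrow> dF h = 0"
      unfolding extremal_def by blast
    show "\<forall>(u, v) \<in> ?V. first_variation H \<alpha> \<beta> \<mu> a b x p u v = 0"
    proof (intro ballI, clarify)
      fix u :: "real \<Rightarrow> real ^ 'd" and v :: "real \<Rightarrow> complex ^ 'd"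
      assume h: "(u, v) \<in> ?V"
      then have "((\<lambda>\<epsilon>. ?F (lincomb 1 (x, p) \<epsilon> (u, v))) has_vector_derivative dF (u, v)) (at 0)"
        using dF(1) by (simp only: has_differential_def iff)
      from vector_derivative_unique_at[OF this d[OF h]] dF(2)[OF h]
      show "first_variation H \<alpha> \<beta> \<mu> a b x p u v = 0" by simp
    qed
  next
    assume z: "\<forall>(u, v) \<in> ?V. first_variation H \<alpha> \<beta> \<mu> a b x p u v = 0"
    have "has_differential ?F ?V (x, p) (\<lambda>_. 0)"
      unfolding has_differential_def iff
    proof (intro conjI ballI allI)
      fix h assume h: "h \<in> ?V"
      obtain u v where uv: "h = (u, v)" by (cases h)
      show "((\<lambda>\<epsilon>. ?F (lincomb 1 (x, p) \<epsilon> h)) has_vector_derivative 0) (at 0)"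
        using d[of u v] h z unfolding uv by auto
    qed simp
    then show "extremal ?F ?V (x, p)" unfolding extremal_def by blast
  qed
qed

section \<open>Vanishing of the first variation and the Hamilton equations\<close>

lemma frac_E_linear:
  fixes y :: "real \<Rightarrow> 'v::euclidean_space" and T :: "'v \<Rightarrow> 'w::euclidean_space"
  assumes "0 < \<alpha>" "0 < \<beta>" "y \<in> frac_E \<alpha> \<beta> a b" "bounded_linear T"
  shows "(\<lambda>s. T (y s)) \<in> frac_E \<alpha> \<beta> a b"
  using assms by (simp add: frac_E_iff left_reg_linear(1) right_reg_linear(1))

lemma sD_zero:
  fixes y :: "real \<Rightarrow> complex"
  assumes "0 < \<alpha>" "0 < \<beta>" "left_reg \<alpha> a b y" "right_reg \<beta> a b y" "t \<in> {a<..<b}"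
  shows "sD \<alpha> \<beta> \<mu> a b (\<lambda>s. 0) t = 0"
  using sD_combine[OF assms(1,2,3,4,3,4,5), of \<mu> 0 0] by simp

lemma test_function_sD_integration_by_parts:
  assumes \<alpha>\<beta>: "0 < \<alpha>" "0 < \<beta>" and T: "test_tower m D c d" and m: "frac_n \<alpha> < m" "frac_n \<beta> < m"
    and ab: "a < c" "c < d" "d < b" and q: "left_reg \<beta> a b q" "right_reg \<alpha> a b q"
  shows "integral {a..b} (\<lambda>t. q t * sD \<alpha> \<beta> \<mu> a b (\<lambda>t. complex_of_real (D 0 t)) t)
    = - integral {a..b} (\<lambda>t. complex_of_real (D 0 t) * sD \<beta> \<alpha> (- \<mu>) a b q t)"
proof (rule sD_integration_by_parts[OF _ _ q])
  show l: "left_reg \<alpha> a b (\<lambda>t. complex_of_real (D 0 t))"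
    by (rule test_function_left_reg(1)[OF \<alpha>\<beta>(1) T m(1) ab(1,3)])
  show r: "right_reg \<beta> a b (\<lambda>t. complex_of_real (D 0 t))"
    by (rule test_function_right_reg[OF \<alpha>\<beta>(2) T m(2) ab(1,3)])
  show "integral {a..b} (\<lambda>t. q t * left_RL \<alpha> a (\<lambda>t. complex_of_real (D 0 t)) t)
     = integral {a..b} (\<lambda>t. complex_of_real (D 0 t) * right_RL \<alpha> b q t)"
    by (rule test_function_integration_by_parts[OF \<alpha>\<beta>(1) T m(1) ab q(2)])
  show "integral {a..b} (\<lambda>t. q t * right_RL \<beta> b (\<lambda>t. complex_of_real (D 0 t)) t)
     = integral {a..b} (\<lambda>t. complex_of_real (D 0 t) * left_RL \<beta> a q t)"
  proof (rule integration_by_parts_mirror[OF \<alpha>\<beta>(2) r q(1)])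
    show "integral {- b..- a} (\<lambda>t. q (- t) * left_RL \<beta> (- b) (\<lambda>s. complex_of_real (D 0 (- s))) t)
      = integral {- b..- a} (\<lambda>t. complex_of_real (D 0 (- t)) * right_RL \<beta> (- a) (\<lambda>s. q (- s)) t)"
      using test_function_integration_by_parts[OF \<alpha>\<beta>(2) test_tower_reflect[OF T] m(2) _ _ _ left_reg_reflect(1)[OF \<alpha>\<beta>(2) q(1)]] ab
      by simp
  qed
qed

lemma variation_sD_integration_by_parts:
  assumes ab: "a < b" and \<alpha>\<beta>: "0 < \<alpha>" "0 < \<beta>" and h: "left_reg \<alpha> a b h" "right_reg \<beta> a b h" "h a = 0" "h b = 0"
    and q: "left_reg \<alpha> a b q" "right_reg \<alpha> a b q" "left_reg \<beta> a b q" "right_reg \<beta> a b q"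
    and nb: "natural_boundary \<alpha> a b q" "natural_boundary \<beta> a b q"
  shows "integral {a..b} (\<lambda>t. q t * sD \<alpha> \<beta> \<mu> a b h t) = - integral {a..b} (\<lambda>t. h t * sD \<beta> \<alpha> (- \<mu>) a b q t)"
proof (rule sD_integration_by_parts[OF h(1,2) q(3,2)])
  show "integral {a..b} (\<lambda>t. q t * left_RL \<alpha> a h t) = integral {a..b} (\<lambda>t. h t * right_RL \<alpha> b q t)"
    by (rule fractional_integration_by_parts[OF ab \<alpha>\<beta>(1) h(1,3,4) q(1,2) nb(1)])
  show "integral {a..b} (\<lambda>t. q t * right_RL \<beta> b h t) = integral {a..b} (\<lambda>t. h t * left_RL \<beta> a q t)"
  proof (rule integration_by_parts_mirror[OF \<alpha>\<beta>(2) h(2) q(3)])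
    show "integral {- b..- a} (\<lambda>t. q (- t) * left_RL \<beta> (- b) (\<lambda>s. h (- s)) t)
      = integral {- b..- a} (\<lambda>t. h (- t) * right_RL \<beta> (- a) (\<lambda>s. q (- s)) t)"
      by (rule fractional_integration_by_parts[OF _ \<alpha>\<beta>(2) right_reg_reflect(1)[OF \<alpha>\<beta>(2) h(2)] _ _
            right_reg_reflect(1)[OF \<alpha>\<beta>(2) q(4)] left_reg_reflect(1)[OF \<alpha>\<beta>(2) q(3)]
            natural_boundary_reflect[OF ab q(3) nb(2)]])
         (use ab h in simp_all)
  qed
qed

text \<open>Variations \<open>(0, \<phi> e\<^sub>i)\<close> yield the first equation, variations \<open>(\<phi> e\<^sub>i, 0)\<close> with a test function \<open>\<phi>\<close> the
  second one, after integration by parts.\<close>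

lemma hamilton_equations_of_first_variation_zero:
  fixes H :: "real ^ 'd::finite \<Rightarrow> complex ^ 'd \<Rightarrow> complex"
    and x :: "real \<Rightarrow> real ^ 'd" and p :: "real \<Rightarrow> complex ^ 'd"
  assumes ab: "a < b" and \<alpha>\<beta>: "0 < \<alpha>" "0 < \<beta>" and H: "hamiltonian_function H"
    and x: "x \<in> frac_E \<alpha> \<beta> a b" and p: "p \<in> frac_E \<beta> \<alpha> a b"
    and z: "\<And>u v. (u, v) \<in> variations \<alpha> \<beta> a b \<Longrightarrow> first_variation H \<alpha> \<beta> \<mu> a b x p u v = 0"
  shows "fractional_hamilton_equations H \<alpha> \<beta> \<mu> a b x p"
proof -
  \<comment> \<open>one derivative more than the orders require, so that the top derivative is itself a primitive\<close>
  define m where "m = Suc (max (frac_n \<alpha>) (frac_n \<beta>))"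
  have m: "frac_n \<alpha> < m" "frac_n \<beta> < m" by (simp_all add: m_def)
  have xc: "continuous_on {a..b} x" and pc: "continuous_on {a..b} p"
    using continuous_on_frac_E x p by auto
  note X = frac_E_ccomp[OF \<alpha>\<beta> x] and P = frac_E_vec_nth[OF \<alpha>\<beta>(2,1) p]
  note grad = hamiltonian_continuous(2,3)[OF H xc pc]
  have Z: "sD \<alpha> \<beta> \<mu> a b (\<lambda>s. 0) t = 0" if "t \<in> {a<..<b}" for t
    using sD_zero[OF \<alpha>\<beta> X that] .
  have phi: "(\<lambda>t. complex_of_real (D 0 t)) \<in> frac_E \<alpha> \<beta> a b"
    if "a < c" "c < d" "d < b" "test_tower m D c d" for D c d
    using test_function_left_reg(1)[OF \<alpha>\<beta>(1) that(4) m(1) that(1,3)]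
      test_function_right_reg[OF \<alpha>\<beta>(2) that(4) m(2) that(1,3)] by (simp add: frac_E_iff)
  have eq1: "sD \<alpha> \<beta> \<mu> a b (ccomp x i) t = grad_p H (x t) (p t) $ i" if t: "t \<in> {a<..<b}" for t i
  proof (rule sD_eq_of_test_functions[OF ab X grad(2) _ t])
    fix D c d assume D: "a < c" "c < d" "d < b" "test_tower m D c d"
    let ?v = "\<lambda>t. complex_of_real (D 0 t) *s axis i (1::complex) :: complex ^ 'd"
    have "bounded_linear (\<lambda>z::complex. z *s axis i (1::complex) :: complex ^ 'd)"
    proof -
      have "linear (\<lambda>z::complex. z *s axis i (1::complex) :: complex ^ 'd)"
        by (rule linearI) (auto simp: vec_eq_iff algebra_simps)
      then show ?thesis by (simp add: linear_conv_bounded_linear)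
    qed
    from frac_E_linear[OF \<alpha>\<beta> phi[OF D] this]
    have v: "?v \<in> frac_E \<alpha> \<beta> a b" .
    have "(\<lambda>_. 0 :: real ^ 'd) \<in> frac_E \<alpha> \<beta> a b"
      using frac_E_linear[OF \<alpha>\<beta> phi[OF D] bounded_linear_zero] .
    then have "(\<lambda>_. 0, ?v) \<in> variations \<alpha> \<beta> a b"
      using v test_tower_zero[OF D(4), of 0] D(1-3) by (simp add: variations_def)
    from z[OF this] have "0 = first_variation H \<alpha> \<beta> \<mu> a b x p (\<lambda>_. 0) ?v" by simp
    also have "\<dots> = integral {a..b} (\<lambda>t. complex_of_real (D 0 t) * (sD \<alpha> \<beta> \<mu> a b (ccomp x i) t - grad_p H (x t) (p t) $ i))"
      unfolding first_variation_def
    proof (rule integral_spike[of "{a, b}"])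
      fix t assume "t \<in> {a..b} - {a, b}"
      then have t: "t \<in> {a<..<b}" by auto
      have s: "(\<Sum>j\<in>UNIV. ?v t $ j * f j) = complex_of_real (D 0 t) * f i" for f :: "'d \<Rightarrow> complex"
        by (simp add: axis_def if_distrib[of "\<lambda>x. _ * x"] if_distrib[of "\<lambda>x. x * _"] cong: if_cong)
      have "(\<Sum>j\<in>UNIV. ?v t $ j * sD \<alpha> \<beta> \<mu> a b (ccomp x j) t + p t $ j * sD \<alpha> \<beta> \<mu> a b (ccomp (\<lambda>_. 0) j) t)
         = (\<Sum>j\<in>UNIV. ?v t $ j * sD \<alpha> \<beta> \<mu> a b (ccomp x j) t)"
        using Z[OF t] by simp
      moreover have "dH H (x t) (p t) 0 (?v t) = (\<Sum>j\<in>UNIV. ?v t $ j * grad_p H (x t) (p t) $ j)"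
        unfolding dH_def by (rule sum.cong) (simp_all add: mult.commute)
      ultimately show "complex_of_real (D 0 t) * (sD \<alpha> \<beta> \<mu> a b (ccomp x i) t - grad_p H (x t) (p t) $ i) =
          (\<Sum>j\<in>UNIV. ?v t $ j * sD \<alpha> \<beta> \<mu> a b (ccomp x j) t + p t $ j * sD \<alpha> \<beta> \<mu> a b (ccomp (\<lambda>_. 0) j) t)
          - dH H (x t) (p t) 0 (?v t)"
        by (simp only: s right_diff_distrib)
    qed simp
    finally show "integral {a..b} (\<lambda>t. complex_of_real (D 0 t) * (sD \<alpha> \<beta> \<mu> a b (ccomp x i) t - grad_p H (x t) (p t) $ i)) = 0"
      by (rule sym)
  qed
  have eq2: "sD \<beta> \<alpha> (- \<mu>) a b (\<lambda>s. p s $ i) t = - grad_x H (x t) (p t) $ i" if t: "t \<in> {a<..<b}" for t i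
  proof (rule sD_eq_of_test_functions[OF ab P continuous_on_minus[OF grad(1)] _ t])
    fix D c d assume D: "a < c" "c < d" "d < b" "test_tower m D c d"
    let ?\<phi> = "\<lambda>t. complex_of_real (D 0 t)" and ?u = "\<lambda>t. D 0 t *\<^sub>R axis i (1::real) :: real ^ 'd"
    have "bounded_linear (\<lambda>z::complex. Re z *\<^sub>R axis i (1::real) :: real ^ 'd)"
      by (rule bounded_linear_compose[OF bounded_linear_scaleR_left bounded_linear_Re])
    from frac_E_linear[OF \<alpha>\<beta> phi[OF D] this]
    have u: "?u \<in> frac_E \<alpha> \<beta> a b" by simp
    have "(\<lambda>_. 0 :: complex ^ 'd) \<in> frac_E \<alpha> \<beta> a b"
      using frac_E_linear[OF \<alpha>\<beta> phi[OF D] bounded_linear_zero] .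
    then have "(?u, \<lambda>_. 0) \<in> variations \<alpha> \<beta> a b"
      using u test_tower_zero[OF D(4), of 0] D(1-3) by (simp add: variations_def)
    from z[OF this] have "0 = first_variation H \<alpha> \<beta> \<mu> a b x p ?u (\<lambda>_. 0)" by simp
    also have "\<dots> = integral {a..b} (\<lambda>t. p t $ i * sD \<alpha> \<beta> \<mu> a b ?\<phi> t - ?\<phi> t * grad_x H (x t) (p t) $ i)"
      unfolding first_variation_def
    proof (rule integral_spike[of "{a, b}"])
      fix t assume "t \<in> {a..b} - {a, b}"
      then have t: "t \<in> {a<..<b}" by auto
      have "sD \<alpha> \<beta> \<mu> a b (ccomp ?u j) t = (if j = i then sD \<alpha> \<beta> \<mu> a b ?\<phi> t else 0)" for j
        using Z[OF t] by (cases "j = i") (simp_all add: axis_def)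
      then have "(\<Sum>j\<in>UNIV. (0 :: complex ^ 'd) $ j * sD \<alpha> \<beta> \<mu> a b (ccomp x j) t + p t $ j * sD \<alpha> \<beta> \<mu> a b (ccomp ?u j) t)
         = p t $ i * sD \<alpha> \<beta> \<mu> a b ?\<phi> t"
        by (simp add: if_distrib[of "\<lambda>x. _ * x"] cong: if_cong)
      moreover have "dH H (x t) (p t) (?u t) 0 = ?\<phi> t * grad_x H (x t) (p t) $ i"
      proof -
        have "grad_x H (x t) (p t) $ j * of_real (?u t $ j) + grad_p H (x t) (p t) $ j * (0 :: complex ^ 'd) $ j
            = (if j = i then ?\<phi> t * grad_x H (x t) (p t) $ i else 0)" for j
          by (cases "j = i") (simp_all add: axis_def)
        then show ?thesis unfolding dH_def by simp
      qed
      ultimately show "p t $ i * sD \<alpha> \<beta> \<mu> a b ?\<phi> t - ?\<phi> t * grad_x H (x t) (p t) $ i =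
        (\<Sum>j\<in>UNIV. (0 :: complex ^ 'd) $ j * sD \<alpha> \<beta> \<mu> a b (ccomp x j) t + p t $ j * sD \<alpha> \<beta> \<mu> a b (ccomp ?u j) t)
         - dH H (x t) (p t) (?u t) 0"
        by (simp only:)
    qed simp
    also have "\<dots> = integral {a..b} (\<lambda>t. p t $ i * sD \<alpha> \<beta> \<mu> a b ?\<phi> t) - integral {a..b} (\<lambda>t. ?\<phi> t * grad_x H (x t) (p t) $ i)"
    proof (rule Henstock_Kurzweil_Integration.integral_diff)
      show "(\<lambda>t. p t $ i * sD \<alpha> \<beta> \<mu> a b ?\<phi> t) integrable_on {a..b}"
        by (intro continuous_times_integrable continuous_on_component pc sD_absolutely_integrable)
           (use phi[OF D] in \<open>simp_all add: frac_E_iff\<close>)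
      show "(\<lambda>t. ?\<phi> t * grad_x H (x t) (p t) $ i) integrable_on {a..b}"
        by (intro integrable_continuous_real continuous_on_mult grad test_tower_complex_continuous[OF D(4)]) simp
    qed
    also have "integral {a..b} (\<lambda>t. p t $ i * sD \<alpha> \<beta> \<mu> a b ?\<phi> t) = - integral {a..b} (\<lambda>t. ?\<phi> t * sD \<beta> \<alpha> (- \<mu>) a b (\<lambda>s. p s $ i) t)"
      by (rule test_function_sD_integration_by_parts[OF \<alpha>\<beta> D(4) m D(1-3) P])
    finally have 1: "integral {a..b} (\<lambda>t. ?\<phi> t * sD \<beta> \<alpha> (- \<mu>) a b (\<lambda>s. p s $ i) t) + integral {a..b} (\<lambda>t. ?\<phi> t * grad_x H (x t) (p t) $ i) = 0"
      by (simp add: neg_eq_iff_add_eq_0)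
    have "integral {a..b} (\<lambda>t. ?\<phi> t * (sD \<beta> \<alpha> (- \<mu>) a b (\<lambda>s. p s $ i) t - - grad_x H (x t) (p t) $ i))
       = integral {a..b} (\<lambda>t. ?\<phi> t * sD \<beta> \<alpha> (- \<mu>) a b (\<lambda>s. p s $ i) t + ?\<phi> t * grad_x H (x t) (p t) $ i)"
      by (simp add: algebra_simps)
    also have "\<dots> = integral {a..b} (\<lambda>t. ?\<phi> t * sD \<beta> \<alpha> (- \<mu>) a b (\<lambda>s. p s $ i) t) + integral {a..b} (\<lambda>t. ?\<phi> t * grad_x H (x t) (p t) $ i)"
    proof (rule Henstock_Kurzweil_Integration.integral_add)
      show "(\<lambda>t. ?\<phi> t * sD \<beta> \<alpha> (- \<mu>) a b (\<lambda>s. p s $ i) t) integrable_on {a..b}"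
        by (intro continuous_times_integrable test_tower_complex_continuous[OF D(4)] sD_absolutely_integrable P) simp
      show "(\<lambda>t. ?\<phi> t * grad_x H (x t) (p t) $ i) integrable_on {a..b}"
        by (intro integrable_continuous_real continuous_on_mult grad test_tower_complex_continuous[OF D(4)]) simp
    qed
    finally show "integral {a..b} (\<lambda>t. ?\<phi> t * (sD \<beta> \<alpha> (- \<mu>) a b (\<lambda>s. p s $ i) t - - grad_x H (x t) (p t) $ i)) = 0"
      using 1 by simp
  qed
  have pr: "left_reg \<beta> a b p" "right_reg \<alpha> a b p" using p by (simp_all add: frac_E_iff)
  show ?thesis
    unfolding fractional_hamilton_equations_def
  proof (intro ballI conjI)
    fix t assume t: "t \<in> {a<..<b}"
    show "frac_D \<alpha> \<beta> \<mu> a b (\<lambda>s. cvec (x s)) t = grad_p H (x t) (p t)"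
      by (simp add: vec_eq_iff frac_D_cvec_nth[OF \<alpha>\<beta> x t] eq1[OF t])
    show "frac_D \<beta> \<alpha> (- \<mu>) a b p t = - grad_x H (x t) (p t)"
      by (simp add: vec_eq_iff frac_D_nth[OF \<alpha>\<beta>(2,1) pr t] eq2[OF t])
  qed
qed

text \<open>By the first equation the terms with \<open>v\<close> cancel; by integration by parts and the second equation so do
  the terms with \<open>u\<close>.\<close>

lemma first_variation_zero_of_hamilton_equations:
  fixes H :: "real ^ 'd::finite \<Rightarrow> complex ^ 'd \<Rightarrow> complex"
    and x :: "real \<Rightarrow> real ^ 'd" and p :: "real \<Rightarrow> complex ^ 'd"
  assumes ab: "a < b" and \<alpha>\<beta>: "0 < \<alpha>" "0 < \<beta>" and H: "hamiltonian_function H"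
    and x: "x \<in> frac_E \<alpha> \<beta> a b" and p: "p \<in> frac_E \<alpha> \<beta> a b" "p \<in> frac_E \<beta> \<alpha> a b"
    and nb: "natural_boundary \<alpha> a b p" "natural_boundary \<beta> a b p"
    and eqs: "fractional_hamilton_equations H \<alpha> \<beta> \<mu> a b x p" and uv: "(u, v) \<in> variations \<alpha> \<beta> a b"
  shows "first_variation H \<alpha> \<beta> \<mu> a b x p u v = 0"
proof -
  have xc: "continuous_on {a..b} x" and pc: "continuous_on {a..b} p"
    using continuous_on_frac_E x p by auto
  have u: "u \<in> frac_E \<alpha> \<beta> a b" "u a = 0" "u b = 0" using uv by (auto simp: variations_def)
  have uc: "continuous_on {a..b} u" by (rule continuous_on_frac_E[OF u(1)])
  note X = frac_E_ccomp[OF \<alpha>\<beta> x] and U = frac_E_ccomp[OF \<alpha>\<beta> u(1)]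
    and P1 = frac_E_vec_nth[OF \<alpha>\<beta> p(1)] and P2 = frac_E_vec_nth[OF \<alpha>\<beta>(2,1) p(2)]
  note grad = hamiltonian_continuous(2,3)[OF H xc pc]
  have pr: "left_reg \<alpha> a b p" "left_reg \<beta> a b p" "right_reg \<alpha> a b p" using p by (simp_all add: frac_E_iff)
  have eq1: "sD \<alpha> \<beta> \<mu> a b (ccomp x i) t = grad_p H (x t) (p t) $ i" if t: "t \<in> {a<..<b}" for t i
    using eqs t by (simp add: fractional_hamilton_equations_def flip: frac_D_cvec_nth[OF \<alpha>\<beta> x t])
  have eq2: "sD \<beta> \<alpha> (- \<mu>) a b (\<lambda>s. p s $ i) t = - grad_x H (x t) (p t) $ i" if t: "t \<in> {a<..<b}" for t i
    using eqs t by (simp add: fractional_hamilton_equations_def flip: frac_D_nth[OF \<alpha>\<beta>(2,1) pr(2,3) t])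
  have i1: "(\<lambda>t. p t $ i * sD \<alpha> \<beta> \<mu> a b (ccomp u i) t) integrable_on {a..b}" for i
    by (intro continuous_times_integrable continuous_on_component pc sD_absolutely_integrable U)
  have i2: "(\<lambda>t. grad_x H (x t) (p t) $ i * of_real (u t $ i)) integrable_on {a..b}" for i
    by (intro integrable_continuous_real continuous_on_mult grad continuous_on_of_real continuous_on_component uc)
  have "first_variation H \<alpha> \<beta> \<mu> a b x p u v = integral {a..b} (\<lambda>t. \<Sum>i\<in>UNIV.
      p t $ i * sD \<alpha> \<beta> \<mu> a b (ccomp u i) t - grad_x H (x t) (p t) $ i * of_real (u t $ i))"
    unfolding first_variation_def
  proof (rule integral_spike[of "{a, b}"])
    fix t assume "t \<in> {a..b} - {a, b}"
    then have t: "t \<in> {a<..<b}" by auto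
    show "(\<Sum>i\<in>UNIV. p t $ i * sD \<alpha> \<beta> \<mu> a b (ccomp u i) t - grad_x H (x t) (p t) $ i * of_real (u t $ i))
      = (\<Sum>i\<in>UNIV. v t $ i * sD \<alpha> \<beta> \<mu> a b (ccomp x i) t + p t $ i * sD \<alpha> \<beta> \<mu> a b (ccomp u i) t)
        - dH H (x t) (p t) (u t) (v t)"
      unfolding dH_def eq1[OF t] sum_subtractf[symmetric]
      by (rule sum.cong) (simp_all add: algebra_simps)
  qed simp
  also have "\<dots> = (\<Sum>i\<in>UNIV. integral {a..b} (\<lambda>t. p t $ i * sD \<alpha> \<beta> \<mu> a b (ccomp u i) t)
      - integral {a..b} (\<lambda>t. grad_x H (x t) (p t) $ i * of_real (u t $ i)))"
    by (intro integral_unique has_integral_sum finite has_integral_diff integrable_integral i1 i2)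
  also have "\<dots> = (\<Sum>i\<in>(UNIV :: 'd set). 0)"
  proof (rule sum.cong[OF refl])
    fix i :: 'd
    have "integral {a..b} (\<lambda>t. p t $ i * sD \<alpha> \<beta> \<mu> a b (ccomp u i) t)
        = - integral {a..b} (\<lambda>t. ccomp u i t * sD \<beta> \<alpha> (- \<mu>) a b (\<lambda>s. p s $ i) t)"
      by (rule variation_sD_integration_by_parts[OF ab \<alpha>\<beta> U _ _ P1(1) P2(2) P2(1) P1(2)])
         (use u natural_boundary_linear[OF ab pr(1) nb(1) bounded_linear_vec_nth]
            natural_boundary_linear[OF ab pr(2) nb(2) bounded_linear_vec_nth] in simp_all)
    also have "integral {a..b} (\<lambda>t. ccomp u i t * sD \<beta> \<alpha> (- \<mu>) a b (\<lambda>s. p s $ i) t)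
       = integral {a..b} (\<lambda>t. - (grad_x H (x t) (p t) $ i * of_real (u t $ i)))"
      by (rule integral_spike[of "{a, b}"]) (auto simp: eq2)
    finally show "integral {a..b} (\<lambda>t. p t $ i * sD \<alpha> \<beta> \<mu> a b (ccomp u i) t)
      - integral {a..b} (\<lambda>t. grad_x H (x t) (p t) $ i * of_real (u t $ i)) = 0" by simp
  qed
  finally show ?thesis by simp
qed

theorem theorem6p1:
  fixes a b \<alpha> \<beta> :: real and \<mu> :: complex
    and H :: "real ^ 'd::finite \<Rightarrow> complex ^ 'd \<Rightarrow> complex"
    and x :: "real \<Rightarrow> real ^ 'd" and p :: "real \<Rightarrow> complex ^ 'd"
    and xa xb :: "real ^ 'd" and pa pb :: "complex ^ 'd"
  assumes "a < b" and "\<alpha> > 0" and "\<beta> > 0"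
    and "hamiltonian_function H"
    and "x \<in> frac_E \<alpha> \<beta> a b" and "p \<in> frac_E \<alpha> \<beta> a b"
    and "p \<in> frac_E \<beta> \<alpha> a b"
    and "x a = xa" and "p a = pa" and "x b = xb" and "p b = pb"
  shows "(extremal (action H \<alpha> \<beta> \<mu> a b) (variations \<alpha> \<beta> a b) (x, p)
            \<longrightarrow> fractional_hamilton_equations H \<alpha> \<beta> \<mu> a b x p)
       \<and> (natural_boundary \<alpha> a b p \<and> natural_boundary \<beta> a b p \<longrightarrow>
            (extremal (action H \<alpha> \<beta> \<mu> a b) (variations \<alpha> \<beta> a b) (x, p)
              \<longleftrightarrow> fractional_hamilton_equations H \<alpha> \<beta> \<mu> a b x p))"
proof -
  note extremal_iff = extremal_iff_first_variation_zero[OF assms(2-5) continuous_on_frac_E[OF assms(6)]]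
  have 1: "fractional_hamilton_equations H \<alpha> \<beta> \<mu> a b x p"
    if "extremal (action H \<alpha> \<beta> \<mu> a b) (variations \<alpha> \<beta> a b) (x, p)"
    by (rule hamilton_equations_of_first_variation_zero[OF assms(1-5,7)]) (use that in \<open>auto simp: extremal_iff\<close>)
  have 2: "extremal (action H \<alpha> \<beta> \<mu> a b) (variations \<alpha> \<beta> a b) (x, p)"
    if "natural_boundary \<alpha> a b p" "natural_boundary \<beta> a b p" "fractional_hamilton_equations H \<alpha> \<beta> \<mu> a b x p"
    unfolding extremal_iff
    using first_variation_zero_of_hamilton_equations[OF assms(1-7) that] by (auto simp del: split_paired_All)
  show ?thesis using 1 2 by blast
qed

end
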